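(* Let $N\ge2$, $V_\pm>0$, $\rho_\pm>0$, $\gamma\ge0$, and let $\Omega=\Omega(\alpha,\beta,R_\pm)$ be a type II minimizer of the problem $(\mathrm{P})$ $$\min\left\{\mathcal F(\Omega):\ \Omega\subset\mathbb R^N \text{ is of finite perimeter},\ \rho_-|\Omega_-|=V_-,\ \rho_+|\Omega_+|=V_+\right\}.$$ If $R_-\sin\alpha>R_+\sin\beta$, then $$\rho_-\cos\alpha=\gamma=\rho_+\cos\beta.$$ On the other hand, if $R_-\sin\alpha<R_+\sin\beta$, then $$\rho_-\cos\alpha=-\gamma=\rho_+\cos\beta.$$
   Context: Let $\mathbb R^N_-=\{x_1<0\}$, $\mathbb R^N_+=\{x_1>0\}$, $\Sigma=\{x_1=0\}$, $e_1=(1,0,\dots,0)$. For a set of finite perimeter $\Omega\subset\mathbb R^N$ put $\Omega_\pm=\Omega\cap\mathbb R^N_\pm$, $\Gamma_\pm=\partial\Omega\cap\mathbb R^N_\pm$, $\Gamma_0=\partial\Omega\cap\Sigma$. Here $|\cdot|$ is Lebesgue measure, $P(\Omega,A)$ is the relative perimeter of $\Omega$ in $A$ in the sense of De Giorgi, and $\mathcal H^{N-1}$ is Hausdorff measure. The functional is $$\mathcal F(\Omega)=\rho_-P(\Omega,\mathbb R^N_-)+\rho_+P(\Omega,\mathbb R^N_+)+\gamma\,\mathcal H^{N-1}(\Gamma_0).$$ Convention: sets of finite perimeter are identified when they differ by a Lebesgue-null set, and $\partial\Omega$ denotes the topological boundary of a representative with $\partial\Omega=\{x:0<|\Omega\cap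 B(x,r)|<|B(x,r)|\ \forall r>0\}$ (the support of the Gauss–Green measure). Candidate sets: for $\alpha\in[0,\pi)$, $\beta\in(0,\pi]$, $R_\pm>0$, let $\Omega(\alpha,\beta,R_\pm)=(B_-\cap\{x_1\le 0\})\cup(B_+\cap\{x_1\ge 0\})$, where $B_-$ is the closed ball of radius $R_-$ centered at $ae_1$ with $a=-R_-\cos\alpha$ and $B_+$ is the closed ball of radius $R_+$ centered at $be_1$ with $b=-R_+\cos\beta$. A minimizer $\Omega$ is of type II if it is connected, $\Gamma_-$ and $\Gamma_+$ are spherical caps (parts in $\mathbb R^N_\pm$ of spheres crossing $\Sigma$), $\overline\Omega\cap\Sigma$ is an $(N-1)$-dimensional ball, and the boundaries of the manifolds $\Gamma_-$ and $\Gamma_+$ are $(N-2)$-spheres in $\Sigma$ with distinct radii (so $\mathcal H^{N-1}(\Gamma_0)>0$). For $\Omega(\alpha,\beta,R_\pm)$ this means $\alpha,\beta\in(0,\pi)$ and $R_-\sin\alpha\ne R_+\sin\beta$. *)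

theory Defs
  imports "HOL-Analysis.Analysis"
begin

text \<open>
  The ambient space \<open>\<real>\<^sup>N\<close> is a type of class \<open>euclidean_space\<close> with \<open>N = DIM('a)\<close>, and \<open>e\<close>
  is the basis vector \<open>e\<^sub>1\<close>, so that the first coordinate of \<open>x\<close> is \<open>x \<bullet> e\<close>.
\<close>

definition half_neg :: "'a::euclidean_space \<Rightarrow> 'a set" where
  "half_neg e = {x. x \<bullet> e < 0}"

definition half_pos :: "'a::euclidean_space \<Rightarrow> 'a set" where
  "half_pos e = {x. x \<bullet> e > 0}"

definition interface :: "'a::euclidean_space \<Rightarrow> 'a set" where
  "interface e = {x. x \<bullet> e = 0}"


definition divergence :: "('a::euclidean_space \<Rightarrow> 'a) \<Rightarrow> 'a \<Rightarrow> real" where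
  "divergence \<phi> x = (\<Sum>i\<in>Basis. frechet_derivative \<phi> (at x) i \<bullet> i)"

definition C1c_fields :: "'a::euclidean_space set \<Rightarrow> ('a \<Rightarrow> 'a) set" where
  "C1c_fields A = {\<phi>.
     (\<exists>\<phi>' :: 'a \<Rightarrow> 'a \<Rightarrow>\<^sub>L 'a.
        (\<forall>x. (\<phi> has_derivative blinfun_apply (\<phi>' x)) (at x)) \<and> continuous_on UNIV \<phi>') \<and>
     compact (closure {x. \<phi> x \<noteq> 0}) \<and> closure {x. \<phi> x \<noteq> 0} \<subseteq> A}"

text \<open>
  De Giorgi's relative perimeter of \<open>E\<close> in an open set \<open>A\<close>. The truncation of negative values by
  \<open>ennreal\<close> is harmless, since \<open>\<phi> = 0\<close> is a competitor.
\<close>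

definition perimeter :: "'a::euclidean_space set \<Rightarrow> 'a set \<Rightarrow> ennreal" where
  "perimeter E A =
     (SUP \<phi> \<in> {\<phi> \<in> C1c_fields A. \<forall>x. norm (\<phi> x) \<le> 1}. ennreal (LINT x:E|lebesgue. divergence \<phi> x))"

definition finite_perimeter :: "'a::euclidean_space set \<Rightarrow> bool" where
  "finite_perimeter E \<longleftrightarrow> E \<in> sets lebesgue \<and> perimeter E UNIV < \<infinity>"


text \<open>
  Hausdorff measure of integer dimension \<open>k\<close>, with the normalising constant
  \<open>\<omega>\<^sub>k = \<pi>\<^bsup>k/2\<^esup> / \<Gamma>(k/2 + 1)\<close>, so that it agrees with Lebesgue measure on \<open>k\<close>-dimensional planes.
  Boundedness of the covering sets is required because \<open>diameter\<close> is meaningless on unbounded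
  sets; empty covering sets contribute \<open>0\<close> also for \<open>k = 0\<close>.
\<close>

definition hausdorff_pre :: "nat \<Rightarrow> real \<Rightarrow> 'a::metric_space set \<Rightarrow> ennreal" where
  "hausdorff_pre k \<delta> A =
     (INF U \<in> {U :: nat \<Rightarrow> 'a set. A \<subseteq> (\<Union>i. U i) \<and> (\<forall>i. bounded (U i) \<and> diameter (U i) \<le> \<delta>)}.
        \<Sum>i. if U i = {} then 0
            else ennreal (unit_ball_vol (real k) * (diameter (U i) / 2) ^ k))"

definition hausdorff_measure :: "nat \<Rightarrow> 'a::metric_space set \<Rightarrow> ennreal" where
  "hausdorff_measure k A = (SUP \<delta>\<in>{0<..}. hausdorff_pre k \<delta> A)"


text \<open>
  Sets of finite perimeter are identified when they differ by a null set, and \<open>\<partial>\<Omega>\<close> is the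
  topological boundary of a representative for which that boundary is the support of the
  Gauss-Green measure. This support depends only on the equivalence class of \<open>\<Omega>\<close>; it is taken as
  \<open>\<partial>\<Omega>\<close>, so that no choice of representative is needed.
\<close>

definition bdry :: "'a::euclidean_space set \<Rightarrow> 'a set" where
  "bdry \<Omega> = {x. \<forall>r>0. 0 < emeasure lebesgue (\<Omega> \<inter> ball x r) \<and>
                     emeasure lebesgue (\<Omega> \<inter> ball x r) < emeasure lebesgue (ball x r)}"

definition Gamma_neg :: "'a::euclidean_space \<Rightarrow> 'a set \<Rightarrow> 'a set" where
  "Gamma_neg e \<Omega> = bdry \<Omega> \<inter> half_neg e"

definition Gamma_pos :: "'a::euclidean_space \<Rightarrow> 'a set \<Rightarrow> 'a set" where
  "Gamma_pos e \<Omega> = bdry \<Omega> \<inter> half_pos e"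

definition Gamma_zero :: "'a::euclidean_space \<Rightarrow> 'a set \<Rightarrow> 'a set" where
  "Gamma_zero e \<Omega> = bdry \<Omega> \<inter> interface e"

definition energy :: "'a::euclidean_space \<Rightarrow> real \<Rightarrow> real \<Rightarrow> real \<Rightarrow> 'a set \<Rightarrow> ennreal" where
  "energy e \<rho>m \<rho>p \<gamma> \<Omega> =
     ennreal \<rho>m * perimeter \<Omega> (half_neg e) + ennreal \<rho>p * perimeter \<Omega> (half_pos e)
     + ennreal \<gamma> * hausdorff_measure (DIM('a) - 1) (Gamma_zero e \<Omega>)"

definition admissible ::
    "'a::euclidean_space \<Rightarrow> real \<Rightarrow> real \<Rightarrow> real \<Rightarrow> real \<Rightarrow> 'a set \<Rightarrow> bool" where
  "admissible e \<rho>m \<rho>p Vm Vp \<Omega> \<longleftrightarrow>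
     finite_perimeter \<Omega> \<and>
     ennreal \<rho>m * emeasure lebesgue (\<Omega> \<inter> half_neg e) = ennreal Vm \<and>
     ennreal \<rho>p * emeasure lebesgue (\<Omega> \<inter> half_pos e) = ennreal Vp"

definition minimizer ::
    "'a::euclidean_space \<Rightarrow> real \<Rightarrow> real \<Rightarrow> real \<Rightarrow> real \<Rightarrow> real \<Rightarrow> 'a set \<Rightarrow> bool" where
  "minimizer e \<rho>m \<rho>p \<gamma> Vm Vp \<Omega> \<longleftrightarrow>
     admissible e \<rho>m \<rho>p Vm Vp \<Omega> \<and>
     (\<forall>E. admissible e \<rho>m \<rho>p Vm Vp E \<longrightarrow> energy e \<rho>m \<rho>p \<gamma> \<Omega> \<le> energy e \<rho>m \<rho>p \<gamma> E)"


definition candidate :: "'a::euclidean_space \<Rightarrow> real \<Rightarrow> real \<Rightarrow> real \<Rightarrow> real \<Rightarrow> 'a set" where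
  "candidate e \<alpha> \<beta> Rm Rp =
     (cball ((- Rm * cos \<alpha>) *\<^sub>R e) Rm \<inter> {x. x \<bullet> e \<le> 0}) \<union>
     (cball ((- Rp * cos \<beta>) *\<^sub>R e) Rp \<inter> {x. x \<bullet> e \<ge> 0})"


text \<open>\<open>\<bar>c \<bullet> e\<bar> < r\<close> says that the sphere with centre \<open>c\<close> and radius \<open>r\<close> crosses the interface.\<close>

definition spherical_cap_in :: "'a::euclidean_space \<Rightarrow> 'a set \<Rightarrow> 'a set \<Rightarrow> bool" where
  "spherical_cap_in e H S \<longleftrightarrow> (\<exists>c r. \<bar>c \<bullet> e\<bar> < r \<and> S = sphere c r \<inter> H)"

definition interface_sphere :: "'a::euclidean_space \<Rightarrow> 'a set \<Rightarrow> real \<Rightarrow> bool" where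
  "interface_sphere e S s \<longleftrightarrow> s > 0 \<and> (\<exists>z\<in>interface e. S = sphere z s \<inter> interface e)"

text \<open>
  The caps \<open>\<Gamma>\<^sub>\<plusminus>\<close> do not contain their manifold boundary, which is thus \<open>closure \<Gamma>\<^sub>\<plusminus> - \<Gamma>\<^sub>\<plusminus>\<close>.
\<close>

definition type_II :: "'a::euclidean_space \<Rightarrow> 'a set \<Rightarrow> bool" where
  "type_II e \<Omega> \<longleftrightarrow>
     connected \<Omega> \<and>
     spherical_cap_in e (half_neg e) (Gamma_neg e \<Omega>) \<and>
     spherical_cap_in e (half_pos e) (Gamma_pos e \<Omega>) \<and>
     (\<exists>z\<in>interface e. \<exists>s>0. closure \<Omega> \<inter> interface e = cball z s \<inter> interface e) \<and>
     (\<exists>sm sp. sm \<noteq> sp \<and>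
        interface_sphere e (closure (Gamma_neg e \<Omega>) - Gamma_neg e \<Omega>) sm \<and>
        interface_sphere e (closure (Gamma_pos e \<Omega>) - Gamma_pos e \<Omega>) sp)"

end

theory Submission
  imports Defs
begin

text \<open>
  Keep one cap fixed and replace the other one by caps of the same volume, parametrised by
  \<open>\<tau> = c / R\<close>, where \<open>c\<close> is the signed height of the centre and \<open>R\<close> the radius
  (\<open>\<tau> = - cos \<alpha>\<close> on the left and, after reflection, \<open>\<tau> = cos \<beta>\<close> on the right). If
  \<open>v\<close> is the volume of the cap, \<open>P\<close> its perimeter in the half space and \<open>D\<close> the area of its
  base disc, then \<open>P = (N v + c D) / R\<close>, and \<open>dP = \<tau> dD\<close> along such a family. The contact set is
  an annulus, of area \<open>\<bar>D - D'\<bar>\<close> with \<open>D'\<close> the area of the other base disc, so that stationarity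
  reads \<open>(\<rho> \<tau> + \<gamma> sgn (D - D')) dD = 0\<close>; finally \<open>dD \<noteq> 0\<close> because a cap is smaller than its
  tangent cone.

  The upper bound for \<open>P\<close> tests with radial ramps of vanishing width, the lower bound with the field
  \<open>(x - c) / R\<close> cut off near the interface. That the Hausdorff measure has the right constant on
  the interface rests on a Vitali covering by balls (upper bound) and on the isodiametric
  inequality (lower bound).
\<close>

section \<open>Slicing by hyperplanes and the volume of a cap\<close>

text \<open>A derivative of the energy along the competitors is taken, so estimates of perimeter or
  contact area up to a factor would be useless. Both are therefore evaluated exactly, straight from
  the supremum and the covering definition, and everything rests on one computation: slicing balls
  by planes parallel to the interface.

  The relation between dP and dD is Young's law: spheres have constant mean curvature, so at fixed
  volume the bulk part of the variation vanishes and only the contact angle survives. Concretely,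
  the volume constraint ties R to \<tau> in such a way that the variation of N v / R is - D d\<tau>,
  which cancels one of the two terms in the variation of \<tau> D.

  The two volumes are prescribed separately, so a single cap may move. The other side follows by
  replacing e with - e and exchanging the roles, which is why the statements about caps allow either
  sign of the basis vector. Distinct rim radii keep the absolute value of the difference of the
  areas away from its kink.\<close>

lemma emeasure_PiM_ball:
  assumes "finite A" "A \<noteq> {}" "r \<ge> 0"
  shows "emeasure (Pi\<^sub>M A (\<lambda>_. lborel))
           ({f. sqrt (\<Sum>i\<in>A. (f i)\<^sup>2) \<le> r} \<inter> space (Pi\<^sub>M A (\<lambda>_. lborel))) =
         ennreal (unit_ball_vol (real (card A)) * r ^ card A)"
proof (cases "r = 0")
  case False
  then show ?thesis using emeasure_cball_aux[of A r] assms by simp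
next
  \<comment> \<open>Slices degenerate to radius zero. Monotonicity bounds that case by every
    positive radius, and the bound tends to zero because \<open>A\<close> is nonempty.\<close>
  case True
  have card: "card A > 0" using assms by (simp add: card_gt_0_iff)
  let ?M = "Pi\<^sub>M A (\<lambda>_. lborel :: real measure)"
  let ?S = "\<lambda>r. {f. sqrt (\<Sum>i\<in>A. (f i)\<^sup>2) \<le> r} \<inter> space ?M"
  have lim: "((\<lambda>r. ennreal (unit_ball_vol (real (card A)) * r ^ card A)) \<longlongrightarrow>
      ennreal (unit_ball_vol (real (card A)) * 0 ^ card A)) (at_right 0)"
    by (intro tendsto_intros)
  have "emeasure ?M (?S 0) \<le> ennreal (unit_ball_vol (real (card A)) * 0 ^ card A)"
  proof (rule tendsto_lowerbound[OF lim])
    show "\<forall>\<^sub>F r in at_right 0. emeasure ?M (?S 0) \<le> ennreal (unit_ball_vol (real (card A)) * r ^ card A)"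
      using eventually_at_right_less[of 0]
    proof eventually_elim
      case (elim r)
      have "emeasure ?M (?S 0) \<le> emeasure ?M (?S r)"
        using elim by (intro emeasure_mono) (auto simp del: real_sqrt_le_0_iff)
      then show ?case using emeasure_cball_aux[of A r] assms elim by simp
    qed
  qed simp
  then show ?thesis using True card by (simp add: zero_power)
qed

lemma borel_measurable_orth_part [measurable]:
  "(\<lambda>x::'a::euclidean_space. norm (x - (x \<bullet> e) *\<^sub>R e)) \<in> borel_measurable borel"
  by (intro borel_measurable_continuous_onI continuous_intros)

text \<open>Tonelli with the coordinate along \<open>e\<close> split off: \<open>lborel\<close> is
  the image of a product over \<open>Basis\<close>, and the other coordinates range over a ball of
  dimension \<open>DIM('a) - 1\<close>. A radius depending on the height covers both balls and
  straight cylinders.\<close>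

lemma nn_integral_cylinder:
  fixes e :: "'a::euclidean_space" and f :: "real \<Rightarrow> ennreal" and \<rho> :: "real \<Rightarrow> real"
  assumes e: "e \<in> Basis" and dim: "DIM('a) \<ge> 2"
    and [measurable]: "f \<in> borel_measurable borel" "\<rho> \<in> borel_measurable borel"
    and \<rho>: "\<And>s. \<rho> s \<ge> 0"
  shows "(\<integral>\<^sup>+x. f (x \<bullet> e) * indicator {x. norm (x - (x \<bullet> e) *\<^sub>R e) \<le> \<rho> (x \<bullet> e)} x \<partial>lborel) =
         (\<integral>\<^sup>+s. f s * ennreal (unit_ball_vol (DIM('a) - 1) * \<rho> s ^ (DIM('a) - 1)) \<partial>lborel)"
proof -
  interpret product_sigma_finite "\<lambda>_::'a. lborel :: real measure" by standard
  let ?B = "Basis - {e} :: 'a set"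
  have ins: "insert e ?B = Basis" using e by auto
  have cardB: "card ?B = DIM('a) - 1" using e by (simp add: card_Diff_singleton)
  have neB: "?B \<noteq> {}"
  proof
    assume "?B = {}"
    then have "card ?B = 0" by (simp only: card.empty)
    then show False using cardB dim by simp
  qed
  have inner: "(\<Sum>b\<in>Basis. g b *\<^sub>R b) \<bullet> e = g e" for g :: "'a \<Rightarrow> real"
    using e by (simp add: inner_sum_left inner_Basis if_distrib cong: if_cong)
  have orth: "norm ((\<Sum>b\<in>Basis. g b *\<^sub>R b) - g e *\<^sub>R e) = sqrt (\<Sum>b\<in>?B. (g b)\<^sup>2)" for g :: "'a \<Rightarrow> real"
  proof -
    have "(\<Sum>b\<in>Basis. g b *\<^sub>R b) - g e *\<^sub>R e = (\<Sum>b\<in>?B. g b *\<^sub>R b)"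
      using e by (subst sum.remove[of _ e]) auto
    moreover have "norm (\<Sum>b\<in>?B. g b *\<^sub>R b) = sqrt (\<Sum>b\<in>?B. (g b)\<^sup>2)"
      by (rule norm_eq_sqrt_inner[THEN trans], rule arg_cong[where f = sqrt])
         (auto simp: inner_sum_left inner_sum_right inner_Basis power2_eq_square if_distrib
            intro!: sum.cong cong: if_cong)
    ultimately show ?thesis by simp
  qed
  have "(\<integral>\<^sup>+x. f (x \<bullet> e) * indicator {x. norm (x - (x \<bullet> e) *\<^sub>R e) \<le> \<rho> (x \<bullet> e)} x \<partial>lborel)
      = (\<integral>\<^sup>+g. f (g e) * indicator {g. sqrt (\<Sum>b\<in>?B. (g b)\<^sup>2) \<le> \<rho> (g e)} g \<partial>Pi\<^sub>M Basis (\<lambda>_. lborel))"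
    by (subst lborel_eq, subst nn_integral_distr)
       (auto intro!: nn_integral_cong simp: inner orth indicator_def)
  also have "\<dots> = (\<integral>\<^sup>+y. \<integral>\<^sup>+g. f y * indicator {g. sqrt (\<Sum>b\<in>?B. (g b)\<^sup>2) \<le> \<rho> y} g
       \<partial>Pi\<^sub>M ?B (\<lambda>_. lborel) \<partial>lborel)"
  proof -
    have m: "(\<lambda>g. f (g e) * indicator {g. sqrt (\<Sum>b\<in>?B. (g b)\<^sup>2) \<le> \<rho> (g e)} g)
       \<in> borel_measurable (Pi\<^sub>M (insert e ?B) (\<lambda>_. lborel))"
    proof -
      let ?M = "Pi\<^sub>M (insert e ?B) (\<lambda>_. borel :: real measure)"
      have [measurable]: "(\<lambda>g. g e) \<in> borel_measurable ?M"
        using measurable_component_singleton[of e "insert e ?B" "\<lambda>_. borel :: real measure"] by simp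
      have sum: "(\<lambda>g. \<Sum>b\<in>?B. (g b)\<^sup>2) \<in> borel_measurable ?M"
      proof (intro borel_measurable_sum borel_measurable_power)
        fix b assume "b \<in> ?B"
        then show "(\<lambda>g. g b) \<in> borel_measurable ?M"
          using measurable_component_singleton[of b "insert e ?B" "\<lambda>_. borel :: real measure"] by simp
      qed
      have [measurable]: "(\<lambda>g. \<rho> (g e)) \<in> borel_measurable ?M" "(\<lambda>g. f (g e)) \<in> borel_measurable ?M"
        by (rule measurable_compose[where N = borel]; simp)+
      have "(\<lambda>g. sqrt (\<Sum>b\<in>?B. (g b)\<^sup>2)) \<in> borel_measurable ?M"
        by (rule measurable_compose[OF sum]) simp
      then have [measurable]: "Measurable.pred ?M (\<lambda>g. sqrt (\<Sum>b\<in>?B. (g b)\<^sup>2) \<le> \<rho> (g e))"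
        unfolding pred_def by (rule borel_measurable_le) measurable
      have "(\<lambda>g. f (g e) * indicator {g. sqrt (\<Sum>b\<in>?B. (g b)\<^sup>2) \<le> \<rho> (g e)} g) \<in> borel_measurable ?M"
        by measurable
      then show ?thesis
        by (simp cong: measurable_cong_sets sets_PiM_cong)
    qed
    have "(\<integral>\<^sup>+g. f (g e) * indicator {g. sqrt (\<Sum>b\<in>?B. (g b)\<^sup>2) \<le> \<rho> (g e)} g \<partial>Pi\<^sub>M (insert e ?B) (\<lambda>_. lborel))
      = (\<integral>\<^sup>+y. \<integral>\<^sup>+g. f ((g(e := y)) e) * indicator {g. sqrt (\<Sum>b\<in>?B. (g b)\<^sup>2) \<le> \<rho> (g e)} (g(e := y))
       \<partial>Pi\<^sub>M ?B (\<lambda>_. lborel) \<partial>lborel)"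
      by (rule product_nn_integral_insert_rev) (use m in auto)
    then show ?thesis unfolding ins
      by (auto simp: indicator_def intro!: nn_integral_cong)
  qed
  also have "\<dots> = (\<integral>\<^sup>+s. f s * ennreal (unit_ball_vol (DIM('a) - 1) * \<rho> s ^ (DIM('a) - 1)) \<partial>lborel)"
  proof (intro nn_integral_cong)
    fix y :: real
    have m: "{g. sqrt (\<Sum>b\<in>?B. (g b)\<^sup>2) \<le> \<rho> y} \<inter> space (Pi\<^sub>M ?B (\<lambda>_. lborel)) \<in> sets (Pi\<^sub>M ?B (\<lambda>_. lborel :: real measure))"
      by measurable
    have "(\<integral>\<^sup>+g. f y * indicator {g. sqrt (\<Sum>b\<in>?B. (g b)\<^sup>2) \<le> \<rho> y} g \<partial>Pi\<^sub>M ?B (\<lambda>_. lborel))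
       = (\<integral>\<^sup>+g. f y * indicator ({g. sqrt (\<Sum>b\<in>?B. (g b)\<^sup>2) \<le> \<rho> y} \<inter> space (Pi\<^sub>M ?B (\<lambda>_. lborel))) g \<partial>Pi\<^sub>M ?B (\<lambda>_. lborel))"
      by (intro nn_integral_cong) (auto simp: indicator_def)
    also have "\<dots> = f y * ennreal (unit_ball_vol (DIM('a) - 1) * \<rho> y ^ (DIM('a) - 1))"
      using emeasure_PiM_ball[of ?B "\<rho> y"] neB \<rho>[of y] cardB m dim
      by (subst nn_integral_cmult_indicator) (auto simp: of_nat_diff)
    finally show "(\<integral>\<^sup>+g. f y * indicator {g. sqrt (\<Sum>b\<in>?B. (g b)\<^sup>2) \<le> \<rho> y} g \<partial>Pi\<^sub>M ?B (\<lambda>_. lborel))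
      = f y * ennreal (unit_ball_vol (DIM('a) - 1) * \<rho> y ^ (DIM('a) - 1))" .
  qed
  finally show ?thesis .
qed

section \<open>Slices of a ball by parallel planes\<close>

lemma cball_in_borel [measurable]: "cball c r \<in> sets borel"
  by simp

text \<open>The \<open>n\<close>-dimensional volume of the slice of an
  \<open>(n + 1)\<close>-dimensional ball of radius \<open>R\<close> at signed distance
  \<open>s\<close> from its centre. Clipping by \<open>max 0\<close> keeps it continuous and, for
  \<open>n > 0\<close>, makes it vanish where the plane misses the ball.\<close>

definition slice_density :: "nat \<Rightarrow> real \<Rightarrow> real \<Rightarrow> real" where
  "slice_density n R s = unit_ball_vol n * sqrt (max 0 (R\<^sup>2 - s\<^sup>2)) ^ n"

lemma slice_density_nonneg [simp]: "slice_density n R s \<ge> 0"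
  by (simp add: slice_density_def)

lemma continuous_on_slice_density [continuous_intros]:
  "continuous_on A f \<Longrightarrow> continuous_on A (\<lambda>x. slice_density n R (f x))"
  unfolding slice_density_def by (intro continuous_intros)

lemma borel_measurable_slice_density [measurable]: "slice_density n R \<in> borel_measurable borel"
  by (intro borel_measurable_continuous_onI continuous_intros)

lemma slice_density_minus [simp]: "slice_density n R (- s) = slice_density n R s"
  by (simp add: slice_density_def)

lemma slice_density_zero: "n > 0 \<Longrightarrow> R \<ge> 0 \<Longrightarrow> R \<le> \<bar>s\<bar> \<Longrightarrow> slice_density n R s = 0"
  using power_mono[of R "\<bar>s\<bar>" 2] by (simp add: slice_density_def max_def)

lemma slice_density_le:
  assumes "R \<ge> 0"
  shows "slice_density n R s \<le> unit_ball_vol n * R ^ n"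
proof -
  have "sqrt (max 0 (R\<^sup>2 - s\<^sup>2)) \<le> sqrt (R\<^sup>2)" by (intro real_sqrt_le_mono) auto
  then have "sqrt (max 0 (R\<^sup>2 - s\<^sup>2)) ^ n \<le> R ^ n" using assms by (intro power_mono) auto
  then show ?thesis unfolding slice_density_def by (intro mult_left_mono) auto
qed

lemma slice_density_scale: "R \<ge> 0 \<Longrightarrow> slice_density n R (R * s) = R ^ n * slice_density n 1 s"
proof -
  assume R: "R \<ge> 0"
  have "max 0 (R\<^sup>2 - (R * s)\<^sup>2) = R\<^sup>2 * max 0 (1 - s\<^sup>2)"
    by (simp add: max_mult_distrib_left power_mult_distrib algebra_simps)
  then show ?thesis using R
    by (simp add: slice_density_def real_sqrt_mult power_mult_distrib)
qed

lemma norm_orth_part_squared: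
  fixes e x :: "'a::real_inner"
  assumes "norm e = 1"
  shows "(norm (x - (x \<bullet> e) *\<^sub>R e))\<^sup>2 = (norm x)\<^sup>2 - (x \<bullet> e)\<^sup>2"
  using assms unfolding power2_norm_eq_inner norm_eq_1
  by (simp add: inner_diff_left inner_diff_right power2_eq_square inner_commute)

lemma norm_orth_part_le:
  fixes e x :: "'a::real_inner"
  assumes "norm e = 1"
  shows "norm (x - (x \<bullet> e) *\<^sub>R e) \<le> norm x"
  by (rule power2_le_imp_le) (simp_all add: norm_orth_part_squared[OF assms])

text \<open>Pythagoras along the axis. The bound on the height has to be kept separate: beyond
  height \<open>R\<close> the clipped square root is zero, which points on the axis would still
  satisfy.\<close>

lemma mem_cball_slice:
  fixes e x c :: "'a::euclidean_space"
  assumes "norm e = 1" "R \<ge> 0"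
  shows "x \<in> cball c R \<longleftrightarrow> \<bar>(x - c) \<bullet> e\<bar> \<le> R \<and>
    norm ((x - c) - ((x - c) \<bullet> e) *\<^sub>R e) \<le> sqrt (max 0 (R\<^sup>2 - ((x - c) \<bullet> e)\<^sup>2))"
proof -
  define y where "y = x - c"
  note n = norm_orth_part_squared[OF assms(1), of y]
  have "norm y \<le> R \<longleftrightarrow> (norm y)\<^sup>2 \<le> R\<^sup>2" using assms by (simp add: abs_le_square_iff[symmetric])
  also have "\<dots> \<longleftrightarrow> \<bar>y \<bullet> e\<bar> \<le> R \<and> (norm (y - (y \<bullet> e) *\<^sub>R e))\<^sup>2 \<le> max 0 (R\<^sup>2 - (y \<bullet> e)\<^sup>2)"
  proof -
    have "\<bar>y \<bullet> e\<bar> \<le> R \<longleftrightarrow> (y \<bullet> e)\<^sup>2 \<le> R\<^sup>2" using assms abs_le_square_iff[of "y \<bullet> e" R] by simp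
    moreover have "0 \<le> (norm y)\<^sup>2 - (y \<bullet> e)\<^sup>2" unfolding n[symmetric] by simp
    ultimately show ?thesis unfolding n by (auto simp: max_def)
  qed
  also have "(norm (y - (y \<bullet> e) *\<^sub>R e))\<^sup>2 \<le> max 0 (R\<^sup>2 - (y \<bullet> e)\<^sup>2) \<longleftrightarrow>
      norm (y - (y \<bullet> e) *\<^sub>R e) \<le> sqrt (max 0 (R\<^sup>2 - (y \<bullet> e)\<^sup>2))"
    by (metis norm_ge_zero real_le_rsqrt real_sqrt_le_iff real_sqrt_abs abs_norm_cancel)
  finally show ?thesis by (simp add: y_def dist_norm norm_minus_commute)
qed

text \<open>The radius of the slice at height \<open>s\<close> comes from
  \<open>mem_cball_slice\<close>. The case \<open>- e \<in> Basis\<close> follows by the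
  substitution \<open>s\<close> to \<open>- s\<close>, as slices depend only on the distance to the
  centre.\<close>

lemma nn_integral_ball_slices:
  fixes e c :: "'a::euclidean_space" and f :: "real \<Rightarrow> ennreal"
  assumes e: "e \<in> Basis \<or> - e \<in> Basis" and dim: "DIM('a) \<ge> 2" and R: "R \<ge> 0"
    and [measurable]: "f \<in> borel_measurable borel"
  shows "(\<integral>\<^sup>+x. f (x \<bullet> e) * indicator (cball c R) x \<partial>lborel) =
         (\<integral>\<^sup>+s. f s * ennreal (slice_density (DIM('a) - 1) R (s - c \<bullet> e)) \<partial>lborel)"
proof -
  let ?n = "DIM('a) - 1"
  have main: "(\<integral>\<^sup>+x. f (x \<bullet> e) * indicator (cball c R) x \<partial>lborel) =
         (\<integral>\<^sup>+s. f s * ennreal (slice_density ?n R (s - c \<bullet> e)) \<partial>lborel)"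
    if e: "e \<in> Basis" and [measurable]: "f \<in> borel_measurable borel" for e c :: 'a and f :: "real \<Rightarrow> ennreal"
  proof -
    have e1: "norm e = 1" using e by simp
    have "(\<integral>\<^sup>+x. f (x \<bullet> e) * indicator (cball c R) x \<partial>lborel)
      = (\<integral>\<^sup>+x. f ((c + x) \<bullet> e) * indicator (cball c R) (c + x) \<partial>lborel)"
      by (subst lborel_distr_plus[symmetric, of c], subst nn_integral_distr) auto
    also have "\<dots> = (\<integral>\<^sup>+x. (\<lambda>s. f (s + c \<bullet> e) * indicator {-R..R} s) (x \<bullet> e) *
        indicator {x. norm (x - (x \<bullet> e) *\<^sub>R e) \<le> (\<lambda>s. sqrt (max 0 (R\<^sup>2 - s\<^sup>2))) (x \<bullet> e)} x \<partial>lborel)"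
      using mem_cball_slice[OF e1 R, of _ c]
      by (intro nn_integral_cong) (auto simp: indicator_def inner_add_left add.commute)
    also have "\<dots> = (\<integral>\<^sup>+s. f (s + c \<bullet> e) * indicator {-R..R} s *
        ennreal (unit_ball_vol ?n * sqrt (max 0 (R\<^sup>2 - s\<^sup>2)) ^ ?n) \<partial>lborel)"
      by (subst nn_integral_cylinder[OF e dim]) (auto intro!: borel_measurable_continuous_onI continuous_intros)
    also have "\<dots> = (\<integral>\<^sup>+s. f (s + c \<bullet> e) * ennreal (slice_density ?n R s) \<partial>lborel)"
    proof (intro nn_integral_cong)
      fix s :: real
      show "f (s + c \<bullet> e) * indicator {-R..R} s * ennreal (unit_ball_vol ?n * sqrt (max 0 (R\<^sup>2 - s\<^sup>2)) ^ ?n)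
         = f (s + c \<bullet> e) * ennreal (slice_density ?n R s)"
      proof (cases "s \<in> {-R..R}")
        case False
        then have "slice_density ?n R s = 0" using dim R by (intro slice_density_zero) auto
        then show ?thesis using False by simp
      qed (simp add: slice_density_def)
    qed
    also have "\<dots> = (\<integral>\<^sup>+s. f s * ennreal (slice_density ?n R (s - c \<bullet> e)) \<partial>lborel)"
      by (subst (2) nn_integral_real_affine[of _ 1 "c \<bullet> e"]) (auto simp: add.commute)
    finally show ?thesis .
  qed
  show ?thesis
  proof (cases "e \<in> Basis")
    case False
    then have e: "- e \<in> Basis" using e by simp
    have "(\<integral>\<^sup>+x. f (x \<bullet> e) * indicator (cball c R) x \<partial>lborel)
      = (\<integral>\<^sup>+x. (\<lambda>s. f (- s)) (x \<bullet> (- e)) * indicator (cball c R) x \<partial>lborel)" by simp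
    also have "\<dots> = (\<integral>\<^sup>+s. f (- s) * ennreal (slice_density ?n R (s - c \<bullet> (- e))) \<partial>lborel)"
      by (rule main[OF e]) simp
    also have "\<dots> = (\<integral>\<^sup>+s. f s * ennreal (slice_density ?n R (s - c \<bullet> e)) \<partial>lborel)"
    proof (subst nn_integral_real_affine[of _ "-1" 0], goal_cases)
      case 3
      have "slice_density ?n R (- s + c \<bullet> e) = slice_density ?n R (s - c \<bullet> e)" for s
        using slice_density_minus[of ?n R "s - c \<bullet> e"] by (simp add: algebra_simps)
      then show ?case by simp
    qed auto
    finally show ?thesis .
  qed (use main in auto)
qed

text \<open>As an identity of measures, slicing transfers from nonnegative to signed integrands
  without splitting them.\<close>

lemma distr_ball_slices:
  fixes e c :: "'a::euclidean_space"
  assumes e: "e \<in> Basis \<or> - e \<in> Basis" and dim: "DIM('a) \<ge> 2" and R: "R \<ge> 0"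
  shows "distr (density lborel (indicator (cball c R))) borel (\<lambda>x. x \<bullet> e) =
         density lborel (\<lambda>s. ennreal (slice_density (DIM('a) - 1) R (s - c \<bullet> e)))" (is "?L = ?R")
proof (rule measure_eqI)
  fix A assume "A \<in> sets ?L"
  then have [measurable]: "A \<in> sets borel" by simp
  have [measurable]: "(\<lambda>x::'a. x \<bullet> e) -` A \<in> sets borel"
    by (rule measurable_sets_borel[of _ borel]) auto
  have "emeasure ?L A = (\<integral>\<^sup>+x. indicator A (x \<bullet> e) * indicator (cball c R) x \<partial>lborel)"
    by (subst emeasure_distr, measurable, subst emeasure_density)
       (auto simp: indicator_def mult.commute intro!: nn_integral_cong)
  also have "\<dots> = emeasure ?R A"
    by (subst nn_integral_ball_slices[OF assms]) (auto simp: emeasure_density mult.commute)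
  finally show "emeasure ?L A = emeasure ?R A" .
qed simp

lemma integral_ball_slices:
  fixes e c :: "'a::euclidean_space" and f :: "real \<Rightarrow> real"
  assumes e: "e \<in> Basis \<or> - e \<in> Basis" and dim: "DIM('a) \<ge> 2" and R: "R \<ge> 0"
    and [measurable]: "f \<in> borel_measurable borel"
  shows "(LINT x|lborel. indicator (cball c R) x * f (x \<bullet> e)) =
         (LINT s|lborel. slice_density (DIM('a) - 1) R (s - c \<bullet> e) * f s)"
proof -
  have "(LINT x|lborel. indicator (cball c R) x * f (x \<bullet> e)) =
      (LINT s|distr (density lborel (indicator (cball c R))) borel (\<lambda>x. x \<bullet> e). f s)"
    by (subst integral_distr, simp, simp, unfold ennreal_indicator[symmetric], subst integral_density) auto
  also have "\<dots> = (LINT s|lborel. slice_density (DIM('a) - 1) R (s - c \<bullet> e) * f s)"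
    unfolding distr_ball_slices[OF assms(1-3)] by (subst integral_density) auto
  finally show ?thesis .
qed

section \<open>Volume of a cap of the unit ball\<close>

lemma slice_density_eq: "\<bar>s\<bar> \<le> 1 \<Longrightarrow> slice_density n 1 s = unit_ball_vol n * sqrt (1 - s\<^sup>2) ^ n"
  using abs_square_le_1[of s] by (simp add: slice_density_def)

lemma slice_density_pos: "\<bar>s\<bar> < R \<Longrightarrow> slice_density n R s > 0"
  using power_strict_mono[of "\<bar>s\<bar>" R 2] by (simp add: slice_density_def max_def)

lemma has_real_derivative_slice_density:
  assumes "\<bar>s\<bar> < 1" "n > 0"
  shows "(slice_density n 1 has_real_derivative - (n * s * slice_density n 1 s / (1 - s\<^sup>2))) (at s)"
proof -
  have lt: "1 - s\<^sup>2 > 0" using assms abs_square_less_1[of s] by simp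
  define q where "q = sqrt (1 - s\<^sup>2)"
  have q: "q > 0" "q\<^sup>2 = 1 - s\<^sup>2" "q ^ n = q ^ (n - 1) * q"
    using lt power_minus_mult[OF assms(2), of q] by (auto simp: q_def)
  have "((\<lambda>s. sqrt (1 - s\<^sup>2)) has_real_derivative - s / q) (at s)"
    unfolding q_def using lt by (auto intro!: derivative_eq_intros simp: field_simps)
  then have "((\<lambda>s. unit_ball_vol n * sqrt (1 - s\<^sup>2) ^ n) has_real_derivative
      unit_ball_vol n * (n * (- s / q * q ^ (n - Suc 0)))) (at s)"
    unfolding q_def by (intro DERIV_cmult DERIV_power)
  also have "unit_ball_vol n * (n * (- s / q * q ^ (n - Suc 0))) = - (n * s * (unit_ball_vol n * q ^ n) / q\<^sup>2)"
    using q(1) unfolding q(3) by (simp add: field_simps power2_eq_square)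
  also have "\<dots> = - (n * s * slice_density n 1 s / (1 - s\<^sup>2))"
    using assms slice_density_eq[of s n] by (simp only: q(2)) (simp add: q_def)
  finally show ?thesis
    by (rule has_field_derivative_transform_within_open[of _ _ _ "{-1<..<1}"])
       (use assms slice_density_eq[of _ n] in auto)
qed

text \<open>The volume above height \<tau> in the unit ball of dimension \<open>n + 1\<close>:
  \<tau> = 1 is the empty cap and \<tau> = -1 the whole ball. After reflection and scaling it is the
  part below the interface of a ball with centre at height \<tau> R.\<close>

definition cap_volume :: "nat \<Rightarrow> real \<Rightarrow> real" where
  "cap_volume n \<tau> = integral {\<tau>..1} (slice_density n 1)"

lemma cap_volume_1 [simp]: "cap_volume n 1 = 0"
  by (simp add: cap_volume_def)

text \<open>Moves \<tau> to the upper limit, where continuity and differentiability of indefinite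
  integrals apply.\<close>

lemma cap_volume_split:
  assumes "\<bar>\<tau>\<bar> \<le> 1"
  shows "cap_volume n \<tau> = integral {-1..1} (slice_density n 1) - integral {-1..\<tau>} (slice_density n 1)"
proof -
  have "slice_density n 1 integrable_on {-1..1}"
    by (intro integrable_continuous_real continuous_on_slice_density[of _ "\<lambda>x. x"] continuous_on_id)
  then show ?thesis
    using Henstock_Kurzweil_Integration.integral_combine[of "-1" \<tau> 1 "slice_density n 1"] assms
    by (simp add: cap_volume_def abs_le_iff)
qed

lemma continuous_on_cap_volume: "continuous_on {-1..1} (cap_volume n)"
proof -
  have "continuous_on {-1..1} (\<lambda>\<tau>. integral {-1..1} (slice_density n 1) - integral {-1..\<tau>} (slice_density n 1))"
    by (intro continuous_intros indefinite_integral_continuous_1 integrable_continuous_real)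
  then show ?thesis
    by (rule continuous_on_eq) (auto simp: cap_volume_split)
qed

lemma has_real_derivative_cap_volume:
  assumes "\<bar>\<tau>\<bar> < 1"
  shows "(cap_volume n has_real_derivative - slice_density n 1 \<tau>) (at \<tau>)"
proof -
  have "((\<lambda>u. integral {-1..u} (slice_density n 1)) has_vector_derivative slice_density n 1 \<tau>) (at \<tau> within {-1..1})"
    using assms by (intro integral_has_vector_derivative continuous_intros) auto
  then have "((\<lambda>u. integral {-1..u} (slice_density n 1)) has_real_derivative slice_density n 1 \<tau>) (at \<tau>)"
    using assms by (simp add: has_real_derivative_iff_has_vector_derivative at_within_Icc_at)
  then have "((\<lambda>u. integral {-1..1} (slice_density n 1) - integral {-1..u} (slice_density n 1))
      has_real_derivative 0 - slice_density n 1 \<tau>) (at \<tau>)"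
    by (intro DERIV_diff DERIV_const)
  then show ?thesis
    unfolding diff_0
    by (rule has_field_derivative_transform_within_open[of _ _ _ "{-1<..<1}"])
       (use assms cap_volume_split[of _ n] in auto)
qed

lemma cap_volume_pos:
  assumes "\<bar>\<tau>\<bar> < 1"
  shows "cap_volume n \<tau> > 0"
proof -
  have "cap_volume n 1 < cap_volume n \<tau>"
  proof (rule DERIV_neg_imp_decreasing_open[of \<tau> 1])
    fix x assume "\<tau> < x" "x < 1"
    then show "\<exists>y. (cap_volume n has_real_derivative y) (at x) \<and> y < 0"
      using assms has_real_derivative_cap_volume[of x n] slice_density_pos[of x 1 n]
      by (intro exI[of _ "- slice_density n 1 x"]) auto
  next
    show "continuous_on {\<tau>..1} (cap_volume n)"
      by (rule continuous_on_subset[OF continuous_on_cap_volume]) (use assms in auto)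
  qed (use assms in auto)
  then show ?thesis by simp
qed

text \<open>Says that a spherical cap is smaller than the tangent cone over the same disc.\<close>

lemma cap_volume_less:
  assumes "\<bar>\<tau>\<bar> < 1" "n > 0"
  shows "(real n + 1) * \<tau> * cap_volume n \<tau> < slice_density n 1 \<tau> * (1 - \<tau>\<^sup>2)"
proof (cases "\<tau> \<le> 0")
  case True
  have "0 < slice_density n 1 \<tau> * (1 - \<tau>\<^sup>2)"
    using assms abs_square_less_1[of \<tau>] slice_density_pos[of \<tau> 1 n] by simp
  moreover have "(real n + 1) * \<tau> * cap_volume n \<tau> \<le> 0"
    using True cap_volume_pos[of \<tau> n] assms by (auto simp: mult_le_0_iff)
  ultimately show ?thesis by linarith
next
  case False
  let ?h = "\<lambda>\<tau>. slice_density n 1 \<tau> * (1 - \<tau>\<^sup>2) - (real n + 1) * \<tau> * cap_volume n \<tau>"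
  \<comment> \<open>\<open>?h\<close> vanishes at 1, so it suffices that it decreases on the way
    there. Both terms of its derivative are negative because only positive heights are met.\<close>
  have "?h 1 < ?h \<tau>"
  proof (rule DERIV_neg_imp_decreasing_open[of \<tau> 1 ?h])
    fix x assume x: "\<tau> < x" "x < 1"
    then have x1: "\<bar>x\<bar> < 1" "x > 0" using False by auto
    have lt: "1 - x\<^sup>2 > 0" using x1 abs_square_less_1[of x] by simp
    have "((\<lambda>x. 1 - x\<^sup>2) has_real_derivative - 2 * x) (at x)"
      "((\<lambda>x. (real n + 1) * x) has_real_derivative real n + 1) (at x)"
      by (auto intro!: derivative_eq_intros)
    then have "(?h has_real_derivative
        (- (n * x * slice_density n 1 x / (1 - x\<^sup>2))) * (1 - x\<^sup>2) + (- 2 * x) * slice_density n 1 x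
         - ((real n + 1) * cap_volume n x + (- slice_density n 1 x) * ((real n + 1) * x))) (at x)"
      using x1 assms
      by (intro DERIV_diff DERIV_mult has_real_derivative_slice_density has_real_derivative_cap_volume)
    also have "(- (n * x * slice_density n 1 x / (1 - x\<^sup>2))) * (1 - x\<^sup>2) + (- 2 * x) * slice_density n 1 x
         - ((real n + 1) * cap_volume n x + (- slice_density n 1 x) * ((real n + 1) * x))
       = - (x * slice_density n 1 x) - (real n + 1) * cap_volume n x"
      using lt by (simp add: field_simps)
    finally show "\<exists>y. (?h has_real_derivative y) (at x) \<and> y < 0"
    proof (intro exI conjI)
      have "x * slice_density n 1 x > 0" "(real n + 1) * cap_volume n x > 0"
        using x1 slice_density_pos[of x 1 n] cap_volume_pos[of x n] by auto
      then show "- (x * slice_density n 1 x) - (real n + 1) * cap_volume n x < 0" by linarith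
    qed
  qed (use assms in \<open>auto intro!: continuous_intros continuous_on_subset[OF continuous_on_cap_volume]\<close>)
  then show ?thesis by simp
qed

lemma emeasure_cap:
  fixes e :: "'a::euclidean_space"
  assumes e: "e \<in> Basis \<or> - e \<in> Basis" and dim: "DIM('a) \<ge> 2" and R: "R > 0" and \<tau>: "\<bar>\<tau>\<bar> \<le> 1"
  shows "emeasure lborel (cball ((\<tau> * R) *\<^sub>R e) R \<inter> {x. x \<bullet> e \<le> 0}) =
         ennreal (R ^ DIM('a) * cap_volume (DIM('a) - 1) \<tau>)"
proof -
  let ?n = "DIM('a) - 1"
  have n: "?n > 0" "DIM('a) = Suc ?n" using dim by auto
  have ee: "e \<bullet> e = 1" using e inner_same_Basis[of "-e"] inner_same_Basis[of e] by auto
  have "emeasure lborel (cball ((\<tau> * R) *\<^sub>R e) R \<inter> {x. x \<bullet> e \<le> 0})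
      = (\<integral>\<^sup>+x. indicator {..0} (x \<bullet> e) * indicator (cball ((\<tau> * R) *\<^sub>R e) R) x \<partial>lborel)"
  proof (subst nn_integral_indicator[symmetric])
    show "cball ((\<tau> * R) *\<^sub>R e) R \<inter> {x. x \<bullet> e \<le> 0} \<in> sets lborel" by measurable
  qed (intro nn_integral_cong, auto simp: indicator_def)
  also have "\<dots> = (\<integral>\<^sup>+s. indicator {..0} s * ennreal (slice_density ?n R (s - \<tau> * R)) \<partial>lborel)"
    using R by (subst nn_integral_ball_slices[OF e dim]) (auto simp: ee)
  \<comment> \<open>The substitution \<open>s = \<tau> * R - R * u\<close> reverses orientation, so
    heights below the interface become \<open>u \<ge> \<tau>\<close> in the unit ball.\<close>
  also have "\<dots> = ennreal R * (\<integral>\<^sup>+u. indicator {..0} (\<tau> * R - R * u) * ennreal (slice_density ?n R (- (R * u))) \<partial>lborel)"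
    using R by (subst nn_integral_real_affine[of _ "-R" "\<tau> * R"]) (auto simp del: slice_density_minus)
  also have "(\<integral>\<^sup>+u. indicator {..0} (\<tau> * R - R * u) * ennreal (slice_density ?n R (- (R * u))) \<partial>lborel)
     = (\<integral>\<^sup>+u. ennreal (indicator {\<tau>..1} u * (R ^ ?n * slice_density ?n 1 u)) \<partial>lborel)"
  proof (intro nn_integral_cong)
    fix u
    have "\<tau> * R - R * u \<le> 0 \<longleftrightarrow> \<tau> \<le> u" using R by (simp add: mult.commute)
    moreover have "u > 1 \<Longrightarrow> slice_density ?n 1 u = 0" using n by (intro slice_density_zero) auto
    ultimately show "indicator {..0} (\<tau> * R - R * u) * ennreal (slice_density ?n R (- (R * u)))
        = ennreal (indicator {\<tau>..1} u * (R ^ ?n * slice_density ?n 1 u))"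
      using R by (auto simp: indicator_def slice_density_scale)
  qed
  also have "\<dots> = ennreal (R ^ ?n * cap_volume ?n \<tau>)"
  proof (rule nn_integral_has_integral_lebesgue)
    show "((\<lambda>u. R ^ ?n * slice_density ?n 1 u) has_integral R ^ ?n * cap_volume ?n \<tau>) {\<tau>..1}"
      unfolding cap_volume_def
      by (intro has_integral_mult_right integrable_integral integrable_continuous_real continuous_intros)
  qed (use R in auto)
  also have "ennreal R * ennreal (R ^ ?n * cap_volume ?n \<tau>) = ennreal (R ^ DIM('a) * cap_volume ?n \<tau>)"
  proof -
    have "R ^ DIM('a) = R * R ^ ?n" using n(2) by (metis power_Suc)
    then show ?thesis using R by (simp add: ennreal_mult'[symmetric] mult.assoc)
  qed
  finally show ?thesis .
qed

section \<open>Difference quotients and the divergence\<close>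

text \<open>A continuous derivative vanishing off a compact set is bounded, and the bound is a
  Lipschitz constant. These constants dominate the integrands in the limits below.\<close>

lemma C1c_fieldsE:
  fixes \<phi> :: "'a::euclidean_space \<Rightarrow> 'a"
  assumes "\<phi> \<in> C1c_fields A"
  obtains \<phi>' :: "'a \<Rightarrow> 'a \<Rightarrow>\<^sub>L 'a" and L K where
    "\<And>x. (\<phi> has_derivative blinfun_apply (\<phi>' x)) (at x)"
    "continuous_on UNIV \<phi>'" "L \<ge> 0" "\<And>x. norm (\<phi>' x) \<le> L"
    "\<And>x y. norm (\<phi> x - \<phi> y) \<le> L * norm (x - y)"
    "compact K" "K \<subseteq> A" "\<And>x. x \<notin> K \<Longrightarrow> \<phi> x = 0" "\<And>x. x \<notin> K \<Longrightarrow> \<phi>' x = 0"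
    "\<And>x. divergence \<phi> x = (\<Sum>i\<in>Basis. blinfun_apply (\<phi>' x) i \<bullet> i)"
proof -
  define K where "K = closure {x. \<phi> x \<noteq> 0}"
  obtain \<phi>' :: "'a \<Rightarrow> 'a \<Rightarrow>\<^sub>L 'a" where d: "\<And>x. (\<phi> has_derivative blinfun_apply (\<phi>' x)) (at x)"
    and c: "continuous_on UNIV \<phi>'" and K: "compact K" "K \<subseteq> A"
    using assms by (auto simp: C1c_fields_def K_def)
  have zero: "\<phi> x = 0" if "x \<notin> K" for x
    using that closure_subset[of "{x. \<phi> x \<noteq> 0}"] by (auto simp: K_def)
  have zero': "\<phi>' x = 0" if "x \<notin> K" for x
  proof -
    have "open (- K)" using K by (simp add: compact_imp_closed open_Compl)
    then have "(\<phi> has_derivative (\<lambda>_. 0)) (at x)"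
      using has_derivative_transform_within_open[of "\<lambda>_. 0" "\<lambda>_. 0" x UNIV "- K" \<phi>] that zero by auto
    then have "blinfun_apply (\<phi>' x) = (\<lambda>_. 0)" using d[of x] has_derivative_unique by blast
    then show ?thesis by (simp add: blinfun_eqI)
  qed
  have "bounded (\<phi>' ` K)"
    using K c by (intro compact_imp_bounded compact_continuous_image continuous_on_subset[OF c]) auto
  then obtain L where L: "L > 0" "\<And>x. x \<in> K \<Longrightarrow> norm (\<phi>' x) \<le> L"
    unfolding bounded_pos by auto
  have L': "norm (\<phi>' x) \<le> L" for x using L zero'[of x] by (cases "x \<in> K") auto
  have lip: "norm (\<phi> x - \<phi> y) \<le> L * norm (x - y)" for x y
    by (rule differentiable_bound[of UNIV \<phi> "\<lambda>x. blinfun_apply (\<phi>' x)"])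
       (use d L' in \<open>auto simp: norm_blinfun.rep_eq[symmetric]\<close>)
  have div: "divergence \<phi> x = (\<Sum>i\<in>Basis. blinfun_apply (\<phi>' x) i \<bullet> i)" for x
    using frechet_derivative_at[OF d[of x]] by (simp add: divergence_def)
  show thesis by (rule that[OF d c _ L' lip K zero zero' div]) (use L in simp)
qed

lemma borel_measurable_divergence:
  fixes \<phi> :: "'a::euclidean_space \<Rightarrow> 'a"
  assumes "\<phi> \<in> C1c_fields A"
  shows "divergence \<phi> \<in> borel_measurable borel"
proof -
  obtain \<phi>' :: "'a \<Rightarrow> 'a \<Rightarrow>\<^sub>L 'a" where c: "continuous_on UNIV \<phi>'"
    and div: "\<And>x. divergence \<phi> x = (\<Sum>i\<in>Basis. blinfun_apply (\<phi>' x) i \<bullet> i)"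
    by (rule C1c_fieldsE[OF assms]) (rule that; assumption)
  have "continuous_on UNIV (divergence \<phi>)"
    unfolding div by (intro continuous_intros c)
  then show ?thesis by (rule borel_measurable_continuous_onI)
qed

lemma C1c_fields_continuous: "\<phi> \<in> C1c_fields A \<Longrightarrow> continuous_on UNIV \<phi>"
  unfolding C1c_fields_def
  by (blast intro: continuous_at_imp_continuous_on has_derivative_continuous)

lemma integrable_bounded_compact_support:
  fixes f :: "'a::euclidean_space \<Rightarrow> real"
  assumes [measurable]: "f \<in> borel_measurable borel" and "\<And>x. \<bar>f x\<bar> \<le> M" "compact K" "\<And>x. x \<notin> K \<Longrightarrow> f x = 0"
  shows "integrable lborel f"
proof (rule Bochner_Integration.integrable_bound)
  show "integrable lborel (\<lambda>x. M * indicator K x)"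
    using emeasure_compact_finite[OF assms(3)] compact_imp_closed[OF assms(3)]
    by (intro integrable_mult_right integrable_real_indicator) auto
  show "AE x in lborel. norm (f x) \<le> norm (M * indicator K x)"
  proof (rule AE_I2)
    fix x show "norm (f x) \<le> norm (M * indicator K x)"
      using assms(2)[of x] assms(4)[of x] by (cases "x \<in> K") auto
  qed
qed simp

lemma difference_quotient_limit:
  fixes \<phi> :: "'a::euclidean_space \<Rightarrow> 'a" and \<phi>' :: "'a \<Rightarrow> 'a \<Rightarrow>\<^sub>L 'a"
  assumes "(\<phi> has_derivative blinfun_apply (\<phi>' x)) (at x)"
  shows "(\<lambda>n. (\<phi> (x + inverse (real (Suc n)) *\<^sub>R i) \<bullet> i - \<phi> x \<bullet> i) / inverse (real (Suc n)))
    \<longlonglongrightarrow> blinfun_apply (\<phi>' x) i \<bullet> i"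
proof -
  let ?g = "\<lambda>s. \<phi> (x + s *\<^sub>R i) \<bullet> i"
  have "((\<lambda>s. x + s *\<^sub>R i) has_derivative (\<lambda>s. s *\<^sub>R i)) (at 0)"
    by (auto intro!: derivative_eq_intros)
  moreover have "(\<phi> has_derivative blinfun_apply (\<phi>' x)) (at (x + 0 *\<^sub>R i))" using assms by simp
  ultimately have "((\<lambda>s. \<phi> (x + s *\<^sub>R i)) has_derivative (\<lambda>s. blinfun_apply (\<phi>' x) (s *\<^sub>R i))) (at 0)"
    by (rule has_derivative_compose)
  then have "(?g has_derivative (\<lambda>s. blinfun_apply (\<phi>' x) (s *\<^sub>R i) \<bullet> i)) (at 0)"
    by (rule has_derivative_inner_left)
  then have "(?g has_real_derivative (blinfun_apply (\<phi>' x) i \<bullet> i)) (at 0)"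
  proof -
    have "(\<lambda>s. blinfun_apply (\<phi>' x) (s *\<^sub>R i) \<bullet> i) = (*) (blinfun_apply (\<phi>' x) i \<bullet> i)"
      by (auto simp: blinfun.scaleR_right)
    then show "(?g has_derivative (\<lambda>s. blinfun_apply (\<phi>' x) (s *\<^sub>R i) \<bullet> i)) (at 0) \<Longrightarrow> ?thesis"
      by (simp add: has_field_derivative_def)
  qed
  then have "(\<lambda>h. (?g (0 + h) - ?g 0) / h) \<midarrow>0\<rightarrow> blinfun_apply (\<phi>' x) i \<bullet> i"
    by (rule DERIV_D)
  moreover have "filterlim (\<lambda>n. inverse (real (Suc n))) (at 0) sequentially"
    using LIMSEQ_inverse_real_of_nat by (intro filterlim_atI) auto
  ultimately show ?thesis unfolding add_0
    by (simp only: scaleR_zero_left add_0_right) (erule filterlim_compose[where f = "\<lambda>n. inverse (real (Suc n))"])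
qed

text \<open>Discrete integration by parts: translation invariance of \<open>lborel\<close> moves the
  difference quotient from \<open>\<psi>\<close>, which is merely bounded and measurable, to the
  differentiable field, where dominated convergence takes the limit.\<close>

lemma integral_difference_quotient:
  fixes \<phi> :: "'a::euclidean_space \<Rightarrow> 'a" and \<phi>' :: "'a \<Rightarrow> 'a \<Rightarrow>\<^sub>L 'a" and \<psi> :: "'a \<Rightarrow> real"
  assumes [measurable]: "\<psi> \<in> borel_measurable borel" and M: "\<And>x. \<bar>\<psi> x\<bar> \<le> M"
    and d: "\<And>x. (\<phi> has_derivative blinfun_apply (\<phi>' x)) (at x)" and c: "continuous_on UNIV \<phi>'"
    and lip: "\<And>x y. norm (\<phi> x - \<phi> y) \<le> L * norm (x - y)"
    and K: "compact K" "\<And>x. x \<notin> K \<Longrightarrow> \<phi> x = 0" and i: "i \<in> Basis"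
  shows "(\<lambda>n. LINT x|lborel. (\<psi> (x - inverse (real (Suc n)) *\<^sub>R i) - \<psi> x) / inverse (real (Suc n)) * (\<phi> x \<bullet> i))
    \<longlonglongrightarrow> (LINT x|lborel. \<psi> x * (blinfun_apply (\<phi>' x) i \<bullet> i))"
proof -
  define t where "t n = inverse (real (Suc n))" for n
  have t: "0 < t n" "t n \<le> 1" for n by (auto simp: t_def inverse_le_1_iff)
  have M0: "M \<ge> 0" using M[of 0] by linarith
  have L0: "L \<ge> 0"
  proof -
    have "norm (\<phi> i - \<phi> 0) \<le> L * norm (i - 0)" by (rule lip)
    then show ?thesis using i norm_ge_zero[of "\<phi> i - \<phi> 0"] by (simp del: norm_ge_zero)
  qed
  have i1: "norm i = 1" using i by simp
  have cont: "continuous_on UNIV \<phi>"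
    using d by (auto intro!: continuous_at_imp_continuous_on has_derivative_continuous)
  have [measurable]: "\<phi> \<in> borel_measurable borel" by (rule borel_measurable_continuous_onI[OF cont])
  have [measurable]: "(\<lambda>x. blinfun_apply (\<phi>' x) i \<bullet> i) \<in> borel_measurable borel"
    by (intro borel_measurable_continuous_onI continuous_intros c)
  obtain B where B: "K \<subseteq> cball 0 B" using bounded_subset_ballD[OF compact_imp_bounded[OF K(1)], of 0] ball_subset_cball by blast
  have out: "\<phi> x = 0" if "norm x > B" for x using K(2)[of x] B that by fastforce
  have "bounded (\<phi> ` cball 0 B)"
    by (intro compact_imp_bounded compact_continuous_image continuous_on_subset[OF cont]) auto
  then obtain P where P: "P > 0" "\<And>x. norm x \<le> B \<Longrightarrow> norm (\<phi> x) \<le> P"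
    unfolding bounded_pos by auto
  have P': "\<bar>\<phi> x \<bullet> i\<bar> \<le> P" for x
    using P(2)[of x] out[of x] P(1) Basis_le_norm[OF i, of "\<phi> x"] by (cases "norm x \<le> B") auto
  have eq: "(LINT x|lborel. (\<psi> (x - t n *\<^sub>R i) - \<psi> x) / t n * (\<phi> x \<bullet> i))
      = (LINT x|lborel. \<psi> x * ((\<phi> (x + t n *\<^sub>R i) \<bullet> i - \<phi> x \<bullet> i) / t n))" for n
  proof -
    have bd: "\<bar>a * b\<bar> \<le> M * P" if "\<bar>a\<bar> \<le> M" "\<bar>b\<bar> \<le> P" for a b :: real
      unfolding abs_mult using that by (intro mult_mono) auto
    have int: "integrable lborel (\<lambda>x. \<psi> (x - t n *\<^sub>R i) * (\<phi> x \<bullet> i))"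
      by (rule integrable_bounded_compact_support[where K = "cball 0 B" and M = "M * P"])
         (use M P' out in \<open>auto intro!: bd\<close>)
    have int2: "integrable lborel (\<lambda>x. \<psi> x * (\<phi> x \<bullet> i))"
      by (rule integrable_bounded_compact_support[where K = "cball 0 B" and M = "M * P"])
         (use M P' out in \<open>auto intro!: bd\<close>)
    have out3: "\<phi> (x + t n *\<^sub>R i) = 0" if "norm x > B + 1" for x
    proof (rule out)
      have "norm x \<le> norm (x + t n *\<^sub>R i) + norm (t n *\<^sub>R i)"
        using norm_triangle_ineq4[of "x + t n *\<^sub>R i" "t n *\<^sub>R i"] by simp
      then show "norm (x + t n *\<^sub>R i) > B" using that t[of n] i1 by simp
    qed
    have int3: "integrable lborel (\<lambda>x. \<psi> x * (\<phi> (x + t n *\<^sub>R i) \<bullet> i))"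
      by (rule integrable_bounded_compact_support[where K = "cball 0 (B + 1)" and M = "M * P"])
         (use M P' out3 in \<open>auto intro!: bd\<close>)
    have shift: "(LINT x|lborel. \<psi> (x - t n *\<^sub>R i) * (\<phi> x \<bullet> i)) = (LINT x|lborel. \<psi> x * (\<phi> (x + t n *\<^sub>R i) \<bullet> i))"
      by (subst lborel_distr_plus[symmetric, of "t n *\<^sub>R i"], subst integral_distr) (auto simp: add.commute)
    have "(LINT x|lborel. (\<psi> (x - t n *\<^sub>R i) - \<psi> x) / t n * (\<phi> x \<bullet> i))
       = (LINT x|lborel. (\<psi> (x - t n *\<^sub>R i) * (\<phi> x \<bullet> i) - \<psi> x * (\<phi> x \<bullet> i)) / t n)"
      by (intro Bochner_Integration.integral_cong) (auto simp: field_simps)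
    also have "\<dots> = ((LINT x|lborel. \<psi> (x - t n *\<^sub>R i) * (\<phi> x \<bullet> i)) - (LINT x|lborel. \<psi> x * (\<phi> x \<bullet> i))) / t n"
      using int int2 by simp
    also have "\<dots> = (LINT x|lborel. (\<psi> x * (\<phi> (x + t n *\<^sub>R i) \<bullet> i) - \<psi> x * (\<phi> x \<bullet> i)) / t n)"
      unfolding shift using int2 int3 by simp
    also have "\<dots> = (LINT x|lborel. \<psi> x * ((\<phi> (x + t n *\<^sub>R i) \<bullet> i - \<phi> x \<bullet> i) / t n))"
      by (intro Bochner_Integration.integral_cong) (auto simp: field_simps)
    finally show ?thesis .
  qed
  have "(\<lambda>n. LINT x|lborel. \<psi> x * ((\<phi> (x + t n *\<^sub>R i) \<bullet> i - \<phi> x \<bullet> i) / t n))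
      \<longlonglongrightarrow> (LINT x|lborel. \<psi> x * (blinfun_apply (\<phi>' x) i \<bullet> i))"
  \<comment> \<open>Steps have length at most 1, so every quotient vanishes outside the ball of
    radius \<open>B + 1\<close>; on it the Lipschitz constant bounds the quotient.\<close>
  proof (rule integral_dominated_convergence[where w = "\<lambda>x. M * L * indicator (cball 0 (B + 1)) x"])
    show "integrable lborel (\<lambda>x. M * L * indicator (cball 0 (B + 1)) x :: real)"
      using emeasure_lborel_cball_finite by (intro integrable_mult_right integrable_real_indicator) auto
    show "AE x in lborel. (\<lambda>n. \<psi> x * ((\<phi> (x + t n *\<^sub>R i) \<bullet> i - \<phi> x \<bullet> i) / t n)) \<longlonglongrightarrow> \<psi> x * (blinfun_apply (\<phi>' x) i \<bullet> i)"
      unfolding t_def by (intro AE_I2 tendsto_mult tendsto_const difference_quotient_limit d)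
    fix n
    show "AE x in lborel. norm (\<psi> x * ((\<phi> (x + t n *\<^sub>R i) \<bullet> i - \<phi> x \<bullet> i) / t n)) \<le> M * L * indicator (cball 0 (B + 1)) x"
    proof (rule AE_I2)
      fix x
      have "\<bar>(\<phi> (x + t n *\<^sub>R i) - \<phi> x) \<bullet> i\<bar> \<le> norm (\<phi> (x + t n *\<^sub>R i) - \<phi> x)"
        by (rule Basis_le_norm[OF i])
      also have "\<dots> \<le> L * t n" using lip[of "x + t n *\<^sub>R i" x] t[of n] i1 by simp
      finally have "\<bar>(\<phi> (x + t n *\<^sub>R i) \<bullet> i - \<phi> x \<bullet> i) / t n\<bar> \<le> L"
        using t[of n] by (simp add: inner_diff_left divide_le_eq)
      then have le: "norm (\<psi> x * ((\<phi> (x + t n *\<^sub>R i) \<bullet> i - \<phi> x \<bullet> i) / t n)) \<le> M * L"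
        unfolding real_norm_def abs_mult using M[of x] M0 by (intro mult_mono) auto
      show "norm (\<psi> x * ((\<phi> (x + t n *\<^sub>R i) \<bullet> i - \<phi> x \<bullet> i) / t n)) \<le> M * L * indicator (cball 0 (B + 1)) x"
      proof (cases "norm x \<le> B + 1")
        case False
        have "norm x \<le> norm (x + t n *\<^sub>R i) + norm (t n *\<^sub>R i)"
          using norm_triangle_ineq4[of "x + t n *\<^sub>R i" "t n *\<^sub>R i"] by simp
        then have "norm (x + t n *\<^sub>R i) > B" using False t[of n] i1 by simp
        then show ?thesis using out[of x] out[of "x + t n *\<^sub>R i"] False by simp
      qed (use le in simp)
    qed
  qed measurable
  then show ?thesis unfolding eq[symmetric] unfolding t_def .
qed

lemma set_lebesgue_integral_divergence:
  assumes "\<phi> \<in> C1c_fields A" "E \<in> sets borel"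
  shows "(LINT x:E|lebesgue. divergence \<phi> x) = (LINT x|lborel. indicator E x * divergence \<phi> x)"
  using borel_measurable_divergence[OF assms(1)] assms(2)
  unfolding set_lebesgue_integral_def by (subst integral_completion) auto

text \<open>Test fields supported in \<open>A\<close> have divergence zero outside \<open>A\<close>.
  This reduces each side of a two-cap set to a single ball.\<close>

lemma perimeter_cong:
  fixes E F A :: "'a::euclidean_space set"
  assumes "E \<inter> A = F \<inter> A"
  shows "perimeter E A = perimeter F A"
proof -
  have "(LINT x:E|lebesgue. divergence \<phi> x) = (LINT x:F|lebesgue. divergence \<phi> x)" if \<phi>: "\<phi> \<in> C1c_fields A" for \<phi>
  proof -
    obtain \<phi>' :: "'a \<Rightarrow> 'a \<Rightarrow>\<^sub>L 'a" and K where K: "K \<subseteq> A" "\<And>x. x \<notin> K \<Longrightarrow> \<phi>' x = 0"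
      "\<And>x. divergence \<phi> x = (\<Sum>i\<in>Basis. blinfun_apply (\<phi>' x) i \<bullet> i)"
      by (rule C1c_fieldsE[OF \<phi>]) (rule that; assumption)
    have "indicator E x *\<^sub>R divergence \<phi> x = indicator F x *\<^sub>R divergence \<phi> x" for x
      using assms K by (cases "x \<in> K") (auto simp: indicator_def)
    then show ?thesis unfolding set_lebesgue_integral_def by presburger
  qed
  then show ?thesis unfolding perimeter_def by (intro SUP_cong) auto
qed

lemma integral_divergence_sum:
  fixes \<phi> :: "'a::euclidean_space \<Rightarrow> 'a" and \<phi>' :: "'a \<Rightarrow> 'a \<Rightarrow>\<^sub>L 'a" and \<psi> :: "'a \<Rightarrow> real"
  assumes [measurable]: "\<psi> \<in> borel_measurable borel" and M: "\<And>x. \<bar>\<psi> x\<bar> \<le> M"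
    and c: "continuous_on UNIV \<phi>'" and L: "\<And>x. norm (\<phi>' x) \<le> L"
    and K: "compact K" "\<And>x. x \<notin> K \<Longrightarrow> \<phi>' x = 0"
    and div: "\<And>x. divergence \<phi> x = (\<Sum>i\<in>Basis. blinfun_apply (\<phi>' x) i \<bullet> i)"
  shows "(LINT x|lborel. \<psi> x * divergence \<phi> x) = (\<Sum>i\<in>Basis. LINT x|lborel. \<psi> x * (blinfun_apply (\<phi>' x) i \<bullet> i))"
proof -
  have "integrable lborel (\<lambda>x. \<psi> x * (blinfun_apply (\<phi>' x) i \<bullet> i))" if i: "i \<in> Basis" for i
  proof (rule integrable_bounded_compact_support[where K = K and M = "M * L"])
    have "continuous_on UNIV (\<lambda>x. blinfun_apply (\<phi>' x) i \<bullet> i)" by (intro continuous_intros c)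
    from borel_measurable_continuous_onI[OF this]
    show "(\<lambda>x. \<psi> x * (blinfun_apply (\<phi>' x) i \<bullet> i)) \<in> borel_measurable borel" by simp
    fix x
    have "\<bar>blinfun_apply (\<phi>' x) i \<bullet> i\<bar> \<le> L"
      using Basis_le_norm[OF i, of "blinfun_apply (\<phi>' x) i"] norm_blinfun[of "\<phi>' x" i] L[of x] i by simp
    then show "\<bar>\<psi> x * (blinfun_apply (\<phi>' x) i \<bullet> i)\<bar> \<le> M * L"
      unfolding abs_mult using M[of x] by (intro mult_mono) auto
  qed (use K in auto)
  then show ?thesis by (simp add: div sum_distrib_left)
qed

section \<open>Translation estimates and integration by parts\<close>

text \<open>The difference quotient of the indicator is supported on the symmetric difference of
  \<open>E\<close> and its translate, so its pairing with a unit field is at most \<open>C\<close>;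
  each partial derivative in the divergence inherits the bound. Admissibility asks only for
  finiteness, so the loss of a factor \<open>DIM('a)\<close> is harmless.\<close>

lemma perimeter_finite_of_translations:
  fixes E :: "'a::euclidean_space set"
  assumes [measurable]: "E \<in> sets borel" and fin: "emeasure lborel E < \<infinity>"
    and C: "\<And>i t. i \<in> Basis \<Longrightarrow> 0 < t \<Longrightarrow> t \<le> 1 \<Longrightarrow>
      emeasure lborel {x. (x - t *\<^sub>R i \<in> E) \<noteq> (x \<in> E)} \<le> ennreal (C * t)"
    and C0: "C \<ge> 0"
  shows "finite_perimeter E"
proof -
  have "perimeter E UNIV \<le> ennreal (DIM('a) * C)"
    unfolding perimeter_def
  proof (rule SUP_least, clarify)
    fix \<phi> :: "'a \<Rightarrow> 'a" assume \<phi>: "\<phi> \<in> C1c_fields UNIV" and \<phi>1: "\<forall>x. norm (\<phi> x) \<le> 1"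
    obtain \<phi>' :: "'a \<Rightarrow> 'a \<Rightarrow>\<^sub>L 'a" and L K where
      d: "\<And>x. (\<phi> has_derivative blinfun_apply (\<phi>' x)) (at x)"
      and c: "continuous_on UNIV \<phi>'" and L: "\<And>x. norm (\<phi>' x) \<le> L"
      and lip: "\<And>x y. norm (\<phi> x - \<phi> y) \<le> L * norm (x - y)"
      and K: "compact K" "\<And>x. x \<notin> K \<Longrightarrow> \<phi> x = 0" "\<And>x. x \<notin> K \<Longrightarrow> \<phi>' x = 0"
      and div: "\<And>x. divergence \<phi> x = (\<Sum>i\<in>Basis. blinfun_apply (\<phi>' x) i \<bullet> i)"
      by (rule C1c_fieldsE[OF \<phi>]) (rule that; assumption)
    let ?\<psi> = "indicator E :: 'a \<Rightarrow> real"
    have "(LINT x|lborel. ?\<psi> x * (blinfun_apply (\<phi>' x) i \<bullet> i)) \<le> C" if i: "i \<in> Basis" for i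
    proof (rule tendsto_upperbound)
      show "(\<lambda>n. LINT x|lborel. (?\<psi> (x - inverse (real (Suc n)) *\<^sub>R i) - ?\<psi> x) / inverse (real (Suc n)) * (\<phi> x \<bullet> i))
        \<longlonglongrightarrow> (LINT x|lborel. ?\<psi> x * (blinfun_apply (\<phi>' x) i \<bullet> i))"
        by (rule integral_difference_quotient[where M = 1, OF _ _ d c lip K(1,2) i]) auto
      show "\<forall>\<^sub>F n in sequentially. (LINT x|lborel. (?\<psi> (x - inverse (real (Suc n)) *\<^sub>R i) - ?\<psi> x) / inverse (real (Suc n)) * (\<phi> x \<bullet> i)) \<le> C"
      proof (intro always_eventually allI)
        fix n
        define t where "t = inverse (real (Suc n))"
        have t: "0 < t" "t \<le> 1" by (auto simp: t_def inverse_le_1_iff)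
        let ?D = "{x. (x - t *\<^sub>R i \<in> E) \<noteq> (x \<in> E)}"
        have [measurable]: "?D \<in> sets borel" by measurable
        have D: "emeasure lborel ?D \<le> ennreal (C * t)" using C[OF i t] .
        have Dfin: "emeasure lborel ?D < \<infinity>" using D by (simp add: le_less_trans)
        have "(LINT x|lborel. (?\<psi> (x - t *\<^sub>R i) - ?\<psi> x) / t * (\<phi> x \<bullet> i)) \<le> (LINT x|lborel. indicator ?D x / t)"
        proof (rule integral_mono')
          show "integrable lborel (\<lambda>x. indicator ?D x / t :: real)"
            using Dfin by (intro integrable_divide integrable_real_indicator) auto
          fix x
          have "\<bar>\<phi> x \<bullet> i\<bar> \<le> 1" using Basis_le_norm[OF i, of "\<phi> x"] \<phi>1 by (meson order_trans)
          then have "(?\<psi> (x - t *\<^sub>R i) - ?\<psi> x) * (\<phi> x \<bullet> i) \<le> indicator ?D x"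
            by (auto simp: indicator_def abs_le_iff)
          then show "(?\<psi> (x - t *\<^sub>R i) - ?\<psi> x) / t * (\<phi> x \<bullet> i) \<le> indicator ?D x / t"
            using t divide_right_mono by fastforce
        qed (use t in auto)
        also have "\<dots> = measure lborel ?D / t" by simp
        also have "\<dots> \<le> C"
        proof -
          have "measure lborel ?D \<le> C * t"
            using D C0 t by (simp add: measure_def enn2real_leI)
          then show ?thesis using t by (simp add: divide_le_eq)
        qed
        finally show "(LINT x|lborel. (?\<psi> (x - inverse (real (Suc n)) *\<^sub>R i) - ?\<psi> x) / inverse (real (Suc n)) * (\<phi> x \<bullet> i)) \<le> C"
          unfolding t_def .
      qed
    qed simp
    then have "(\<Sum>i\<in>Basis. LINT x|lborel. ?\<psi> x * (blinfun_apply (\<phi>' x) i \<bullet> i)) \<le> (\<Sum>i\<in>(Basis::'a set). C)"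
      by (intro sum_mono)
    moreover have "(LINT x:E|lebesgue. divergence \<phi> x) = (\<Sum>i\<in>Basis. LINT x|lborel. ?\<psi> x * (blinfun_apply (\<phi>' x) i \<bullet> i))"
      unfolding set_lebesgue_integral_divergence[OF \<phi> assms(1)]
      by (rule integral_divergence_sum[where M = 1, OF _ _ c L K(1,3) div]) auto
    ultimately have "(LINT x:E|lebesgue. divergence \<phi> x) \<le> DIM('a) * C" by simp
    then show "ennreal (LINT x:E|lebesgue. divergence \<phi> x) \<le> ennreal (DIM('a) * C)"
      by (rule ennreal_leI)
  qed
  then have "perimeter E UNIV < \<infinity>" by (rule le_less_trans) simp
  then show ?thesis unfolding finite_perimeter_def using assms(1) by simp
qed

text \<open>The quotients of \<open>\<eta>\<close> have two limits: by
  \<open>integral_difference_quotient\<close> they yield the divergence integral, and by dominated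
  convergence with constant \<open>Q\<close> they yield the gradient, which exists almost
  everywhere.\<close>

lemma integral_divergence_lipschitz:
  fixes \<phi> :: "'a::euclidean_space \<Rightarrow> 'a" and \<eta> :: "'a \<Rightarrow> real"
  assumes \<phi>: "\<phi> \<in> C1c_fields A" and M: "\<And>x. \<bar>\<eta> x\<bar> \<le> M"
    and lip: "\<And>x y. \<bar>\<eta> x - \<eta> y\<bar> \<le> Q * norm (x - y)"
    and der: "\<And>x. x \<notin> N \<Longrightarrow> (\<eta> has_derivative (\<lambda>h. g x \<bullet> h)) (at x)"
    and N: "N \<in> null_sets lborel" and [measurable]: "g \<in> borel_measurable borel" and Q: "Q \<ge> 0"
  shows "(LINT x|lborel. \<eta> x * divergence \<phi> x) = - (LINT x|lborel. g x \<bullet> \<phi> x)"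
proof -
  obtain \<phi>' :: "'a \<Rightarrow> 'a \<Rightarrow>\<^sub>L 'a" and L K where
    d: "\<And>x. (\<phi> has_derivative blinfun_apply (\<phi>' x)) (at x)"
    and c: "continuous_on UNIV \<phi>'" and L: "\<And>x. norm (\<phi>' x) \<le> L"
    and lip\<phi>: "\<And>x y. norm (\<phi> x - \<phi> y) \<le> L * norm (x - y)"
    and K: "compact K" "\<And>x. x \<notin> K \<Longrightarrow> \<phi> x = 0" "\<And>x. x \<notin> K \<Longrightarrow> \<phi>' x = 0"
    and div: "\<And>x. divergence \<phi> x = (\<Sum>i\<in>Basis. blinfun_apply (\<phi>' x) i \<bullet> i)"
    by (rule C1c_fieldsE[OF \<phi>]) (rule that; assumption)
  have cont\<phi>: "continuous_on UNIV \<phi>" using \<phi> by (rule C1c_fields_continuous)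
  then have [measurable]: "\<phi> \<in> borel_measurable borel" by (rule borel_measurable_continuous_onI)
  have "Q-lipschitz_on UNIV \<eta>" using lip Q by (auto simp: lipschitz_on_def dist_norm)
  then have [measurable]: "\<eta> \<in> borel_measurable borel"
    by (intro borel_measurable_continuous_onI lipschitz_on_continuous_on)
  have "bounded (\<phi> ` K)"
    using K by (intro compact_imp_bounded compact_continuous_image continuous_on_subset[OF cont\<phi>]) auto
  then obtain P where P: "P > 0" "\<And>x. x \<in> K \<Longrightarrow> norm (\<phi> x) \<le> P"
    unfolding bounded_pos by auto
  have P': "\<bar>\<phi> x \<bullet> i\<bar> \<le> P * indicator K x" if "i \<in> Basis" for x i
    using P K(2)[of x] Basis_le_norm[OF that, of "\<phi> x"] by (cases "x \<in> K") (auto intro: order_trans)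
  have bound: "integrable lborel (\<lambda>x. Q * (P * indicator K x) :: real)"
    using emeasure_compact_finite[OF K(1)] compact_imp_closed[OF K(1)]
    by (intro integrable_mult_right integrable_real_indicator) auto
  have each: "integrable lborel (\<lambda>x. g x \<bullet> i * (\<phi> x \<bullet> i)) \<and>
     (LINT x|lborel. \<eta> x * (blinfun_apply (\<phi>' x) i \<bullet> i)) = - (LINT x|lborel. g x \<bullet> i * (\<phi> x \<bullet> i))"
    if i: "i \<in> Basis" for i
  proof -
    define t where "t n = inverse (real (Suc n))" for n
    have t: "0 < t n" for n by (auto simp: t_def)
    have tlim: "filterlim t (at 0) sequentially"
      using LIMSEQ_inverse_real_of_nat t unfolding t_def by (intro filterlim_atI) auto
    \<comment> \<open>The quotient shifts backwards, by \<open>- t n *\<^sub>R i\<close>, which is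
      the source of the minus sign.\<close>
    have ae: "AE x in lborel. (\<lambda>n. (\<eta> (x - t n *\<^sub>R i) - \<eta> x) / t n * (\<phi> x \<bullet> i)) \<longlonglongrightarrow> - (g x \<bullet> i * (\<phi> x \<bullet> i))"
    proof (rule AE_I'[OF N], rule subsetI, rule ccontr, clarify)
      fix x assume x: "x \<notin> N" and nl: "\<not> (\<lambda>n. (\<eta> (x - t n *\<^sub>R i) - \<eta> x) / t n * (\<phi> x \<bullet> i)) \<longlonglongrightarrow> - (g x \<bullet> i * (\<phi> x \<bullet> i))"
      have "((\<lambda>s. x - s *\<^sub>R i) has_derivative (\<lambda>s. - (s *\<^sub>R i))) (at 0)"
        by (auto intro!: derivative_eq_intros)
      moreover have "(\<eta> has_derivative (\<lambda>h. g x \<bullet> h)) (at (x - 0 *\<^sub>R i))" using der[OF x] by simp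
      ultimately have "((\<lambda>s. \<eta> (x - s *\<^sub>R i)) has_derivative (\<lambda>s. g x \<bullet> (- (s *\<^sub>R i)))) (at 0)"
        by (rule has_derivative_compose)
      moreover have "(\<lambda>s. g x \<bullet> (- (s *\<^sub>R i))) = (*) (- (g x \<bullet> i))" by auto
      ultimately have "((\<lambda>s. \<eta> (x - s *\<^sub>R i)) has_real_derivative (- (g x \<bullet> i))) (at 0)"
        by (simp add: has_field_derivative_def)
      then have "(\<lambda>h. (\<eta> (x - (0 + h) *\<^sub>R i) - \<eta> (x - 0 *\<^sub>R i)) / h) \<midarrow>0\<rightarrow> - (g x \<bullet> i)"
        by (rule DERIV_D)
      from filterlim_compose[OF this tlim]
      have "(\<lambda>n. (\<eta> (x - t n *\<^sub>R i) - \<eta> x) / t n) \<longlonglongrightarrow> - (g x \<bullet> i)" by simp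
      from tendsto_mult_right[OF this, of "\<phi> x \<bullet> i"] nl show False by simp
    qed
    have le: "norm ((\<eta> (x - t n *\<^sub>R i) - \<eta> x) / t n * (\<phi> x \<bullet> i)) \<le> Q * (P * indicator K x)" for n x
    proof -
      have "\<bar>\<eta> (x - t n *\<^sub>R i) - \<eta> x\<bar> \<le> Q * t n"
        using lip[of "x - t n *\<^sub>R i" x] t[of n] i by simp
      then have "\<bar>(\<eta> (x - t n *\<^sub>R i) - \<eta> x) / t n\<bar> \<le> Q"
        using t[of n] by (simp add: divide_le_eq)
      then show ?thesis unfolding real_norm_def abs_mult using P'[OF i, of x] Q
        by (intro mult_mono) auto
    qed
    have "integrable lborel (\<lambda>x. - (g x \<bullet> i * (\<phi> x \<bullet> i)))"
      by (rule integrable_dominated_convergence[OF _ _ bound ae]) (use le in \<open>auto intro!: AE_I2\<close>)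
    then have int: "integrable lborel (\<lambda>x. g x \<bullet> i * (\<phi> x \<bullet> i))" by simp
    have "(\<lambda>n. LINT x|lborel. (\<eta> (x - t n *\<^sub>R i) - \<eta> x) / t n * (\<phi> x \<bullet> i)) \<longlonglongrightarrow> (LINT x|lborel. - (g x \<bullet> i * (\<phi> x \<bullet> i)))"
      by (rule integral_dominated_convergence[OF _ _ bound ae]) (use le in \<open>auto intro!: AE_I2\<close>)
    moreover have "(\<lambda>n. LINT x|lborel. (\<eta> (x - t n *\<^sub>R i) - \<eta> x) / t n * (\<phi> x \<bullet> i)) \<longlonglongrightarrow> (LINT x|lborel. \<eta> x * (blinfun_apply (\<phi>' x) i \<bullet> i))"
      unfolding t_def by (rule integral_difference_quotient[OF _ M d c lip\<phi> K(1,2) i]) auto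
    ultimately have "(LINT x|lborel. \<eta> x * (blinfun_apply (\<phi>' x) i \<bullet> i)) = (LINT x|lborel. - (g x \<bullet> i * (\<phi> x \<bullet> i)))"
      by (rule LIMSEQ_unique[rotated])
    then show ?thesis using int by simp
  qed
  have "(LINT x|lborel. \<eta> x * divergence \<phi> x) = (\<Sum>i\<in>Basis. LINT x|lborel. \<eta> x * (blinfun_apply (\<phi>' x) i \<bullet> i))"
    by (rule integral_divergence_sum[OF _ M c L K(1,3) div]) auto
  also have "\<dots> = - (\<Sum>i\<in>Basis. LINT x|lborel. g x \<bullet> i * (\<phi> x \<bullet> i))"
    using each by (simp add: sum_negf)
  also have "(\<Sum>i\<in>Basis. LINT x|lborel. g x \<bullet> i * (\<phi> x \<bullet> i)) = (LINT x|lborel. (\<Sum>i\<in>Basis. g x \<bullet> i * (\<phi> x \<bullet> i)))"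
    using each by (subst Bochner_Integration.integral_sum) auto
  also have "\<dots> = (LINT x|lborel. g x \<bullet> \<phi> x)"
    by (simp add: euclidean_inner[symmetric])
  finally show ?thesis .
qed

section \<open>The perimeter of a spherical cap\<close>

lemma null_sets_sphere: "sphere c r \<in> null_sets (lborel :: 'a::euclidean_space measure)"
  using negligible_sphere[of c r] null_sets_completion_iff[of "sphere c r" lborel]
  by (simp add: negligible_iff_null_sets)

text \<open>The gradient of the ramp is radial of length \<open>1 / \<epsilon>\<close> on the shell
  and zero elsewhere, with kinks only on two null spheres. A field of norm at most 1 supported in
  \<open>H\<close> therefore sees no more than the volume of the shell in \<open>H\<close>, divided
  by \<open>\<epsilon>\<close>.\<close>

lemma integral_ramp_divergence_le:
  fixes c :: "'a::euclidean_space"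
  assumes \<phi>: "\<phi> \<in> C1c_fields H" and \<phi>1: "\<And>x. norm (\<phi> x) \<le> 1" and \<epsilon>: "0 < \<epsilon>" "\<epsilon> < R"
    and H: "H \<in> sets borel"
  shows "(LINT x|lborel. max 0 (min 1 ((R - norm (x - c)) / \<epsilon>)) * divergence \<phi> x)
    \<le> measure lborel ({x. R - \<epsilon> < norm (x - c) \<and> norm (x - c) < R} \<inter> H) / \<epsilon>"
proof -
  define \<eta> where "\<eta> x = max 0 (min 1 ((R - norm (x - c)) / \<epsilon>))" for x
  define W where "W = {x. R - \<epsilon> < norm (x - c) \<and> norm (x - c) < R}"
  define g where "g x = indicator W x *\<^sub>R ((- 1 / \<epsilon>) *\<^sub>R sgn (x - c))" for x
  have [measurable]: "H \<in> sets borel" by fact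
  have Wb [measurable]: "W \<in> sets borel" unfolding W_def by measurable
  have out: "\<phi> x = 0" if "x \<notin> H" for x
    using that \<phi> closure_subset[of "{x. \<phi> x \<noteq> 0}"] by (auto simp: C1c_fields_def)
  have "(LINT x|lborel. \<eta> x * divergence \<phi> x) = - (LINT x|lborel. g x \<bullet> \<phi> x)"
  proof (rule integral_divergence_lipschitz[where M = 1 and Q = "1 / \<epsilon>" and N = "sphere c R \<union> sphere c (R - \<epsilon>)", OF \<phi>])
    show "\<bar>\<eta> x\<bar> \<le> 1" for x by (auto simp: \<eta>_def)
    show "\<bar>\<eta> x - \<eta> y\<bar> \<le> 1 / \<epsilon> * norm (x - y)" for x y
    proof -
      have "\<bar>max 0 (min 1 a) - max 0 (min 1 b)\<bar> \<le> \<bar>a - b\<bar>" for a b :: real by auto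
      then have "\<bar>\<eta> x - \<eta> y\<bar> \<le> \<bar>(R - norm (x - c)) / \<epsilon> - (R - norm (y - c)) / \<epsilon>\<bar>"
        unfolding \<eta>_def .
      also have "\<dots> = \<bar>norm (x - c) - norm (y - c)\<bar> / \<epsilon>"
        using \<epsilon> by (simp add: diff_divide_distrib[symmetric] abs_minus_commute)
      also have "\<dots> \<le> norm (x - y) / \<epsilon>"
        using \<epsilon> norm_triangle_ineq3[of "x - c" "y - c"] by (intro divide_right_mono) auto
      finally show ?thesis by simp
    qed
    show "sphere c R \<union> sphere c (R - \<epsilon>) \<in> null_sets lborel"
      by (intro null_sets.Un null_sets_sphere)
    have "sgn \<in> borel_measurable (borel :: 'a measure)" unfolding sgn_div_norm[abs_def] by measurable
    then show "g \<in> borel_measurable borel"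
      unfolding g_def by measurable
    show "0 \<le> 1 / \<epsilon>" using \<epsilon> by simp
    fix x assume "x \<notin> sphere c R \<union> sphere c (R - \<epsilon>)"
    then have x: "norm (x - c) \<noteq> R" "norm (x - c) \<noteq> R - \<epsilon>" by (auto simp: dist_norm norm_minus_commute)
    have op: "open {x. norm (x - c) < r}" "open {x. norm (x - c) > r}" for r
      by (auto intro!: open_Collect_less continuous_intros)
    consider "norm (x - c) < R - \<epsilon>" | "norm (x - c) > R" | "x \<in> W"
      using x by (fastforce simp: W_def)
    then show "(\<eta> has_derivative (\<lambda>h. g x \<bullet> h)) (at x)"
    proof cases
      case 1
      have "((\<lambda>_. 1) has_derivative (\<lambda>_. 0)) (at x)" by simp
      then have "(\<eta> has_derivative (\<lambda>_. 0)) (at x)"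
        by (rule has_derivative_transform_within_open[OF _ op(1)[of "R - \<epsilon>"]])
           (use 1 \<epsilon> in \<open>auto simp: \<eta>_def field_simps\<close>)
      then show ?thesis using 1 by (simp add: g_def W_def)
    next
      case 2
      have "((\<lambda>_. 0) has_derivative (\<lambda>_. 0)) (at x)" by simp
      then have "(\<eta> has_derivative (\<lambda>_. 0)) (at x)"
        by (rule has_derivative_transform_within_open[OF _ op(2)[of "R"]])
           (use 2 \<epsilon> in \<open>auto simp: \<eta>_def field_simps max_def\<close>)
      then show ?thesis using 2 by (simp add: g_def W_def)
    next
      case 3
      then have "x - c \<noteq> 0" using \<epsilon> by (auto simp: W_def)
      have "((\<lambda>x. x - c) has_derivative (\<lambda>h. h)) (at x)" by (auto intro!: derivative_eq_intros)
      from has_derivative_compose[OF this has_derivative_norm[OF \<open>x - c \<noteq> 0\<close>]]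
      have "((\<lambda>x. norm (x - c)) has_derivative (\<lambda>h. h \<bullet> sgn (x - c))) (at x)"
        by (simp add: inner_commute)
      then have "((\<lambda>x. (R - norm (x - c)) / \<epsilon>) has_derivative (\<lambda>h. (0 - h \<bullet> sgn (x - c)) / \<epsilon>)) (at x)"
        unfolding divide_inverse by (intro has_derivative_mult_left has_derivative_diff has_derivative_const)
      then have "(\<eta> has_derivative (\<lambda>h. (0 - h \<bullet> sgn (x - c)) / \<epsilon>)) (at x)"
      proof (rule has_derivative_transform_within_open[of _ _ _ _ W])
        show "open W" unfolding W_def Collect_conj_eq using op by auto
      qed (use 3 \<epsilon> in \<open>auto simp: \<eta>_def W_def field_simps\<close>)
      then show ?thesis using 3 by (simp add: g_def inner_commute divide_inverse mult.commute)
    qed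
  qed
  also have "\<dots> = (LINT x|lborel. - (g x \<bullet> \<phi> x))" by simp
  also have "\<dots> \<le> (LINT x|lborel. indicator (W \<inter> H) x / \<epsilon>)"
  proof (rule integral_mono')
    have "emeasure lborel (W \<inter> H) \<le> emeasure lborel (cball c R)"
      by (rule emeasure_mono) (auto simp: W_def dist_norm norm_minus_commute)
    also have "\<dots> < \<infinity>" by (rule emeasure_lborel_cball_finite)
    finally show "integrable lborel (\<lambda>x. indicator (W \<inter> H) x / \<epsilon> :: real)"
      by (intro integrable_divide integrable_real_indicator) auto
    fix x
    have "sgn (x - c) \<bullet> \<phi> x \<le> norm (sgn (x - c)) * norm (\<phi> x)"
      using Cauchy_Schwarz_ineq2[of "sgn (x - c)" "\<phi> x"] by linarith
    also have "\<dots> \<le> 1 * 1" using \<phi>1[of x] by (intro mult_mono) (auto simp: norm_sgn)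
    finally have "sgn (x - c) \<bullet> \<phi> x \<le> 1" by simp
    then have le: "(sgn (x - c) \<bullet> \<phi> x) / \<epsilon> \<le> 1 / \<epsilon>" using \<epsilon> by (intro divide_right_mono) auto
    then show "- (g x \<bullet> \<phi> x) \<le> indicator (W \<inter> H) x / \<epsilon>"
      using out[of x] by (cases "x \<in> H") (auto simp: g_def indicator_def)
  qed (use \<epsilon> in auto)
  also have "\<dots> = measure lborel (W \<inter> H) / \<epsilon>" by simp
  finally show ?thesis unfolding \<eta>_def W_def .
qed

text \<open>A Minkowski content argument: shell volume over shell width tends to the derivative in
  the radius of the volume of the ball below the interface, the centre being fixed. The right-hand
  side is that derivative.\<close>

lemma perimeter_cap_le:
  fixes e :: "'a::euclidean_space"
  assumes e: "e \<in> Basis \<or> - e \<in> Basis" and dim: "DIM('a) \<ge> 2" and R: "R > 0" and \<tau>: "\<bar>\<tau>\<bar> < 1"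
  shows "perimeter (cball ((\<tau> * R) *\<^sub>R e) R) (half_neg e) \<le>
    ennreal (R ^ (DIM('a) - 1) * (DIM('a) * cap_volume (DIM('a) - 1) \<tau> + \<tau> * slice_density (DIM('a) - 1) 1 \<tau>))"
  unfolding perimeter_def
proof (rule SUP_least, clarify)
  fix \<phi> :: "'a \<Rightarrow> 'a" assume \<phi>: "\<phi> \<in> C1c_fields (half_neg e)" and \<phi>1: "\<forall>x. norm (\<phi> x) \<le> 1"
  define n where "n = DIM('a) - 1"
  have n: "n > 0" "DIM('a) = Suc n" using dim by (auto simp: n_def)
  define c where "c = (\<tau> * R) *\<^sub>R e"
  \<comment> \<open>The centre stays at height \<tau> R while the radius varies, so the cap
    parameter at radius \<open>r\<close> is \<tau> R / r; differentiating it produces the term with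
    \<open>slice_density\<close>.\<close>
  define v where "v r = r ^ Suc n * cap_volume n (\<tau> * R / r)" for r
  define P where "P = R ^ n * (Suc n * cap_volume n \<tau> + \<tau> * slice_density n 1 \<tau>)"
  have H [measurable]: "half_neg e \<in> sets borel" unfolding half_neg_def by measurable
  have div [measurable]: "divergence \<phi> \<in> borel_measurable borel" by (rule borel_measurable_divergence[OF \<phi>])
  obtain \<phi>' :: "'a \<Rightarrow> 'a \<Rightarrow>\<^sub>L 'a" and L where L: "\<And>x. norm (\<phi>' x) \<le> L"
    and div_eq: "\<And>x. divergence \<phi> x = (\<Sum>i\<in>Basis. blinfun_apply (\<phi>' x) i \<bullet> i)"
    by (rule C1c_fieldsE[OF \<phi>]) (rule that; assumption)
  define Q where "Q = DIM('a) * L"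
  have L0: "0 \<le> L" using L[of 0] norm_ge_zero order_trans by blast
  have Q: "\<bar>divergence \<phi> x\<bar> \<le> Q" for x
  proof -
    have "\<bar>divergence \<phi> x\<bar> \<le> (\<Sum>i\<in>(Basis::'a set). \<bar>blinfun_apply (\<phi>' x) i \<bullet> i\<bar>)"
      unfolding div_eq by (rule sum_abs)
    also have "\<dots> \<le> (\<Sum>i\<in>(Basis::'a set). L)"
    proof (rule sum_mono)
      fix i :: 'a assume i: "i \<in> Basis"
      then show "\<bar>blinfun_apply (\<phi>' x) i \<bullet> i\<bar> \<le> L"
        using Basis_le_norm[OF i, of "blinfun_apply (\<phi>' x) i"] norm_blinfun[of "\<phi>' x" i] L[of x] i by simp
    qed
    finally show ?thesis by (simp add: Q_def)
  qed
  have Q0: "Q \<ge> 0" using L0 by (simp add: Q_def)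
  have vol: "measure lborel (cball c r \<inter> {x. x \<bullet> e \<le> 0}) = v r" if "r > 0" "\<bar>\<tau>\<bar> * R \<le> r" for r
  proof -
    have \<tau>': "\<bar>\<tau> * R / r\<bar> \<le> 1" using that R by (simp add: abs_mult)
    have "0 \<le> cap_volume n (\<tau> * R / r)"
      unfolding cap_volume_def by (intro Henstock_Kurzweil_Integration.integral_nonneg integrable_continuous_real continuous_intros) auto
    then show ?thesis using emeasure_cap[OF e dim \<open>r > 0\<close> \<tau>'] that
      by (simp add: c_def measure_def v_def n(2))
  qed
  define ww where "ww = measure lborel (cball (0::'a) 1)"
  have ball: "measure lborel (cball c r) = ww * r ^ Suc n" if "r \<ge> 0" for r
    using content_cball[of r c] content_cball[of 1 "0::'a"] that by (simp add: ww_def n(2))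
  \<comment> \<open>The first term bounds the integral against the ramp. The second is the price of
    replacing the indicator by the ramp: at most \<open>Q\<close> on the shell, whose total volume
    vanishes with \<open>\<epsilon>\<close>.\<close>
  have ineq: "(LINT x|lborel. indicator (cball c R) x * divergence \<phi> x)
      \<le> (v R - v (R - \<epsilon>)) / \<epsilon> + Q * (ww * R ^ Suc n - ww * (R - \<epsilon>) ^ Suc n)"
    if \<epsilon>: "0 < \<epsilon>" "\<epsilon> < R * (1 - \<bar>\<tau>\<bar>)" for \<epsilon>
  proof -
    \<comment> \<open>The restriction on \<open>\<epsilon>\<close> keeps the cap parameter of the
      smaller ball in [-1, 1], as \<open>vol\<close> requires.\<close>
    have "R * (1 - \<bar>\<tau>\<bar>) \<le> R" using R by (simp add: algebra_simps)
    then have \<epsilon>R: "\<epsilon> < R" and \<epsilon>\<tau>: "\<bar>\<tau>\<bar> * R \<le> R - \<epsilon>" "\<bar>\<tau>\<bar> * R \<le> R"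
      using \<epsilon> \<tau> by (auto simp: algebra_simps)
    define \<eta> where "\<eta> x = max 0 (min 1 ((R - norm (x - c)) / \<epsilon>))" for x
    have [measurable]: "\<eta> \<in> borel_measurable borel"
      unfolding \<eta>_def by (intro borel_measurable_continuous_onI continuous_intros) (use \<epsilon> in auto)
    let ?W = "{x. R - \<epsilon> < norm (x - c) \<and> norm (x - c) < R}"
    have \<eta>_out: "\<eta> x = 0" if "x \<notin> cball c R" for x
    proof -
      have "(R - norm (x - c)) / \<epsilon> \<le> 0"
        using that \<epsilon> by (auto simp: dist_norm norm_minus_commute divide_le_0_iff)
      then show ?thesis by (simp add: \<eta>_def)
    qed
    have \<eta>_in: "\<eta> x = 1" if "x \<in> cball c (R - \<epsilon>)" for x
      using that \<epsilon> by (auto simp: \<eta>_def dist_norm norm_minus_commute field_simps)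
    have \<eta>01: "0 \<le> \<eta> x" "\<eta> x \<le> 1" for x by (auto simp: \<eta>_def)
    have sub: "cball c (R - \<epsilon>) \<subseteq> cball c R" using \<epsilon> by auto
    have fin: "cball c r \<in> fmeasurable lborel" for r by (rule fmeasurable_compact) simp
    have int1: "integrable lborel (\<lambda>x. indicator (cball c R) x * divergence \<phi> x)"
      by (rule integrable_bounded_compact_support[where K = "cball c R" and M = Q])
         (use Q Q0 in \<open>auto simp: indicator_def\<close>)
    have int2: "integrable lborel (\<lambda>x. \<eta> x * divergence \<phi> x)"
    proof (rule integrable_bounded_compact_support[where K = "cball c R" and M = Q])
      fix x
      have "\<bar>\<eta> x\<bar> * \<bar>divergence \<phi> x\<bar> \<le> 1 * Q" using \<eta>01[of x] Q[of x] by (intro mult_mono) auto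
      then show "\<bar>\<eta> x * divergence \<phi> x\<bar> \<le> Q" by (simp add: abs_mult)
    qed (use \<eta>_out in auto)
    have "(LINT x|lborel. indicator (cball c R) x * divergence \<phi> x) - (LINT x|lborel. \<eta> x * divergence \<phi> x)
       = (LINT x|lborel. indicator (cball c R) x * divergence \<phi> x - \<eta> x * divergence \<phi> x)"
      using int1 int2 by simp
    also have "\<dots> \<le> (LINT x|lborel. Q * indicator (cball c R - cball c (R - \<epsilon>)) x)"
    proof (rule integral_mono')
      show "integrable lborel (\<lambda>x. Q * indicator (cball c R - cball c (R - \<epsilon>)) x :: real)"
        using fmeasurable.Diff[OF fin fin, of R "R - \<epsilon>"]
        by (intro integrable_mult_right integrable_real_indicator) (auto simp: fmeasurable_def)
      fix x
      show "0 \<le> Q * indicator (cball c R - cball c (R - \<epsilon>)) x" using Q0 by simp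
      have "(1 - \<eta> x) * divergence \<phi> x \<le> 1 * Q"
      proof -
        have "(1 - \<eta> x) * divergence \<phi> x \<le> (1 - \<eta> x) * Q"
          using \<eta>01[of x] Q[of x] by (intro mult_left_mono) auto
        also have "\<dots> \<le> 1 * Q" using \<eta>01[of x] Q0 by (intro mult_right_mono) auto
        finally show ?thesis .
      qed
      then show "indicator (cball c R) x * divergence \<phi> x - \<eta> x * divergence \<phi> x \<le> Q * indicator (cball c R - cball c (R - \<epsilon>)) x"
        using \<eta>_out[of x] \<eta>_in[of x] sub
        by (cases "x \<in> cball c R"; cases "x \<in> cball c (R - \<epsilon>)") (auto simp: algebra_simps)
    qed
    also have "\<dots> = Q * measure lborel (cball c R - cball c (R - \<epsilon>))" by simp
    also have "measure lborel (cball c R - cball c (R - \<epsilon>)) = ww * R ^ Suc n - ww * (R - \<epsilon>) ^ Suc n"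
      using sub fin \<epsilon>R R by (subst measurable_measure_Diff) (auto simp: ball)
    finally have 1: "(LINT x|lborel. indicator (cball c R) x * divergence \<phi> x)
       \<le> (LINT x|lborel. \<eta> x * divergence \<phi> x) + Q * (ww * R ^ Suc n - ww * (R - \<epsilon>) ^ Suc n)" by simp
    have 2: "(LINT x|lborel. \<eta> x * divergence \<phi> x) \<le> measure lborel (?W \<inter> half_neg e) / \<epsilon>"
      unfolding \<eta>_def using integral_ramp_divergence_le[OF \<phi> _ _ \<epsilon>R H] \<phi>1 \<epsilon> by blast
    have 3: "measure lborel (?W \<inter> half_neg e) \<le> v R - v (R - \<epsilon>)"
    proof -
      let ?C = "\<lambda>r. cball c r \<inter> {x. x \<bullet> e \<le> 0}"
      have finC: "?C r \<in> fmeasurable lborel" for r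
        by (rule fmeasurable_Int_fmeasurable[OF fin]) simp
      have "measure lborel (?W \<inter> half_neg e) \<le> measure lborel (?C R - ?C (R - \<epsilon>))"
        by (intro measure_mono_fmeasurable)
           (auto simp: half_neg_def dist_norm norm_minus_commute intro!: fmeasurable.Diff finC)
      also have "\<dots> = v R - v (R - \<epsilon>)"
        using finC sub \<epsilon>R R \<epsilon>\<tau> by (subst measurable_measure_Diff) (auto simp: vol)
      finally show ?thesis .
    qed
    have "measure lborel (?W \<inter> half_neg e) / \<epsilon> \<le> (v R - v (R - \<epsilon>)) / \<epsilon>"
      using 3 \<epsilon> by (intro divide_right_mono) auto
    then show ?thesis using 1 2 by linarith
  qed
  have dv: "(v has_real_derivative P) (at R)"
  proof -
    have "((\<lambda>r. \<tau> * R / r) has_real_derivative - (\<tau> / R)) (at R)"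
      using R by (auto intro!: derivative_eq_intros simp: field_simps)
    moreover have "(cap_volume n has_real_derivative - slice_density n 1 \<tau>) (at (\<tau> * R / R))"
      using has_real_derivative_cap_volume[OF \<tau>, of n] R by simp
    ultimately have "((\<lambda>r. cap_volume n (\<tau> * R / r)) has_real_derivative (- slice_density n 1 \<tau>) * (- (\<tau> / R))) (at R)"
      by (rule DERIV_chain2[rotated])
    moreover have "((\<lambda>r. r ^ Suc n) has_real_derivative Suc n * R ^ n) (at R)"
      using DERIV_pow[of "Suc n" R] by simp
    ultimately have "(v has_real_derivative Suc n * R ^ n * cap_volume n (\<tau> * R / R) + (- slice_density n 1 \<tau>) * (- (\<tau> / R)) * R ^ Suc n) (at R)"
      unfolding v_def by (intro DERIV_mult)
    also have "Suc n * R ^ n * cap_volume n (\<tau> * R / R) + (- slice_density n 1 \<tau>) * (- (\<tau> / R)) * R ^ Suc n = P"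
      using R by (simp add: P_def field_simps)
    finally show ?thesis .
  qed
  have lim: "((\<lambda>\<epsilon>. (v R - v (R - \<epsilon>)) / \<epsilon> + Q * (ww * R ^ Suc n - ww * (R - \<epsilon>) ^ Suc n))
      \<longlongrightarrow> P + Q * (ww * R ^ Suc n - ww * (R - 0) ^ Suc n)) (at_right 0)"
  proof (intro tendsto_add tendsto_intros)
    have m: "filterlim uminus (at (0::real)) (at_right 0)"
      by (rule filterlim_atI) (auto intro!: tendsto_eq_intros simp: eventually_at_filter)
    have "((\<lambda>\<epsilon>. (v (R + - \<epsilon>) - v R) / (- \<epsilon>)) \<longlongrightarrow> P) (at_right 0)"
      using filterlim_compose[OF DERIV_D[OF dv] m] .
    then show "((\<lambda>\<epsilon>. (v R - v (R - \<epsilon>)) / \<epsilon>) \<longlongrightarrow> P) (at_right 0)"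
      by (rule Lim_transform_eventually) (auto simp: eventually_at_filter field_simps)
  qed
  have "(LINT x|lborel. indicator (cball c R) x * divergence \<phi> x) \<le> P + Q * (ww * R ^ Suc n - ww * (R - 0) ^ Suc n)"
  proof (rule tendsto_lowerbound[OF lim])
    have "R * (1 - \<bar>\<tau>\<bar>) > 0" using R \<tau> by simp
    then show "\<forall>\<^sub>F \<epsilon> in at_right 0. (LINT x|lborel. indicator (cball c R) x * divergence \<phi> x)
       \<le> (v R - v (R - \<epsilon>)) / \<epsilon> + Q * (ww * R ^ Suc n - ww * (R - \<epsilon>) ^ Suc n)"
      using ineq unfolding eventually_at_right_field by blast
  qed simp
  then show "ennreal (LINT x:cball ((\<tau> * R) *\<^sub>R e) R|lebesgue. divergence \<phi> x) \<le>
    ennreal (R ^ (DIM('a) - 1) * (DIM('a) * cap_volume (DIM('a) - 1) \<tau> + \<tau> * slice_density (DIM('a) - 1) 1 \<tau>))"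
    by (subst set_lebesgue_integral_divergence[OF \<phi>]) (auto simp: P_def c_def n(2) intro!: ennreal_leI)
qed

section \<open>Continuously differentiable cut-offs\<close>

text \<open>Test fields must be continuously differentiable, so the ramp is replaced by a quadratic
  spline rising from 0 to 1 with knots 0, 1/2 and 1. Its derivative is the tent of height 2 over the
  unit interval.\<close>

definition smoothstep :: "real \<Rightarrow> real" where
  "smoothstep u = 2 * (max 0 u)\<^sup>2 - 4 * (max 0 (u - 1/2))\<^sup>2 + 2 * (max 0 (u - 1))\<^sup>2"

definition smoothstep' :: "real \<Rightarrow> real" where
  "smoothstep' u = 4 * max 0 u - 8 * max 0 (u - 1/2) + 4 * max 0 (u - 1)"

lemma has_real_derivative_max_0_squared:
  "((\<lambda>u. (max 0 u)\<^sup>2) has_real_derivative 2 * max 0 x) (at (x::real))"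
proof -
  consider "x > 0" | "x < 0" | "x = 0" by linarith
  then show ?thesis
  proof cases
    case 1
    have "((\<lambda>u. u\<^sup>2) has_real_derivative 2 * x) (at x)" by (auto intro!: derivative_eq_intros)
    then have "((\<lambda>u. (max 0 u)\<^sup>2) has_real_derivative 2 * x) (at x)"
      by (rule has_field_derivative_transform_within_open[of _ _ _ "{0<..}"]) (use 1 in auto)
    then show ?thesis using 1 by simp
  next
    case 2
    have "((\<lambda>u. 0) has_real_derivative 0) (at x)" by simp
    then have "((\<lambda>u. (max 0 u)\<^sup>2) has_real_derivative 0) (at x)"
      by (rule has_field_derivative_transform_within_open[of _ _ _ "{..<0}"]) (use 2 in auto)
    then show ?thesis using 2 by simp
  next
    case 3
    \<comment> \<open>At the kink the difference quotient is \<open>max 0 h\<close> itself.\<close>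
    have "((\<lambda>h. max 0 h) \<longlongrightarrow> max 0 (0::real)) (at 0)" by (intro tendsto_intros)
    then have "(\<lambda>h. ((max 0 (0 + h))\<^sup>2 - (max 0 (0::real))\<^sup>2) / h) \<midarrow>0\<rightarrow> 0"
      by (simp, elim Lim_transform_eventually)
         (auto simp: eventually_at_filter max_def power2_eq_square)
    then show ?thesis unfolding 3 DERIV_def by simp
  qed
qed

lemma has_real_derivative_smoothstep: "(smoothstep has_real_derivative smoothstep' u) (at u)"
proof -
  have "((\<lambda>u. (max 0 (u - a))\<^sup>2) has_real_derivative 2 * max 0 (u - a) * 1) (at u)" for a
    by (rule DERIV_chain2[where g = "\<lambda>u. u - a", OF has_real_derivative_max_0_squared])
       (auto intro!: derivative_eq_intros)
  note this[THEN DERIV_cmult]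
  from DERIV_add[OF DERIV_diff[OF this[of 2 0] this[of 4 "1/2"]] this[of 2 1]]
  show ?thesis unfolding smoothstep_def[abs_def] smoothstep'_def by simp
qed

lemma smoothstep_eq_0: "u \<le> 0 \<Longrightarrow> smoothstep u = 0"
  by (simp add: smoothstep_def)

lemma smoothstep_eq_1: "u \<ge> 1 \<Longrightarrow> smoothstep u = 1"
  by (simp add: smoothstep_def power2_eq_square algebra_simps)

lemma smoothstep'_eq_0: "u \<le> 0 \<or> u \<ge> 1 \<Longrightarrow> smoothstep' u = 0"
  by (auto simp: smoothstep'_def)

lemma smoothstep'_bounds: "0 \<le> smoothstep' u" "smoothstep' u \<le> 2"
proof -
  have "0 \<le> smoothstep' u \<and> smoothstep' u \<le> 2"
  proof -
    consider "u \<le> 0" | "0 \<le> u" "u \<le> 1/2" | "1/2 \<le> u" "u \<le> 1" | "1 \<le> u" by linarith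
    then show ?thesis
      unfolding smoothstep'_def by cases (simp_all only: max_absorb1 max_absorb2 diff_le_0_iff_le diff_ge_0_iff_ge, simp_all)
  qed
  then show "0 \<le> smoothstep' u" "smoothstep' u \<le> 2" by auto
qed

lemma smoothstep_bounds: "0 \<le> smoothstep u" "smoothstep u \<le> 1"
proof -
  have mono: "smoothstep a \<le> smoothstep b" if "a \<le> b" for a b
    using that
    by (rule DERIV_nonneg_imp_nondecreasing) (use has_real_derivative_smoothstep smoothstep'_bounds in blast)
  show "0 \<le> smoothstep u" using mono[of "min 0 u" u] by (simp add: smoothstep_eq_0)
  show "smoothstep u \<le> 1" using mono[of u "max 1 u"] by (simp add: smoothstep_eq_1)
qed

lemma continuous_on_smoothstep [continuous_intros]:
  "continuous_on A f \<Longrightarrow> continuous_on A (\<lambda>x. smoothstep (f x))"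
  unfolding smoothstep_def by (intro continuous_intros)

lemma continuous_on_smoothstep' [continuous_intros]:
  "continuous_on A f \<Longrightarrow> continuous_on A (\<lambda>x. smoothstep' (f x))"
  unfolding smoothstep'_def by (intro continuous_intros)

lemma borel_measurable_smoothstep [measurable]:
  "smoothstep \<in> borel_measurable borel" "smoothstep' \<in> borel_measurable borel"
  by (intro borel_measurable_continuous_onI continuous_intros)+

text \<open>Unit mass turns the derivative of a cut-off at the interface into an approximate delta,
  which will produce the term with the base disc.\<close>

lemma integral_smoothstep': "(LINT u|lborel. smoothstep' u) = 1"
proof -
  have "(LINT u|lborel. smoothstep' u * indicator {0..1} u) = smoothstep 1 - smoothstep 0"
  proof (rule integral_FTC_Icc_real)
    have "continuous_on UNIV smoothstep'" by (intro continuous_intros)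
    then show "isCont smoothstep' u" for u by (simp add: continuous_on_eq_continuous_at)
  qed (auto intro: has_real_derivative_smoothstep)
  moreover have "smoothstep' u * indicator {0..1} u = smoothstep' u" for u
    using smoothstep'_eq_0[of u] by (cases "u \<in> {0..1}") auto
  ultimately show ?thesis by (simp add: smoothstep_eq_0 smoothstep_eq_1)
qed

text \<open>Product rule, the divergence of \<open>x - c\<close> being the dimension. With
  \<open>a\<close> close to \<open>1 / R\<close> the field approximates the outer unit normal on the
  sphere, the best possible test field.\<close>

lemma radial_field:
  fixes a :: "'a::euclidean_space \<Rightarrow> real"
  assumes d: "\<And>x. (a has_derivative (\<lambda>h. G x \<bullet> h)) (at x)" and G: "continuous_on UNIV G"
    and K: "compact K" "K \<subseteq> A" "\<And>x. x \<notin> K \<Longrightarrow> a x = 0"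
  shows "(\<lambda>x. a x *\<^sub>R (x - c)) \<in> C1c_fields A"
    and "divergence (\<lambda>x. a x *\<^sub>R (x - c)) x = G x \<bullet> (x - c) + DIM('a) * a x"
proof -
  let ?\<phi> = "\<lambda>x. a x *\<^sub>R (x - c)"
  define \<phi>' where "\<phi>' x = Blinfun (\<lambda>h. a x *\<^sub>R h + (G x \<bullet> h) *\<^sub>R (x - c))" for x
  have bl: "bounded_linear (\<lambda>h. a x *\<^sub>R h + (G x \<bullet> h) *\<^sub>R (x - c))" for x
    by (intro bounded_linear_add bounded_linear_scaleR_right
          bounded_linear_scaleR_const bounded_linear_inner_right)
  have ap: "blinfun_apply (\<phi>' x) = (\<lambda>h. a x *\<^sub>R h + (G x \<bullet> h) *\<^sub>R (x - c))" for x
    unfolding \<phi>'_def using bl by (rule bounded_linear_Blinfun_apply)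
  have der: "(?\<phi> has_derivative blinfun_apply (\<phi>' x)) (at x)" for x
    unfolding ap
    by (rule has_derivative_eq_rhs[OF has_derivative_scaleR[OF d has_derivative_diff[OF has_derivative_ident has_derivative_const]]]) auto
  have conta: "continuous_on UNIV a"
    by (rule continuous_at_imp_continuous_on) (use d has_derivative_continuous in blast)
  have "continuous_on UNIV \<phi>'"
    by (rule continuous_on_blinfun_componentwise) (unfold ap, intro continuous_intros conta G)
  moreover have sub: "closure {x. ?\<phi> x \<noteq> 0} \<subseteq> K"
    using K by (intro closure_minimal) (auto simp: compact_imp_closed)
  moreover have "compact (closure {x. ?\<phi> x \<noteq> 0})"
    using compact_Int_closed[OF K(1) closed_closure] sub by (metis inf.absorb2)
  ultimately show "?\<phi> \<in> C1c_fields A"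
    unfolding C1c_fields_def using der K(2) by blast
  have "divergence ?\<phi> x = (\<Sum>i\<in>Basis. blinfun_apply (\<phi>' x) i \<bullet> i)"
    using frechet_derivative_at[OF der[of x]] by (simp add: divergence_def)
  also have "\<dots> = (\<Sum>i\<in>Basis. a x + (G x \<bullet> i) * ((x - c) \<bullet> i))"
    by (intro sum.cong) (auto simp: ap inner_add_left)
  also have "\<dots> = G x \<bullet> (x - c) + DIM('a) * a x"
    unfolding sum.distrib by (simp add: euclidean_inner[of "G x" "x - c"])
  finally show "divergence ?\<phi> x = G x \<bullet> (x - c) + DIM('a) * a x" .
qed

text \<open>A calibration: (x - c) / R is the outer unit normal on the sphere. Its divergence N / R
  contributes N v / R, and switching it off at the interface contributes its flux through the base
  disc, \<tau> D. Both cut-offs have a width controlled by \<open>\<delta> m\<close>, which then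
  tends to zero.\<close>

lemma perimeter_cap_ge:
  fixes e :: "'a::euclidean_space"
  assumes e: "e \<in> Basis \<or> - e \<in> Basis" and dim: "DIM('a) \<ge> 2" and R: "R > 0" and \<tau>: "\<bar>\<tau>\<bar> < 1"
  shows "ennreal (R ^ (DIM('a) - 1) * (DIM('a) * cap_volume (DIM('a) - 1) \<tau> + \<tau> * slice_density (DIM('a) - 1) 1 \<tau>))
    \<le> perimeter (cball ((\<tau> * R) *\<^sub>R e) R) (half_neg e)"
proof -
  define n where "n = DIM('a) - 1"
  have n: "n > 0" "DIM('a) = Suc n" using dim by (auto simp: n_def)
  have ee: "e \<bullet> e = 1" using e inner_same_Basis[of "-e"] inner_same_Basis[of e] by auto
  define c where "c = (\<tau> * R) *\<^sub>R e"
  have ce: "c \<bullet> e = \<tau> * R" by (simp add: c_def ee)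
  define P where "P = R ^ n * (Suc n * cap_volume n \<tau> + \<tau> * slice_density n 1 \<tau>)"
  define k where "k s = slice_density n R (s - \<tau> * R)" for s
  have k [measurable]: "k \<in> borel_measurable borel" unfolding k_def by measurable
  have kcont: "continuous_on UNIV k" unfolding k_def by (intro continuous_intros)
  have k0: "0 \<le> k s" "k s \<le> unit_ball_vol n * R ^ n" for s
    using slice_density_le R by (simp_all add: k_def)
  have kz: "k s = 0" if "s \<notin> {\<tau> * R - R..\<tau> * R + R}" for s
    unfolding k_def using that R n by (intro slice_density_zero) auto
  have kint: "integrable lborel k"
    by (rule integrable_bounded_compact_support[where K = "{\<tau> * R - R..\<tau> * R + R}" and M = "unit_ball_vol n * R ^ n"])
       (use k0 kz in auto)
  define \<delta> where "\<delta> m = inverse (real (Suc m))" for m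
  \<comment> \<open>The extra radius leaves room for an outer cut-off that does not touch the ball,
    and dividing by \<open>R2 m\<close> instead of \<open>R\<close> keeps the norm of the field at
    most 1.\<close>
  define R2 where "R2 m = R + \<delta> m" for m
  have \<delta>: "\<delta> m > 0" "\<delta> m \<le> 1" for m by (auto simp: \<delta>_def inverse_le_1_iff)
  have \<delta>lim: "\<delta> \<longlonglongrightarrow> 0" unfolding \<delta>_def by (rule LIMSEQ_inverse_real_of_nat)
  \<comment> \<open>Equal to 1 for \<open>s \<le> - 2 * \<delta> m\<close> and 0 for
    \<open>s \<ge> - \<delta> m\<close>, so the support stays away from the interface.\<close>
  define \<theta> where "\<theta> m s = smoothstep (- s / \<delta> m - 1)" for m s
  define \<theta>' where "\<theta>' m s = - (smoothstep' (- s / \<delta> m - 1) / \<delta> m)" for m s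
  have [measurable]: "\<theta> m \<in> borel_measurable borel" "\<theta>' m \<in> borel_measurable borel" for m
    unfolding \<theta>_def \<theta>'_def by measurable
  have \<theta>d: "(\<theta> m has_real_derivative \<theta>' m s) (at s)" for m s
  proof -
    have "((\<lambda>s. - s / \<delta> m - 1) has_real_derivative (- 1 / \<delta> m)) (at s)"
      using \<delta>[of m] by (auto intro!: derivative_eq_intros)
    from DERIV_chain2[OF has_real_derivative_smoothstep this]
    show ?thesis unfolding \<theta>_def[abs_def] \<theta>'_def by simp
  qed
  have \<theta>b: "0 \<le> \<theta> m s" "\<theta> m s \<le> 1" for m s
    using smoothstep_bounds by (auto simp: \<theta>_def)
  have \<theta>0: "\<theta> m s = 0" if "s > - \<delta> m" for m s
    unfolding \<theta>_def by (rule smoothstep_eq_0) (use that \<delta>[of m] in \<open>simp add: field_simps\<close>)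
  define I where "I m = (LINT s|lborel. k s * (\<theta>' m s * (s - \<tau> * R) + Suc n * \<theta> m s))" for m
  have lower: "ennreal (I m / R2 m) \<le> perimeter (cball c R) (half_neg e)" for m
  proof -
    have R2: "R < R2 m" "R2 m > 0" using \<delta>[of m] R by (auto simp: R2_def)
    define q where "q = (R2 m)\<^sup>2 - R\<^sup>2"
    have q: "q > 0" using R2 R by (simp add: q_def power_strict_mono)
    \<comment> \<open>\<open>w\<close> is 0 on the sphere of radius \<open>R\<close> and 1 on that
      of radius \<open>R2 m\<close>. Using the squared distance avoids the singularity of the norm
      at the centre.\<close>
    define w where "w x = ((x - c) \<bullet> (x - c) - R\<^sup>2) / q" for x
    define a where "a x = \<theta> m (x \<bullet> e) * (1 - smoothstep (w x)) / R2 m" for x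
    define G where "G x = (1 / R2 m) *\<^sub>R ((\<theta>' m (x \<bullet> e) * (1 - smoothstep (w x))) *\<^sub>R e
       - (\<theta> m (x \<bullet> e) * smoothstep' (w x) * (2 / q)) *\<^sub>R (x - c))" for x
    have wd: "(w has_derivative (\<lambda>h. (2 / q) * ((x - c) \<bullet> h))) (at x)" for x
      unfolding w_def by (rule derivative_eq_intros refl)+ (use q in \<open>auto simp: inner_commute field_simps\<close>)
    have ad: "(a has_derivative (\<lambda>h. G x \<bullet> h)) (at x)" for x
    proof -
      have "((\<lambda>x. x \<bullet> e) has_derivative (\<lambda>h. h \<bullet> e)) (at x)" by (auto intro!: derivative_eq_intros)
      from has_derivative_compose[OF this \<theta>d[of m "x \<bullet> e", unfolded has_field_derivative_def]]
      have 1: "((\<lambda>x. \<theta> m (x \<bullet> e)) has_derivative (\<lambda>h. \<theta>' m (x \<bullet> e) * (h \<bullet> e))) (at x)" .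
      from has_derivative_compose[OF wd has_real_derivative_smoothstep[of "w x", unfolded has_field_derivative_def]]
      have "((\<lambda>x. smoothstep (w x)) has_derivative (\<lambda>h. smoothstep' (w x) * ((2 / q) * ((x - c) \<bullet> h)))) (at x)" .
      then have "((\<lambda>x. 1 - smoothstep (w x)) has_derivative (\<lambda>h. 0 - smoothstep' (w x) * ((2 / q) * ((x - c) \<bullet> h)))) (at x)"
        by (intro has_derivative_diff has_derivative_const)
      from has_derivative_mult_left[OF has_derivative_mult[OF 1 this], of "1 / R2 m"]
      have "(a has_derivative (\<lambda>h. (\<theta> m (x \<bullet> e) * (0 - smoothstep' (w x) * ((2 / q) * ((x - c) \<bullet> h))) + \<theta>' m (x \<bullet> e) * (h \<bullet> e) * (1 - smoothstep (w x))) * (1 / R2 m))) (at x)"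
        unfolding a_def by simp
      then show ?thesis
        by (rule has_derivative_eq_rhs)
           (auto simp: G_def inner_diff_left inner_commute algebra_simps diff_divide_distrib add_divide_distrib)
    qed
    have contG: "continuous_on UNIV G"
      unfolding G_def w_def \<theta>_def \<theta>'_def by (intro continuous_intros) (use \<delta>[of m] q in auto)
    define K where "K = cball c (R2 m) \<inter> {x. x \<bullet> e \<le> - \<delta> m}"
    have K: "compact K" "K \<subseteq> half_neg e"
      unfolding K_def half_neg_def using \<delta>[of m]
      by (auto intro!: compact_Int_closed closed_Collect_le continuous_intros)
    have w1: "w x \<ge> 1 \<longleftrightarrow> x \<notin> ball c (R2 m)" for x
    proof -
      have "w x \<ge> 1 \<longleftrightarrow> (R2 m)\<^sup>2 \<le> (norm (x - c))\<^sup>2"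
        using q unfolding w_def power2_norm_eq_inner by (simp add: field_simps q_def)
      also have "\<dots> \<longleftrightarrow> R2 m \<le> norm (x - c)"
        using R2 abs_le_square_iff[of "R2 m" "norm (x - c)"] by auto
      finally show ?thesis by (auto simp: dist_norm norm_minus_commute)
    qed
    have aK: "a x = 0" if "x \<notin> K" for x
    proof (cases "x \<in> cball c (R2 m)")
      case True
      then show ?thesis using that \<theta>0[of m "x \<bullet> e"] by (auto simp: a_def K_def)
    next
      case False
      then have "w x \<ge> 1" using w1[of x] by auto
      then show ?thesis by (simp add: a_def smoothstep_eq_1)
    qed
    let ?\<phi> = "\<lambda>x. a x *\<^sub>R (x - c)"
    note \<phi> = radial_field[OF ad contG K aK, where c = c]
    have a1: "0 \<le> a x" "a x \<le> 1 / R2 m" for x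
    proof -
      have "\<theta> m (x \<bullet> e) * (1 - smoothstep (w x)) \<le> 1 * 1"
        using \<theta>b[of m "x \<bullet> e"] smoothstep_bounds[of "w x"] by (intro mult_mono) auto
      then show "a x \<le> 1 / R2 m" unfolding a_def using R2 by (intro divide_right_mono) auto
    qed (use \<theta>b smoothstep_bounds R2 in \<open>auto simp: a_def\<close>)
    have "norm (?\<phi> x) \<le> 1" for x
    proof (cases "x \<in> cball c (R2 m)")
      case True
      then have "a x * norm (x - c) \<le> 1 / R2 m * R2 m"
        using a1[of x] R2 by (intro mult_mono) (auto simp: dist_norm norm_minus_commute)
      then show ?thesis using a1[of x] R2 by simp
    next
      case False
      then have "x \<notin> K" by (simp add: K_def)
      then show ?thesis using aK by simp
    qed
    then have "ennreal (LINT x:cball c R|lebesgue. divergence ?\<phi> x) \<le> perimeter (cball c R) (half_neg e)"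
      unfolding perimeter_def using \<phi>(1) by (intro SUP_upper) auto
    also have "(LINT x:cball c R|lebesgue. divergence ?\<phi> x) = (LINT x|lborel. indicator (cball c R) x * divergence ?\<phi> x)"
      by (rule set_lebesgue_integral_divergence[OF \<phi>(1)]) measurable
    also have "\<dots> = (LINT x|lborel. indicator (cball c R) x * ((\<theta>' m (x \<bullet> e) * (x \<bullet> e - \<tau> * R) + Suc n * \<theta> m (x \<bullet> e)) / R2 m))"
    proof (intro Bochner_Integration.integral_cong refl)
      fix x
      show "indicator (cball c R) x * divergence ?\<phi> x
        = indicator (cball c R) x * ((\<theta>' m (x \<bullet> e) * (x \<bullet> e - \<tau> * R) + Suc n * \<theta> m (x \<bullet> e)) / R2 m)"
      proof (cases "x \<in> cball c R")
        case True
        then have "(norm (x - c))\<^sup>2 \<le> R\<^sup>2" using R by (intro power_mono) (auto simp: dist_norm norm_minus_commute)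
        then have "w x \<le> 0" using q by (simp add: w_def power2_norm_eq_inner divide_le_0_iff)
        then have "a x = \<theta> m (x \<bullet> e) / R2 m" "G x = (\<theta>' m (x \<bullet> e) / R2 m) *\<^sub>R e"
          by (auto simp: a_def G_def smoothstep_eq_0 smoothstep'_eq_0)
        moreover have "divergence ?\<phi> x = G x \<bullet> (x - c) + DIM('a) * a x" by (rule \<phi>(2))
        ultimately show ?thesis
          by (simp add: inner_diff_right inner_commute[of e] ce n(2) add_divide_distrib diff_divide_distrib right_diff_distrib)
      qed simp
    qed
    also have "\<dots> = (LINT s|lborel. k s * ((\<theta>' m s * (s - \<tau> * R) + Suc n * \<theta> m s) / R2 m))"
      using R by (subst integral_ball_slices[OF e dim]) (auto simp: ce k_def n_def)
    also have "\<dots> = I m / R2 m" by (simp add: I_def)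
    finally show ?thesis .
  qed
  \<comment> \<open>\<open>\<theta>' m\<close> has integral -1 and concentrates at 0, where
    \<open>s - \<tau> * R\<close> is \<open>- (\<tau> * R)\<close>; the two signs cancel.\<close>
  have I1: "(\<lambda>m. LINT s|lborel. k s * (\<theta>' m s * (s - \<tau> * R))) \<longlonglongrightarrow> k 0 * (\<tau> * R)"
  proof -
    have eq: "(LINT s|lborel. k s * (\<theta>' m s * (s - \<tau> * R)))
      = (LINT u|lborel. smoothstep' u * (k (- (\<delta> m * (u + 1))) * (\<tau> * R + \<delta> m * (u + 1))))" for m
    proof -
      have "(LINT s|lborel. k s * (\<theta>' m s * (s - \<tau> * R))) =
        \<bar>- \<delta> m\<bar> *\<^sub>R (LINT u|lborel. k (- \<delta> m + (- \<delta> m) * u) * (\<theta>' m (- \<delta> m + (- \<delta> m) * u) * (- \<delta> m + (- \<delta> m) * u - \<tau> * R)))"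
        using \<delta>[of m] by (intro lborel_integral_real_affine) auto
      also have "\<dots> = (LINT u|lborel. \<delta> m * (k (- \<delta> m + (- \<delta> m) * u) * (\<theta>' m (- \<delta> m + (- \<delta> m) * u) * (- \<delta> m + (- \<delta> m) * u - \<tau> * R))))"
        using \<delta>[of m] by simp
      also have "\<dots> = (LINT u|lborel. smoothstep' u * (k (- (\<delta> m * (u + 1))) * (\<tau> * R + \<delta> m * (u + 1))))"
      proof (intro Bochner_Integration.integral_cong refl)
        fix u
        have u: "- \<delta> m + (- \<delta> m) * u = - (\<delta> m * (u + 1))" by (simp add: algebra_simps)
        have "- (- (\<delta> m * (u + 1))) / \<delta> m - 1 = u" using \<delta>[of m] by simp
        then have "\<delta> m * \<theta>' m (- (\<delta> m * (u + 1))) = - smoothstep' u"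
          using \<delta>[of m] by (simp add: \<theta>'_def)
        then show "\<delta> m * (k (- \<delta> m + (- \<delta> m) * u) * (\<theta>' m (- \<delta> m + (- \<delta> m) * u) * (- \<delta> m + (- \<delta> m) * u - \<tau> * R)))
          = smoothstep' u * (k (- (\<delta> m * (u + 1))) * (\<tau> * R + \<delta> m * (u + 1)))"
          unfolding u by algebra
      qed
      finally show ?thesis .
    qed
    have "(\<lambda>m. LINT u|lborel. smoothstep' u * (k (- (\<delta> m * (u + 1))) * (\<tau> * R + \<delta> m * (u + 1))))
      \<longlonglongrightarrow> (LINT u|lborel. smoothstep' u * (k (- (0 * (u + 1))) * (\<tau> * R + 0 * (u + 1))))"
    \<comment> \<open>The factors bound the tent, the slice, and the moment: \<tau> R is at most
      \<open>R\<close> in modulus and \<open>\<delta> m * (u + 1)\<close> is at most 2.\<close>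
    proof (rule integral_dominated_convergence[where w = "\<lambda>u. 2 * ((unit_ball_vol n * R ^ n) * (R + 2)) * indicator {0..1} u"])
      show "integrable lborel (\<lambda>u::real. 2 * ((unit_ball_vol n * R ^ n) * (R + 2)) * indicator {0..1} u :: real)"
        by (intro integrable_mult_right integrable_real_indicator) auto
      show "AE u in lborel. (\<lambda>m. smoothstep' u * (k (- (\<delta> m * (u + 1))) * (\<tau> * R + \<delta> m * (u + 1))))
          \<longlonglongrightarrow> smoothstep' u * (k (- (0 * (u + 1))) * (\<tau> * R + 0 * (u + 1)))"
      proof (rule AE_I2)
        fix u
        have "isCont k x" for x using kcont by (simp add: continuous_on_eq_continuous_at)
        then have "(\<lambda>m. k (- (\<delta> m * (u + 1)))) \<longlonglongrightarrow> k (- (0 * (u + 1)))"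
          by (rule isCont_tendsto_compose) (intro tendsto_intros \<delta>lim)
        then show "(\<lambda>m. smoothstep' u * (k (- (\<delta> m * (u + 1))) * (\<tau> * R + \<delta> m * (u + 1))))
          \<longlonglongrightarrow> smoothstep' u * (k (- (0 * (u + 1))) * (\<tau> * R + 0 * (u + 1)))"
          by (intro tendsto_mult tendsto_add tendsto_const \<delta>lim)
      qed
      fix m
      show "AE u in lborel. norm (smoothstep' u * (k (- (\<delta> m * (u + 1))) * (\<tau> * R + \<delta> m * (u + 1))))
         \<le> 2 * ((unit_ball_vol n * R ^ n) * (R + 2)) * indicator {0..1} u"
      proof (rule AE_I2)
        fix u
        show "norm (smoothstep' u * (k (- (\<delta> m * (u + 1))) * (\<tau> * R + \<delta> m * (u + 1))))
         \<le> 2 * ((unit_ball_vol n * R ^ n) * (R + 2)) * indicator {0..1} u"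
        proof (cases "u \<in> {0..1}")
          case True
          have "\<delta> m * (u + 1) \<le> 1 * 2" using True \<delta>[of m] by (intro mult_mono) auto
          moreover have "0 \<le> \<delta> m * (u + 1)" using True \<delta>[of m] by simp
          moreover have "\<bar>\<tau> * R\<bar> \<le> R" using \<tau> R by (simp add: abs_mult)
          ultimately have "\<bar>\<tau> * R + \<delta> m * (u + 1)\<bar> \<le> R + 2" by linarith
          then have "\<bar>smoothstep' u\<bar> * (\<bar>k (- (\<delta> m * (u + 1)))\<bar> * \<bar>\<tau> * R + \<delta> m * (u + 1)\<bar>) \<le> 2 * ((unit_ball_vol n * R ^ n) * (R + 2))"
            using smoothstep'_bounds[of u] k0 R by (intro mult_mono) auto
          then show ?thesis using True by (simp add: abs_mult)
        qed (use smoothstep'_eq_0[of u] in auto)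
      qed
    qed measurable
    then show ?thesis unfolding eq using integral_smoothstep' by simp
  qed
  have I2: "(\<lambda>m. LINT s|lborel. k s * \<theta> m s) \<longlonglongrightarrow> (LINT s|lborel. k s * indicator {..<0} s)"
  proof (rule integral_dominated_convergence[where w = k, OF _ _ kint])
    show "AE s in lborel. (\<lambda>m. k s * \<theta> m s) \<longlonglongrightarrow> k s * indicator {..<0} s"
    proof (rule AE_I2)
      fix s :: real
      show "(\<lambda>m. k s * \<theta> m s) \<longlonglongrightarrow> k s * indicator {..<0} s"
      proof (cases "s < 0")
        case False
        then have "\<theta> m s = 0" for m using \<theta>0[of m s] \<delta>[of m] by auto
        then show ?thesis using False by simp
      next
        case True
        have "\<forall>\<^sub>F m in sequentially. \<delta> m < - s / 2"
          using order_tendstoD(2)[OF \<delta>lim, of "- s / 2"] True by simp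
        then have "\<forall>\<^sub>F m in sequentially. k s * \<theta> m s = k s * indicator {..<0} s"
        proof eventually_elim
          case (elim m)
          have "- s / \<delta> m - 1 \<ge> 1" using elim \<delta>[of m] by (simp add: field_simps)
          then show ?case using True by (simp add: \<theta>_def smoothstep_eq_1)
        qed
        then show ?thesis by (rule tendsto_eventually)
      qed
    qed
    fix m
    show "AE s in lborel. norm (k s * \<theta> m s) \<le> k s"
      using \<theta>b[of m] k0 by (auto intro!: AE_I2 simp: abs_mult mult_left_le)
  qed measurable
  have vol: "(LINT s|lborel. k s * indicator {..<0} s) = R ^ Suc n * cap_volume n \<tau>"
  proof -
    have "(LINT s|lborel. k s * indicator {..<0} s) = (LINT s|lborel. k s * indicator {..0} s)"
    proof (rule integral_cong_AE)
      show "AE s in lborel. k s * indicator {..<0} s = k s * indicator {..0} s"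
        using AE_lborel_singleton[of "0::real"] by eventually_elim (auto simp: indicator_def)
    qed measurable
    also have "\<dots> = (LINT x|lborel. indicator (cball c R) x * indicator {..0} (x \<bullet> e))"
      using R by (subst integral_ball_slices[OF e dim]) (auto simp: ce k_def n_def)
    also have "\<dots> = (LINT x|lborel. indicator (cball c R \<inter> {x. x \<bullet> e \<le> 0}) x)"
      by (intro Bochner_Integration.integral_cong) (auto simp: indicator_def)
    also have "\<dots> = measure lborel (cball c R \<inter> {x. x \<bullet> e \<le> 0})" by simp
    also have "\<dots> = R ^ Suc n * cap_volume n \<tau>"
      using emeasure_cap[OF e dim R, of \<tau>] \<tau> R cap_volume_pos[OF \<tau>, of n]
      by (simp add: measure_def c_def n(2))
    finally show ?thesis .
  qed
  have Ieq: "I m = (LINT s|lborel. k s * (\<theta>' m s * (s - \<tau> * R))) + Suc n * (LINT s|lborel. k s * \<theta> m s)" for m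
  proof -
    have i1: "integrable lborel (\<lambda>s. k s * \<theta> m s)"
      by (rule Bochner_Integration.integrable_bound[OF kint])
         (use \<theta>b[of m] k0 in \<open>auto intro!: AE_I2 simp: abs_mult mult_left_le\<close>)
    have i2: "integrable lborel (\<lambda>s. k s * (\<theta>' m s * (s - \<tau> * R)))"
    proof (rule integrable_bounded_compact_support[where K = "{\<tau> * R - R..\<tau> * R + R}" and M = "unit_ball_vol n * R ^ n * (2 / \<delta> m * R)"])
      fix s
      show "\<bar>k s * (\<theta>' m s * (s - \<tau> * R))\<bar> \<le> unit_ball_vol n * R ^ n * (2 / \<delta> m * R)"
      proof (cases "s \<in> {\<tau> * R - R..\<tau> * R + R}")
        case True
        have "\<bar>\<theta>' m s\<bar> \<le> 2 / \<delta> m"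
          using smoothstep'_bounds[of "- s / \<delta> m - 1"] \<delta>[of m] by (simp add: \<theta>'_def divide_right_mono)
        then show ?thesis unfolding abs_mult using k0[of s] R \<delta>[of m] True by (intro mult_mono) auto
      qed (use kz R \<delta>[of m] in auto)
    qed (use kz in auto)
    have "I m = (LINT s|lborel. k s * (\<theta>' m s * (s - \<tau> * R)) + Suc n * (k s * \<theta> m s))"
      unfolding I_def by (intro Bochner_Integration.integral_cong) (auto simp: algebra_simps)
    then show ?thesis using i1 i2 by simp
  qed
  have "(\<lambda>m. I m / R2 m) \<longlonglongrightarrow> (k 0 * (\<tau> * R) + Suc n * (R ^ Suc n * cap_volume n \<tau>)) / (R + 0)"
    unfolding Ieq R2_def using I1 I2[unfolded vol] \<delta>lim R
    by (intro tendsto_divide tendsto_add tendsto_mult tendsto_const) auto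
  also have "(k 0 * (\<tau> * R) + Suc n * (R ^ Suc n * cap_volume n \<tau>)) / (R + 0) = P"
  proof -
    have "k 0 = R ^ n * slice_density n 1 \<tau>"
      using slice_density_scale[of R n \<tau>] slice_density_minus[of n R "R * \<tau>"] R by (simp add: k_def mult.commute)
    then show ?thesis using R by (simp add: P_def field_simps)
  qed
  finally have "(\<lambda>m. ennreal (I m / R2 m)) \<longlonglongrightarrow> ennreal P" by (rule tendsto_ennrealI)
  then have "ennreal P \<le> perimeter (cball c R) (half_neg e)"
    by (rule LIMSEQ_le_const2) (use lower in auto)
  then show ?thesis unfolding P_def c_def by (simp add: n(2))
qed

section \<open>Brunn-Minkowski and isodiametric inequalities\<close>

text \<open>Degenerate boxes are excluded so that a nonempty family has positive volume and any two
  members are separated by a coordinate hyperplane.\<close>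

definition box_family :: "'a::euclidean_space set set \<Rightarrow> bool" where
  "box_family D \<longleftrightarrow> finite D \<and> (\<forall>K\<in>D. interior K \<noteq> {} \<and> (\<exists>a b. K = cbox a b)) \<and>
     (\<forall>K\<in>D. \<forall>L\<in>D. K \<noteq> L \<longrightarrow> interior K \<inter> interior L = {})"

text \<open>Half the Minkowski sum. In this scaling Brunn-Minkowski takes the dimension-free form of
  a geometric mean, which splits additively when both sets are cut in the same ratio.\<close>

definition midpoints :: "'a::real_vector set \<Rightarrow> 'a set \<Rightarrow> 'a set" where
  "midpoints A B = (\<lambda>(x, y). (1/2) *\<^sub>R (x + y)) ` (A \<times> B)"

lemma midpoints_commute: "midpoints A B = midpoints B A"
  unfolding midpoints_def by (auto simp: image_iff) (metis add.commute)+

lemma midpoints_mono: "A \<subseteq> A' \<Longrightarrow> B \<subseteq> B' \<Longrightarrow> midpoints A B \<subseteq> midpoints A' B'"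
  unfolding midpoints_def by blast

lemma midpointsE:
  assumes "z \<in> midpoints A B"
  obtains x y where "x \<in> A" "y \<in> B" "z = (1/2) *\<^sub>R (x + y)"
  using assms by (auto simp: midpoints_def)

lemma compact_midpoints:
  fixes A B :: "'a::euclidean_space set"
  assumes "compact A" "compact B" shows "compact (midpoints A B)"
proof -
  have "continuous_on (A \<times> B) (\<lambda>z. (1/2) *\<^sub>R (fst z + snd z))" by (intro continuous_intros)
  then show ?thesis
    unfolding midpoints_def case_prod_beta by (rule compact_continuous_image) (intro compact_Times assms)
qed

lemma compact_box_family: "box_family D \<Longrightarrow> compact (\<Union>D)"
  unfolding box_family_def by (intro compact_Union) auto

lemma null_sets_hyperplane: "i \<in> Basis \<Longrightarrow> {x::'a::euclidean_space. x \<bullet> i = t} \<in> null_sets lborel"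
  using negligible_hyperplane[of i t] null_sets_completion_iff[of "{x. x \<bullet> i = t}" lborel] nonzero_Basis[of i]
  by (simp add: negligible_iff_null_sets inner_commute)

lemma box_familyE:
  assumes "box_family D" "K \<in> D"
  obtains a b where "K = cbox a b" "box a b \<noteq> {}"
proof -
  have "interior K \<noteq> {} \<and> (\<exists>a b. K = cbox a b)" using assms by (simp add: box_family_def)
  then show thesis using that by (metis interior_cbox)
qed

lemma measure_Un_hyperplane:
  fixes A B :: "'a::euclidean_space set"
  assumes "compact A" "compact B" "i \<in> Basis" "A \<inter> B \<subseteq> {x. x \<bullet> i = t}"
  shows "measure lborel (A \<union> B) = measure lborel A + measure lborel B"
proof (rule measure_Un_AE)
  show "AE x in lborel. x \<notin> A \<or> x \<notin> B"
    using AE_not_in[OF null_sets_hyperplane[OF assms(3), of t]] by eventually_elim (use assms in auto)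
qed (use assms in \<open>auto intro: fmeasurable_compact\<close>)

lemma box_family_pos:
  assumes "box_family D" "D \<noteq> {}"
  shows "measure lborel (\<Union>D) > 0"
proof -
  obtain K where K: "K \<in> D" using assms by auto
  then obtain a b where ab: "K = cbox a b" "box a b \<noteq> {}"
    by (rule box_familyE[OF assms(1)])
  have "0 < measure lborel K"
    unfolding ab(1) using ab(2) by (simp add: content_pos_lt_eq box_ne_empty)
  also have "\<dots> \<le> measure lborel (\<Union>D)"
    using K compact_box_family[OF assms(1)] ab(1)
    by (intro measure_mono_fmeasurable) (auto intro: fmeasurable_compact)
  finally show ?thesis .
qed

text \<open>The midpoints contain the box whose sides are the averages of the given sides, and the
  arithmetic-geometric mean inequality applies to each side.\<close>

lemma measure_midpoints_box:
  fixes a b c d :: "'a::euclidean_space"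
  assumes "box a b \<noteq> {}" "box c d \<noteq> {}"
  shows "sqrt (measure lborel (cbox a b) * measure lborel (cbox c d)) \<le> measure lborel (midpoints (cbox a b) (cbox c d))"
proof -
  have ab: "a \<bullet> i < b \<bullet> i" and cd: "c \<bullet> i < d \<bullet> i" if "i \<in> Basis" for i
    using assms that by (auto simp: box_ne_empty)
  let ?l = "(1/2) *\<^sub>R (a + c)" and ?u = "(1/2) *\<^sub>R (b + d)"
  have lu: "?l \<bullet> i \<le> ?u \<bullet> i" if "i \<in> Basis" for i
    using ab[OF that] cd[OF that] by (simp add: inner_add_left)
  have "sqrt (measure lborel (cbox a b) * measure lborel (cbox c d)) = sqrt (\<Prod>i\<in>Basis. (b \<bullet> i - a \<bullet> i) * (d \<bullet> i - c \<bullet> i))"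
    using ab cd by (simp add: content_cbox less_imp_le prod.distrib inner_diff_left)
  also have "\<dots> = (\<Prod>i\<in>Basis. sqrt ((b \<bullet> i - a \<bullet> i) * (d \<bullet> i - c \<bullet> i)))"
    by (induction rule: infinite_finite_induct) (auto simp: real_sqrt_mult)
  also have "\<dots> \<le> (\<Prod>i\<in>Basis. (?u - ?l) \<bullet> i)"
  proof (rule prod_mono, safe)
    fix i :: 'a assume i: "i \<in> Basis"
    show "0 \<le> sqrt ((b \<bullet> i - a \<bullet> i) * (d \<bullet> i - c \<bullet> i))" using ab[OF i] cd[OF i] by simp
    have "sqrt ((b \<bullet> i - a \<bullet> i) * (d \<bullet> i - c \<bullet> i)) \<le> ((b \<bullet> i - a \<bullet> i) + (d \<bullet> i - c \<bullet> i)) / 2"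
      using ab[OF i] cd[OF i] by (intro arith_geo_mean_sqrt) auto
    also have "\<dots> = (?u - ?l) \<bullet> i" by (simp add: inner_diff_left inner_add_left diff_divide_distrib add_divide_distrib)
    finally show "sqrt ((b \<bullet> i - a \<bullet> i) * (d \<bullet> i - c \<bullet> i)) \<le> (?u - ?l) \<bullet> i" .
  qed
  also have "\<dots> = measure lborel (cbox ?l ?u)"
    using lu by (simp add: content_cbox inner_diff_left)
  also have "\<dots> \<le> measure lborel (midpoints (cbox a b) (cbox c d))"
  proof (rule measure_mono_fmeasurable)
    show "cbox ?l ?u \<subseteq> midpoints (cbox a b) (cbox c d)"
    proof
      fix z assume z: "z \<in> cbox ?l ?u"
      \<comment> \<open>The common relative position in the i-th sides of the two boxes for which
        the two chosen points have midpoint \<open>z\<close>.\<close>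
      define w where "w i = (2 * (z \<bullet> i) - a \<bullet> i - c \<bullet> i) / ((b \<bullet> i - a \<bullet> i) + (d \<bullet> i - c \<bullet> i))" for i
      define x where "x = (\<Sum>i\<in>Basis. (a \<bullet> i + w i * (b \<bullet> i - a \<bullet> i)) *\<^sub>R i)"
      define y where "y = (\<Sum>i\<in>Basis. (c \<bullet> i + w i * (d \<bullet> i - c \<bullet> i)) *\<^sub>R i)"
      have w: "0 \<le> w i" "w i \<le> 1" "w i * ((b \<bullet> i - a \<bullet> i) + (d \<bullet> i - c \<bullet> i)) = 2 * (z \<bullet> i) - a \<bullet> i - c \<bullet> i" if i: "i \<in> Basis" for i
      proof -
        have zi: "a \<bullet> i + c \<bullet> i \<le> 2 * (z \<bullet> i)" "2 * (z \<bullet> i) \<le> b \<bullet> i + d \<bullet> i"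
          using z i by (auto simp: mem_box inner_add_left)
        have p: "(b \<bullet> i - a \<bullet> i) + (d \<bullet> i - c \<bullet> i) > 0" using ab[OF i] cd[OF i] by simp
        show "0 \<le> w i" unfolding w_def using zi p by (intro divide_nonneg_pos) auto
        show "w i \<le> 1" unfolding w_def using zi p by (simp add: pos_divide_le_eq)
        show "w i * ((b \<bullet> i - a \<bullet> i) + (d \<bullet> i - c \<bullet> i)) = 2 * (z \<bullet> i) - a \<bullet> i - c \<bullet> i"
          unfolding w_def using p by simp
      qed
      have xi: "x \<bullet> i = a \<bullet> i + w i * (b \<bullet> i - a \<bullet> i)" and yi: "y \<bullet> i = c \<bullet> i + w i * (d \<bullet> i - c \<bullet> i)"
        if "i \<in> Basis" for i using that by (simp_all add: x_def y_def)
      have "x \<in> cbox a b" unfolding mem_box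
      proof safe
        fix i :: 'a assume i: "i \<in> Basis"
        have "0 \<le> w i * (b \<bullet> i - a \<bullet> i)" "w i * (b \<bullet> i - a \<bullet> i) \<le> b \<bullet> i - a \<bullet> i"
          using w[OF i] ab[OF i] by (auto simp: mult_left_le_one_le)
        then show "a \<bullet> i \<le> x \<bullet> i" "x \<bullet> i \<le> b \<bullet> i" using xi[OF i] by auto
      qed
      moreover have "y \<in> cbox c d" unfolding mem_box
      proof safe
        fix i :: 'a assume i: "i \<in> Basis"
        have "0 \<le> w i * (d \<bullet> i - c \<bullet> i)" "w i * (d \<bullet> i - c \<bullet> i) \<le> d \<bullet> i - c \<bullet> i"
          using w[OF i] cd[OF i] by (auto simp: mult_left_le_one_le)
        then show "c \<bullet> i \<le> y \<bullet> i" "y \<bullet> i \<le> d \<bullet> i" using yi[OF i] by auto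
      qed
      moreover have "z = (1/2) *\<^sub>R (x + y)"
      proof (rule euclidean_eqI)
        fix i :: 'a assume i: "i \<in> Basis"
        show "z \<bullet> i = ((1/2) *\<^sub>R (x + y)) \<bullet> i"
          using w(3)[OF i] xi[OF i] yi[OF i] by (simp add: inner_add_left algebra_simps)
      qed
      ultimately show "z \<in> midpoints (cbox a b) (cbox c d)"
        unfolding midpoints_def by (auto intro!: rev_image_eqI[of "(x, y)"])
    qed
    show "midpoints (cbox a b) (cbox c d) \<in> fmeasurable lborel"
      by (intro fmeasurable_compact compact_midpoints) auto
  qed simp
  finally show ?thesis .
qed

text \<open>\<open>H\<close> is a closed half space and \<open>U\<close> its interior. Boxes whose
  interior misses \<open>U\<close> are dropped: a box is the closure of its interior, so it then
  misses \<open>U\<close> and only the null set \<open>H - U\<close> is affected. Dropping them is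
  what lets the number of boxes fall in the induction.\<close>

lemma box_family_cut:
  fixes D :: "'a::euclidean_space set set"
  assumes D: "box_family D"
    and H: "\<And>a b. \<exists>c d. cbox a b \<inter> H = cbox c d" and U: "open U" "U \<subseteq> H" "H - U \<in> null_sets lborel"
  obtains D' where "box_family D'" "card D' \<le> card {K\<in>D. interior K \<inter> U \<noteq> {}}"
    "\<Union>D' \<subseteq> \<Union>D \<inter> H" "measure lborel (\<Union>D') = measure lborel (\<Union>D \<inter> H)"
    "D' = {} \<longleftrightarrow> {K\<in>D. interior K \<inter> U \<noteq> {}} = {}"
proof -
  define F where "F = {K\<in>D. interior K \<inter> U \<noteq> {}}"
  define D' where "D' = (\<lambda>K. K \<inter> H) ` F"
  have fin: "finite F" using D by (auto simp: F_def box_family_def)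
  have clH: "closed (\<Union>D \<inter> H)" "compact (\<Union>D \<inter> H)"
  proof -
    have "\<Union>D \<inter> H = (\<Union>K\<in>D. K \<inter> H)" by auto
    moreover have "compact (\<Union>K\<in>D. K \<inter> H)"
      using D H by (intro compact_UN) (auto simp: box_family_def, metis compact_cbox)
    ultimately show "compact (\<Union>D \<inter> H)" by simp
    then show "closed (\<Union>D \<inter> H)" by (rule compact_imp_closed)
  qed
  have "box_family D'"
    unfolding box_family_def
  proof (intro conjI ballI impI)
    show "finite D'" using fin by (simp add: D'_def)
    fix L assume "L \<in> D'"
    then obtain K where K: "K \<in> F" "L = K \<inter> H" by (auto simp: D'_def)
    have "interior K \<inter> U \<subseteq> interior L"
      unfolding K(2) using U by (auto simp: interior_Int intro: interior_maximal[THEN subsetD])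
    then show "interior L \<noteq> {}" using K by (auto simp: F_def)
    show "\<exists>a b. L = cbox a b" using K D H by (auto simp: F_def box_family_def)
    fix L' assume "L' \<in> D'" "L \<noteq> L'"
    then obtain K' where K': "K' \<in> F" "L' = K' \<inter> H" by (auto simp: D'_def)
    then have "K \<noteq> K'" using K \<open>L \<noteq> L'\<close> by auto
    then have "interior K \<inter> interior K' = {}" using K K' D by (auto simp: F_def box_family_def)
    then show "interior L \<inter> interior L' = {}" unfolding K(2) K'(2) by auto
  qed
  moreover have "card D' \<le> card F" unfolding D'_def by (rule card_image_le[OF fin])
  moreover have sub: "\<Union>D' \<subseteq> \<Union>D \<inter> H" by (auto simp: D'_def F_def)
  moreover have "measure lborel (\<Union>D') = measure lborel (\<Union>D \<inter> H)"
  proof (rule measure_eq_AE)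
    show "AE x in lborel. x \<in> \<Union>D' \<longleftrightarrow> x \<in> \<Union>D \<inter> H"
      using AE_not_in[OF U(3)]
    proof eventually_elim
      case (elim x)
      have "x \<in> \<Union>D'" if x: "x \<in> \<Union>D \<inter> H"
      proof -
        obtain K where K: "K \<in> D" "x \<in> K" using x by auto
        have xU: "x \<in> U" using elim x by auto
        obtain a b where ab: "K = cbox a b" "box a b \<noteq> {}" using box_familyE[OF D K(1)] .
        have "x \<in> closure (interior K)" using K ab by (simp add: closure_box)
        then have "interior K \<inter> U \<noteq> {}" using xU U(1) by (metis Int_commute open_Int_closure_eq_empty IntI empty_iff)
        then show ?thesis using K x by (auto simp: D'_def F_def)
      qed
      then show ?case using sub by auto
    qed
    show "\<Union>D' \<in> sets lborel" using compact_box_family[OF \<open>box_family D'\<close>] by (simp add: compact_imp_closed)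
    show "\<Union>D \<inter> H \<in> sets lborel" using clH by simp
  qed
  moreover have "D' = {} \<longleftrightarrow> F = {}" by (auto simp: D'_def)
  ultimately show thesis using that unfolding F_def by blast
qed

text \<open>Hyperplanes are null, so the indicators converge almost everywhere. Continuity provides,
  by the intermediate value theorem, a cut in any prescribed ratio.\<close>

lemma continuous_measure_halfspace:
  fixes S :: "'a::euclidean_space set"
  assumes "compact S" "i \<in> Basis"
  shows "continuous_on UNIV (\<lambda>s. measure lborel (S \<inter> {x. x \<bullet> i \<le> s}))"
proof -
  have S [measurable]: "S \<in> sets borel" using assms by (simp add: compact_imp_closed)
  have "(\<lambda>n. measure lborel (S \<inter> {x. x \<bullet> i \<le> u n})) \<longlonglongrightarrow> measure lborel (S \<inter> {x. x \<bullet> i \<le> s})"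
    if u: "u \<longlonglongrightarrow> s" for u s
  proof -
    have "(\<lambda>n. LINT x|lborel. indicator (S \<inter> {x. x \<bullet> i \<le> u n}) x :: real) \<longlonglongrightarrow> (LINT x|lborel. indicator (S \<inter> {x. x \<bullet> i \<le> s}) x)"
    proof (rule integral_dominated_convergence[where w = "indicator S"])
      show "integrable lborel (indicator S :: 'a \<Rightarrow> real)"
        using emeasure_compact_finite[OF assms(1)] by (intro integrable_real_indicator) auto
      show "AE x in lborel. (\<lambda>n. indicator (S \<inter> {x. x \<bullet> i \<le> u n}) x :: real) \<longlonglongrightarrow> indicator (S \<inter> {x. x \<bullet> i \<le> s}) x"
        using AE_not_in[OF null_sets_hyperplane[OF assms(2), of s]]
      proof eventually_elim
        case (elim x)
        then consider "x \<bullet> i < s" | "x \<bullet> i > s" by fastforce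
        then have "\<forall>\<^sub>F n in sequentially. indicator (S \<inter> {x. x \<bullet> i \<le> u n}) x = (indicator (S \<inter> {x. x \<bullet> i \<le> s}) x :: real)"
        proof cases
          case 1
          from order_tendstoD(1)[OF u 1] show ?thesis by eventually_elim (use 1 in \<open>auto simp: indicator_def\<close>)
        next
          case 2
          from order_tendstoD(2)[OF u 2] show ?thesis by eventually_elim (use 2 in \<open>auto simp: indicator_def\<close>)
        qed
        then show ?case by (rule tendsto_eventually)
      qed
    qed (auto simp: indicator_def)
    then show ?thesis by simp
  qed
  then show ?thesis
    by (intro continuous_at_imp_continuous_on ballI) (auto simp: continuous_at_sequentially comp_def)
qed

text \<open>Multiplicative Brunn-Minkowski inequality for unions of boxes: cut both families by parallel
  hyperplanes in the same volume ratio and induct on the number of boxes (Hadwiger-Ohmann).\<close>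

lemma measure_midpoints_box_family_aux:
  fixes D E :: "'a::euclidean_space set set"
  assumes D: "box_family D" and E: "box_family E" "E \<noteq> {}" and card: "card D \<ge> 2"
    and IH: "\<And>D' E' :: 'a set set. box_family D' \<Longrightarrow> box_family E' \<Longrightarrow> D' \<noteq> {} \<Longrightarrow> E' \<noteq> {} \<Longrightarrow>
      card D' + card E' < card D + card E \<Longrightarrow>
      sqrt (measure lborel (\<Union>D') * measure lborel (\<Union>E')) \<le> measure lborel (midpoints (\<Union>D') (\<Union>E'))"
  shows "sqrt (measure lborel (\<Union>D) * measure lborel (\<Union>E)) \<le> measure lborel (midpoints (\<Union>D) (\<Union>E))"
proof -
  let ?m = "measure (lborel :: 'a measure)"
  have "\<exists>K\<in>D. \<exists>L\<in>D. K \<noteq> L"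
  proof (rule ccontr)
    assume "\<not> ?thesis"
    then have "card D \<le> 1" using D by (auto simp: box_family_def card_le_Suc0_iff_eq)
    then show False using card by simp
  qed
  then obtain K0 L0 where KL0: "K0 \<in> D" "L0 \<in> D" "K0 \<noteq> L0" by auto
  obtain a b where K0: "K0 = cbox a b" "box a b \<noteq> {}" using box_familyE[OF D KL0(1)] .
  obtain c d where L0: "L0 = cbox c d" "box c d \<noteq> {}" using box_familyE[OF D KL0(2)] .
  have "interior K0 \<inter> interior L0 = {}" using D KL0 by (simp add: box_family_def)
  then have "box a b \<inter> box c d = {}" by (simp add: K0 L0)
  then obtain i where i: "i \<in> Basis" "b \<bullet> i \<le> c \<bullet> i \<or> d \<bullet> i \<le> a \<bullet> i"
    using K0(2) L0(2) unfolding disjoint_interval by (meson box_ne_empty(2) not_le)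
  \<comment> \<open>Disjoint open boxes are disjoint in some coordinate. \<open>K\<close> and
    \<open>L\<close> name the two boxes in increasing order, so each half of the cut loses one of
    them.\<close>
  obtain K L t where KL: "K \<in> D" "L \<in> D" and sep: "interior K \<subseteq> {x. x \<bullet> i < t}" "interior L \<subseteq> {x. x \<bullet> i > t}"
  proof (cases "b \<bullet> i \<le> c \<bullet> i")
    case True
    then show ?thesis
      using that[of K0 L0 "b \<bullet> i"] KL0 i by (force simp: K0 L0 mem_box)
  next
    case False
    then show ?thesis
      using that[of L0 K0 "d \<bullet> i"] KL0 i by (force simp: K0 L0 mem_box)
  qed
  have ne: "interior K \<noteq> {}" "interior L \<noteq> {}" and finD: "finite D" and finE: "finite E"
    using D E KL by (auto simp: box_family_def)
  have lower: "\<exists>c d. cbox a b \<inter> {x. x \<bullet> i \<le> t} = cbox c d" and upper: "\<exists>c d. cbox a b \<inter> {x. x \<bullet> i \<ge> t} = cbox c d" for a b t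
    using interval_split[OF i(1)] by blast+
  have lowU: "open {x. x \<bullet> i < t}" "{x. x \<bullet> i < t} \<subseteq> {x. x \<bullet> i \<le> t}" "{x. x \<bullet> i \<le> t} - {x. x \<bullet> i < t} \<in> null_sets lborel"
    and upU: "open {x. x \<bullet> i > t}" "{x. x \<bullet> i > t} \<subseteq> {x. x \<bullet> i \<ge> t}" "{x. x \<bullet> i \<ge> t} - {x. x \<bullet> i > t} \<in> null_sets lborel" for t
  proof -
    show "open {x. x \<bullet> i < t}" "open {x. x \<bullet> i > t}" by (auto intro!: open_Collect_less continuous_intros)
    have "{x. x \<bullet> i \<le> t} - {x. x \<bullet> i < t} = {x. x \<bullet> i = t}" "{x. x \<bullet> i \<ge> t} - {x. x \<bullet> i > t} = {x. x \<bullet> i = t}" by auto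
    then show "{x. x \<bullet> i \<le> t} - {x. x \<bullet> i < t} \<in> null_sets lborel" "{x. x \<bullet> i \<ge> t} - {x. x \<bullet> i > t} \<in> null_sets lborel"
      using null_sets_hyperplane[OF i(1), of t] by simp_all
  qed auto
  obtain D1 where D1: "box_family D1" "card D1 \<le> card {K\<in>D. interior K \<inter> {x. x \<bullet> i < t} \<noteq> {}}"
    "\<Union>D1 \<subseteq> \<Union>D \<inter> {x. x \<bullet> i \<le> t}" "?m (\<Union>D1) = ?m (\<Union>D \<inter> {x. x \<bullet> i \<le> t})"
    "D1 = {} \<longleftrightarrow> {K\<in>D. interior K \<inter> {x. x \<bullet> i < t} \<noteq> {}} = {}"
    by (rule box_family_cut[OF D lower lowU])
  obtain D2 where D2: "box_family D2" "card D2 \<le> card {K\<in>D. interior K \<inter> {x. x \<bullet> i > t} \<noteq> {}}"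
    "\<Union>D2 \<subseteq> \<Union>D \<inter> {x. x \<bullet> i \<ge> t}" "?m (\<Union>D2) = ?m (\<Union>D \<inter> {x. x \<bullet> i \<ge> t})"
    "D2 = {} \<longleftrightarrow> {K\<in>D. interior K \<inter> {x. x \<bullet> i > t} \<noteq> {}} = {}"
    by (rule box_family_cut[OF D upper upU])
  have "K \<in> {K\<in>D. interior K \<inter> {x. x \<bullet> i < t} \<noteq> {}}" using KL ne sep by auto
  then have D1ne: "D1 \<noteq> {}" using D1(5) by blast
  have "L \<in> {K\<in>D. interior K \<inter> {x. x \<bullet> i > t} \<noteq> {}}" using KL ne sep by auto
  then have D2ne: "D2 \<noteq> {}" using D2(5) by blast
  have "L \<notin> {K\<in>D. interior K \<inter> {x. x \<bullet> i < t} \<noteq> {}}" using sep by auto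
  then have "{K\<in>D. interior K \<inter> {x. x \<bullet> i < t} \<noteq> {}} \<subset> D" using KL by blast
  then have cD1: "card D1 < card D" using D1(2) psubset_card_mono[OF finD] by (meson le_less_trans)
  have "K \<notin> {K\<in>D. interior K \<inter> {x. x \<bullet> i > t} \<noteq> {}}" using sep by auto
  then have "{K\<in>D. interior K \<inter> {x. x \<bullet> i > t} \<noteq> {}} \<subset> D" using KL by blast
  then have cD2: "card D2 < card D" using D2(2) psubset_card_mono[OF finD] by (meson le_less_trans)
  have split: "?m S = ?m (S \<inter> {x. x \<bullet> i \<le> s}) + ?m (S \<inter> {x. x \<bullet> i \<ge> s})" if S: "compact S" for S s
  proof -
    have "?m ((S \<inter> {x. x \<bullet> i \<le> s}) \<union> (S \<inter> {x. x \<bullet> i \<ge> s})) = ?m (S \<inter> {x. x \<bullet> i \<le> s}) + ?m (S \<inter> {x. x \<bullet> i \<ge> s})"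
      by (rule measure_Un_hyperplane[OF _ _ i(1), of _ _ s])
         (auto intro!: compact_Int_closed S closed_Collect_le continuous_intros)
    moreover have "(S \<inter> {x. x \<bullet> i \<le> s}) \<union> (S \<inter> {x. x \<bullet> i \<ge> s}) = S" by auto
    ultimately show ?thesis by simp
  qed
  define mD where "mD = ?m (\<Union>D)"
  define mE where "mE = ?m (\<Union>E)"
  define \<theta> where "\<theta> = ?m (\<Union>D1) / mD"
  have cpD: "compact (\<Union>D)" "compact (\<Union>E)" using compact_box_family D E by blast+
  have mD: "mD = ?m (\<Union>D1) + ?m (\<Union>D2)" unfolding mD_def D1(4) D2(4) by (rule split[OF cpD(1)])
  have pos: "?m (\<Union>D1) > 0" "?m (\<Union>D2) > 0" "mE > 0"
    unfolding mE_def
    by (rule box_family_pos[OF D1(1) D1ne] box_family_pos[OF D2(1) D2ne] box_family_pos[OF E])+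
  then have mDpos: "mD > 0" using mD by simp
  have \<theta>: "0 < \<theta>" "\<theta> < 1" "?m (\<Union>D1) = \<theta> * mD" "?m (\<Union>D2) = (1 - \<theta>) * mD"
    using pos mD mDpos by (auto simp: \<theta>_def field_simps)
  obtain r where r: "\<Union>E \<subseteq> cball 0 r" "r > 0"
    using bounded_subset_ballD[OF compact_imp_bounded[OF cpD(2)], of 0] ball_subset_cball by blast
  define f where "f s = ?m (\<Union>E \<inter> {x. x \<bullet> i \<le> s})" for s
  have xr: "\<bar>x \<bullet> i\<bar> \<le> r" if "x \<in> \<Union>E" for x
    using r that Basis_le_norm[OF i(1), of x] by fastforce
  have f0: "f (- r - 1) = 0"
  proof -
    have "\<Union>E \<inter> {x. x \<bullet> i \<le> - r - 1} = {}" using xr by fastforce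
    then show ?thesis by (simp add: f_def)
  qed
  have f1: "f r = mE"
  proof -
    have "\<Union>E \<inter> {x. x \<bullet> i \<le> r} = \<Union>E" using xr by fastforce
    then show ?thesis by (simp add: f_def mE_def)
  qed
  \<comment> \<open>The second family is cut at the height giving the same ratio as the first; at
    the two ends of the interval the ratio is 0 and 1.\<close>
  have "\<exists>s. - r - 1 \<le> s \<and> s \<le> r \<and> f s = \<theta> * mE"
  proof (rule IVT')
    show "f (- r - 1) \<le> \<theta> * mE" using f0 \<theta> pos by simp
    show "\<theta> * mE \<le> f r" using f1 \<theta> pos by simp
    show "continuous_on {- r - 1..r} f"
      unfolding f_def by (rule continuous_on_subset[OF continuous_measure_halfspace[OF cpD(2) i(1)]]) simp
  qed (use r in auto)
  then obtain s where s: "f s = \<theta> * mE" by auto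
  obtain E1 where E1: "box_family E1" "card E1 \<le> card {K\<in>E. interior K \<inter> {x. x \<bullet> i < s} \<noteq> {}}"
    "\<Union>E1 \<subseteq> \<Union>E \<inter> {x. x \<bullet> i \<le> s}" "?m (\<Union>E1) = ?m (\<Union>E \<inter> {x. x \<bullet> i \<le> s})"
    by (rule box_family_cut[OF E(1) lower lowU])
  obtain E2 where E2: "box_family E2" "card E2 \<le> card {K\<in>E. interior K \<inter> {x. x \<bullet> i > s} \<noteq> {}}"
    "\<Union>E2 \<subseteq> \<Union>E \<inter> {x. x \<bullet> i \<ge> s}" "?m (\<Union>E2) = ?m (\<Union>E \<inter> {x. x \<bullet> i \<ge> s})"
    by (rule box_family_cut[OF E(1) upper upU])
  have mE1: "?m (\<Union>E1) = \<theta> * mE" using E1(4) s by (simp add: f_def)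
  have mE2: "?m (\<Union>E2) = (1 - \<theta>) * mE"
    using split[OF cpD(2), of s] E1(4) E2(4) mE1 by (simp add: mE_def algebra_simps)
  have "?m (\<Union>E1) > 0" "?m (\<Union>E2) > 0" unfolding mE1 mE2 using \<theta> pos by auto
  then have E12ne: "E1 \<noteq> {}" "E2 \<noteq> {}" by auto
  \<comment> \<open>The pieces of \<open>E\<close> need not have fewer boxes; the strict drop of the
    total comes from \<open>D\<close>.\<close>
  have cE: "card E1 \<le> card E" "card E2 \<le> card E"
    by (rule order_trans[OF E1(2)] order_trans[OF E2(2)], rule card_mono[OF finE], blast)+
  have 1: "sqrt (?m (\<Union>D1) * ?m (\<Union>E1)) \<le> ?m (midpoints (\<Union>D1) (\<Union>E1))"
    using D1(1) E1(1) D1ne E12ne cD1 cE by (intro IH) auto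
  have 2: "sqrt (?m (\<Union>D2) * ?m (\<Union>E2)) \<le> ?m (midpoints (\<Union>D2) (\<Union>E2))"
    using D2(1) E2(1) D2ne E12ne cD2 cE by (intro IH) auto
  \<comment> \<open>Equal ratios make the geometric mean of each pair of pieces the same fraction of
    the whole, and the two fractions add up to 1.\<close>
  have sq: "sqrt (w * x * (w * y)) = w * sqrt (x * y)" if "w \<ge> 0" for w x y :: real
    using that real_sqrt_mult[of "w\<^sup>2" "x * y"] by (simp add: power2_eq_square mult_ac)
  have "sqrt (mD * mE) = \<theta> * sqrt (mD * mE) + (1 - \<theta>) * sqrt (mD * mE)" by (simp add: algebra_simps)
  also have "\<dots> = sqrt (?m (\<Union>D1) * ?m (\<Union>E1)) + sqrt (?m (\<Union>D2) * ?m (\<Union>E2))"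
    unfolding \<theta>(3,4) mE1 mE2 using \<theta>(1,2) by (simp add: sq)
  also have "\<dots> \<le> ?m (midpoints (\<Union>D1) (\<Union>E1)) + ?m (midpoints (\<Union>D2) (\<Union>E2))" using 1 2 by simp
  also have "\<dots> = ?m (midpoints (\<Union>D1) (\<Union>E1) \<union> midpoints (\<Union>D2) (\<Union>E2))"
  \<comment> \<open>Midpoints of the lower pieces have height at most \<open>(t + s) / 2\<close>,
    those of the upper pieces at least that much, so the overlap is null.\<close>
  proof (rule measure_Un_hyperplane[symmetric, OF _ _ i(1), of _ _ "(t + s) / 2"])
    show "compact (midpoints (\<Union>D1) (\<Union>E1))" "compact (midpoints (\<Union>D2) (\<Union>E2))"
      using compact_box_family D1(1) D2(1) E1(1) E2(1) by (auto intro: compact_midpoints)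
    have "z \<bullet> i \<le> (t + s) / 2" if z: "z \<in> midpoints (\<Union>D1) (\<Union>E1)" for z
    proof -
      obtain x y where "x \<in> \<Union>D1" "y \<in> \<Union>E1" "z = (1/2) *\<^sub>R (x + y)" using midpointsE[OF z] .
      moreover from this have "x \<bullet> i \<le> t" "y \<bullet> i \<le> s" using D1(3) E1(3) by auto
      ultimately show ?thesis by (simp add: inner_add_left)
    qed
    moreover have "z \<bullet> i \<ge> (t + s) / 2" if z: "z \<in> midpoints (\<Union>D2) (\<Union>E2)" for z
    proof -
      obtain x y where "x \<in> \<Union>D2" "y \<in> \<Union>E2" "z = (1/2) *\<^sub>R (x + y)" using midpointsE[OF z] .
      moreover from this have "x \<bullet> i \<ge> t" "y \<bullet> i \<ge> s" using D2(3) E2(3) by auto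
      ultimately show ?thesis by (simp add: inner_add_left)
    qed
    ultimately show "midpoints (\<Union>D1) (\<Union>E1) \<inter> midpoints (\<Union>D2) (\<Union>E2) \<subseteq> {x. x \<bullet> i = (t + s) / 2}"
      by (auto intro: antisym)
  qed
  also have "\<dots> \<le> ?m (midpoints (\<Union>D) (\<Union>E))"
  proof (rule measure_mono_fmeasurable)
    have "midpoints (\<Union>D1) (\<Union>E1) \<subseteq> midpoints (\<Union>D) (\<Union>E)" "midpoints (\<Union>D2) (\<Union>E2) \<subseteq> midpoints (\<Union>D) (\<Union>E)"
      using D1(3) D2(3) E1(3) E2(3) by (intro midpoints_mono; blast)+
    then show "midpoints (\<Union>D1) (\<Union>E1) \<union> midpoints (\<Union>D2) (\<Union>E2) \<subseteq> midpoints (\<Union>D) (\<Union>E)" by blast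
    show "midpoints (\<Union>D1) (\<Union>E1) \<union> midpoints (\<Union>D2) (\<Union>E2) \<in> sets lborel"
      using compact_box_family D1(1) D2(1) E1(1) E2(1)
      by (auto intro!: compact_imp_closed compact_midpoints borel_closed)
  qed (intro fmeasurable_compact compact_midpoints cpD)
  finally show ?thesis unfolding mD_def mE_def .
qed

text \<open>Midpoints are symmetric in the two sets, so whichever family has two boxes can be the
  one that is cut; two single boxes are the base case.\<close>

lemma measure_midpoints_box_family:
  fixes D E :: "'a::euclidean_space set set"
  assumes "box_family D" "box_family E" "D \<noteq> {}" "E \<noteq> {}"
  shows "sqrt (measure lborel (\<Union>D) * measure lborel (\<Union>E)) \<le> measure lborel (midpoints (\<Union>D) (\<Union>E))"
  using assms
proof (induction "card D + card E" arbitrary: D E rule: less_induct)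
  case less
  have fin: "finite D" "finite E" using less.prems by (auto simp: box_family_def)
  have "card D > 0" "card E > 0" using less.prems fin by (simp_all add: card_gt_0_iff)
  then consider "card D \<ge> 2" | "card E \<ge> 2" | "card D = 1" "card E = 1" by linarith
  then show ?case
  proof cases
    case 1
    show ?thesis
      by (rule measure_midpoints_box_family_aux[OF less.prems(1,2,4) 1]) (rule less.hyps)
  next
    case 2
    have "sqrt (measure lborel (\<Union>E) * measure lborel (\<Union>D)) \<le> measure lborel (midpoints (\<Union>E) (\<Union>D))"
      by (rule measure_midpoints_box_family_aux[OF less.prems(2,1,3) 2], rule less.hyps) (simp_all add: add.commute)
    then show ?thesis by (simp add: midpoints_commute mult.commute)
  next
    case 3
    then obtain K L where KL: "D = {K}" "E = {L}" by (auto simp: card_1_singleton_iff)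
    obtain a b where "K = cbox a b" "box a b \<noteq> {}" using box_familyE[OF less.prems(1), of K] KL by auto
    moreover obtain c d where "L = cbox c d" "box c d \<noteq> {}" using box_familyE[OF less.prems(2), of L] KL by auto
    ultimately show ?thesis using measure_midpoints_box[of a b c d] KL by simp
  qed
qed

section \<open>The isodiametric inequality for cylinders\<close>

lemma emeasure_cylinder:
  fixes e :: "'a::euclidean_space"
  assumes e: "e \<in> Basis" and dim: "DIM('a) \<ge> 2" and "a \<le> b" "r \<ge> 0"
  shows "emeasure lborel {x. a \<le> x \<bullet> e \<and> x \<bullet> e \<le> b \<and> norm (x - (x \<bullet> e) *\<^sub>R e) \<le> r} =
    ennreal ((b - a) * (unit_ball_vol (DIM('a) - 1) * r ^ (DIM('a) - 1)))"
proof -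
  let ?C = "{x. a \<le> x \<bullet> e \<and> x \<bullet> e \<le> b \<and> norm (x - (x \<bullet> e) *\<^sub>R e) \<le> r}"
  have [measurable]: "?C \<in> sets borel" by measurable
  have "emeasure lborel ?C = (\<integral>\<^sup>+x. indicator {a..b} (x \<bullet> e) * indicator {x. norm (x - (x \<bullet> e) *\<^sub>R e) \<le> (\<lambda>_. r) (x \<bullet> e)} x \<partial>lborel)"
  proof (subst nn_integral_indicator[symmetric])
    show "?C \<in> sets lborel" by simp
  qed (intro nn_integral_cong, auto simp: indicator_def)
  also have "\<dots> = (\<integral>\<^sup>+s. indicator {a..b} s * ennreal (unit_ball_vol (DIM('a) - 1) * r ^ (DIM('a) - 1)) \<partial>lborel)"
    using assms by (subst nn_integral_cylinder[OF e dim]) auto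
  also have "\<dots> = ennreal (b - a) * ennreal (unit_ball_vol (DIM('a) - 1) * r ^ (DIM('a) - 1))"
    using assms by (subst nn_integral_multc) auto
  also have "\<dots> = ennreal ((b - a) * (unit_ball_vol (DIM('a) - 1) * r ^ (DIM('a) - 1)))"
    using assms by (simp add: ennreal_mult')
  finally show ?thesis .
qed

text \<open>Finitely many boxes inside balls of radius \<open>\<eta>\<close> cover \<open>W\<close>
  by compactness. Dissecting their union makes them nonoverlapping, and the degenerate pieces are
  null.\<close>

lemma box_family_approx:
  fixes W :: "'a::euclidean_space set"
  assumes W: "compact W" and \<eta>: "\<eta> > 0"
  obtains D where "box_family D" "measure lborel W \<le> measure lborel (\<Union>D)"
    "\<And>x. x \<in> \<Union>D \<Longrightarrow> \<exists>y\<in>W. dist y x < \<eta>"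
proof -
  have "\<exists>a b. x \<in> box a b \<and> cbox a b \<subseteq> ball x \<eta>" for x :: 'a
    using open_contains_cbox[of "ball x \<eta>" x] \<eta> by (metis open_ball centre_in_ball)
  then obtain a b :: "'a \<Rightarrow> 'a" where ab: "\<And>x. x \<in> box (a x) (b x)" "\<And>x. cbox (a x) (b x) \<subseteq> ball x \<eta>" by metis
  obtain F where F: "F \<subseteq> W" "finite F" "W \<subseteq> (\<Union>x\<in>F. box (a x) (b x))"
    by (rule compactE_image[OF W, of W "\<lambda>x. box (a x) (b x)"]) (use ab(1) in auto)
  obtain p where p: "p division_of (\<Union>((\<lambda>x. cbox (a x) (b x)) ` F))"
  proof (rule elementary_unions_intervals)
    show "finite ((\<lambda>x. cbox (a x) (b x)) ` F)" using F(2) by simp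
  qed blast+
  define D where "D = {K\<in>p. interior K \<noteq> {}}"
  have fin: "finite p" using p by (rule division_of_finite)
  have cb: "\<exists>a b. K = cbox a b" if "K \<in> p" for K using division_ofD(4)[OF p that] .
  have "box_family D"
    unfolding box_family_def D_def using fin cb division_ofD(5)[OF p] by auto
  moreover have "measure lborel W \<le> measure lborel (\<Union>D)"
  proof -
    have U: "\<Union>p = \<Union>((\<lambda>x. cbox (a x) (b x)) ` F)" by (rule division_ofD(6)[OF p])
    have cp: "compact (\<Union>p)" using fin cb by (intro compact_Union) (auto, metis compact_cbox)
    have "measure lborel W \<le> measure lborel (\<Union>p)"
    proof (rule measure_mono_fmeasurable)
      show "W \<subseteq> \<Union>p" unfolding U using F(3) box_subset_cbox by blast
    qed (use W cp in \<open>auto intro: fmeasurable_compact simp: compact_imp_closed\<close>)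
    also have "\<dots> = measure lborel (\<Union>D)"
    proof (rule measure_eq_AE)
      have "(\<Union>K\<in>p - D. K) \<in> null_sets lborel"
      proof (rule null_sets_UN')
        fix K assume K: "K \<in> p - D"
        then obtain u v where uv: "K = cbox u v" using cb by blast
        then have "box u v = {}" using K by (simp add: D_def)
        then show "K \<in> null_sets lborel" unfolding uv using null_sets_cbox_Diff_box[of u v] by simp
      qed (use fin in \<open>auto intro: countable_finite\<close>)
      then have null: "\<Union>(p - D) \<in> null_sets lborel" by simp
      show "AE x in lborel. x \<in> \<Union>p \<longleftrightarrow> x \<in> \<Union>D"
        using AE_not_in[OF null] by eventually_elim (auto simp: D_def)
    qed (use cp compact_box_family[OF \<open>box_family D\<close>] in \<open>auto simp: compact_imp_closed\<close>)
    finally show ?thesis .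
  qed
  moreover have "\<exists>y\<in>W. dist y x < \<eta>" if "x \<in> \<Union>D" for x
  proof -
    have "x \<in> \<Union>p" using that by (auto simp: D_def)
    then obtain y where "y \<in> F" "x \<in> cbox (a y) (b y)" unfolding division_ofD(6)[OF p] by blast
    then show ?thesis using F(1) ab(2)[of y] by (auto simp: subset_iff)
  qed
  ultimately show thesis using that by blast
qed

text \<open>Pairing a family with its reflection turns midpoints into half differences.\<close>

lemma box_family_uminus:
  assumes "box_family D"
  shows "box_family ((`) uminus ` D)"
proof -
  have um: "(`) uminus = (\<lambda>K. uminus ` K)" by auto
  have int: "interior (uminus ` K) = uminus ` interior K" for K :: "'a set" by (rule interior_negations)
  have cb: "uminus ` cbox a b = cbox (- b) (- a)" for a b :: 'a
  proof -
    have "x \<in> uminus ` cbox a b \<longleftrightarrow> x \<in> cbox (- b) (- a)" for x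
    proof -
      have "x \<in> uminus ` cbox a b \<longleftrightarrow> - x \<in> cbox a b" by (metis (no_types) image_iff minus_minus)
      also have "\<dots> \<longleftrightarrow> x \<in> cbox (- b) (- a)"
        unfolding mem_box inner_minus_left by (intro ball_cong refl) linarith
      finally show ?thesis .
    qed
    then show ?thesis by blast
  qed
  show ?thesis
    unfolding box_family_def
  proof (intro conjI ballI impI)
    show "finite ((`) uminus ` D)" using assms by (simp add: box_family_def)
    fix K' assume "K' \<in> (`) uminus ` D"
    then obtain K where K: "K \<in> D" "K' = uminus ` K" by auto
    obtain a b where ab: "K = cbox a b" "box a b \<noteq> {}" using box_familyE[OF assms K(1)] .
    then show "interior K' \<noteq> {}" "\<exists>a b. K' = cbox a b" unfolding K int by (auto simp: cb)
    fix L' assume "L' \<in> (`) uminus ` D" "K' \<noteq> L'"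
    then obtain L where L: "L \<in> D" "L' = uminus ` L" "K \<noteq> L" using K by auto
    then have "interior K \<inter> interior L = {}" using assms K by (simp add: box_family_def)
    then show "interior K' \<inter> interior L' = {}" unfolding K L int by auto
  qed
qed

text \<open>Isodiametric inequality for the projection along \<open>e\<close>, read off from \<open>|W| \<le> |(W - W)/2|\<close>.\<close>

lemma isodiametric_cylinder:
  fixes W :: "'a::euclidean_space set"
  assumes e: "e \<in> Basis" and dim: "DIM('a) \<ge> 2" and W: "compact W" and d: "d \<ge> 0" and h: "h \<ge> 0"
    and diam: "\<And>x y. x \<in> W \<Longrightarrow> y \<in> W \<Longrightarrow> norm ((x - y) - ((x - y) \<bullet> e) *\<^sub>R e) \<le> d"
    and height: "\<And>x y. x \<in> W \<Longrightarrow> y \<in> W \<Longrightarrow> \<bar>(x - y) \<bullet> e\<bar> \<le> h"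
  shows "measure lborel W \<le> h * (unit_ball_vol (DIM('a) - 1) * (d / 2) ^ (DIM('a) - 1))"
proof -
  let ?n = "DIM('a) - 1"
  define \<pi> where "\<pi> x = x - (x \<bullet> e) *\<^sub>R e" for x
  have \<pi>_lin: "\<pi> (x + y) = \<pi> x + \<pi> y" "\<pi> (x - y) = \<pi> x - \<pi> y" "\<pi> (c *\<^sub>R x) = c *\<^sub>R \<pi> x" for x y c
    by (auto simp: \<pi>_def inner_add_left inner_diff_left algebra_simps)
  have ee: "e \<bullet> e = 1" "norm e = 1" using e by auto
  have \<pi>_le: "norm (\<pi> x) \<le> norm x" for x
    unfolding \<pi>_def by (rule norm_orth_part_le[OF ee(2)])
  \<comment> \<open>The boxes overshoot \<open>W\<close> by \<open>\<eta>\<close> at each of two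
    points, so height and diameter grow by \<open>2 * \<eta>\<close>; the limit at the end removes
    this.\<close>
  have main: "measure lborel W \<le> (h + 2 * \<eta>) * (unit_ball_vol ?n * ((d + 2 * \<eta>) / 2) ^ ?n)" if \<eta>: "\<eta> > 0" for \<eta>
  proof -
    obtain D where D: "box_family D" "measure lborel W \<le> measure lborel (\<Union>D)"
      and near: "\<And>x. x \<in> \<Union>D \<Longrightarrow> \<exists>y\<in>W. dist y x < \<eta>"
      using box_family_approx[OF W \<eta>] by metis
    show ?thesis
    proof (cases "D = {}")
      case True
      then have "measure lborel W \<le> 0" using D(2) by simp
      also have "0 \<le> (h + 2 * \<eta>) * (unit_ball_vol ?n * ((d + 2 * \<eta>) / 2) ^ ?n)"
        using h d \<eta> by (intro mult_nonneg_nonneg zero_le_power) auto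
      finally show ?thesis .
    next
      case False
      let ?D' = "(`) uminus ` D"
      let ?C = "{x. - (h + 2 * \<eta>) / 2 \<le> x \<bullet> e \<and> x \<bullet> e \<le> (h + 2 * \<eta>) / 2 \<and> norm (x - (x \<bullet> e) *\<^sub>R e) \<le> (d + 2 * \<eta>) / 2}"
      have Cm: "emeasure lborel ?C = ennreal ((h + 2 * \<eta>) * (unit_ball_vol ?n * ((d + 2 * \<eta>) / 2) ^ ?n))"
      proof -
        have "(h + 2 * \<eta>) / 2 - - (h + 2 * \<eta>) / 2 = h + 2 * \<eta>" by (simp add: field_simps)
        then show ?thesis
          using emeasure_cylinder[OF e dim, of "- (h + 2 * \<eta>) / 2" "(h + 2 * \<eta>) / 2" "(d + 2 * \<eta>) / 2"] d h \<eta> by simp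
      qed
      have U': "\<Union>?D' = uminus ` \<Union>D" by auto
      have m': "measure lborel (uminus ` \<Union>D) = measure lborel (\<Union>D)"
      proof -
        have [measurable]: "\<Union>D \<in> sets borel" using compact_box_family[OF D(1)] by (simp add: compact_imp_closed)
        have "measure lborel (uminus ` \<Union>D) = measure (distr lborel borel uminus) (uminus ` \<Union>D)"
          using lborel_affine[of "-1" "0::'a"] by (simp add: density_1)
        also have "\<dots> = measure lborel (uminus -` (uminus ` \<Union>D) \<inter> space lborel)"
          by (rule measure_distr)
             (use compact_box_family[OF box_family_uminus[OF D(1)]] in \<open>auto simp: compact_imp_closed U'[symmetric]\<close>)
        also have "uminus -` (uminus ` \<Union>D) \<inter> space lborel = \<Union>D" by (auto simp: inj_vimage_image_eq)
        finally show ?thesis .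
      qed
      have "measure lborel (\<Union>D) = sqrt (measure lborel (\<Union>D) * measure lborel (\<Union>?D'))"
        unfolding U' m' by simp
      also have "\<dots> \<le> measure lborel (midpoints (\<Union>D) (\<Union>?D'))"
        using D(1) False by (intro measure_midpoints_box_family box_family_uminus) auto
      also have "\<dots> \<le> measure lborel ?C"
      proof (rule measure_mono_fmeasurable)
        \<comment> \<open>Half differences turn a bound on diameters into one on radii about the
          axis, which is how the constant of a ball of diameter \<open>d\<close> arises.\<close>
        show "midpoints (\<Union>D) (\<Union>?D') \<subseteq> ?C"
        proof
          fix z assume z: "z \<in> midpoints (\<Union>D) (\<Union>?D')"
          obtain x y' where xy': "x \<in> \<Union>D" "y' \<in> \<Union>?D'" "z = (1/2) *\<^sub>R (x + y')" using midpointsE[OF z] .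
          then obtain y where y: "y \<in> \<Union>D" "y' = - y" unfolding U' by blast
          have z: "z = (1/2) *\<^sub>R (x - y)" using xy' y by simp
          obtain x0 y0 where 0: "x0 \<in> W" "dist x0 x < \<eta>" "y0 \<in> W" "dist y0 y < \<eta>"
            using near[OF xy'(1)] near[OF y(1)] by blast
          have eq: "x - y = (x0 - y0) + ((x - x0) - (y - y0))" by simp
          have small: "norm (x - x0) \<le> \<eta>" "norm (y - y0) \<le> \<eta>"
            using 0 by (auto simp: dist_norm norm_minus_commute)
          have "norm (\<pi> (x - y)) \<le> norm (\<pi> (x0 - y0)) + (norm (\<pi> (x - x0)) + norm (\<pi> (y - y0)))"
            unfolding eq \<pi>_lin by (smt (verit) norm_triangle_ineq norm_triangle_ineq4)
          also have "\<dots> \<le> d + (\<eta> + \<eta>)"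
            using diam[OF 0(1,3)] \<pi>_le[of "x - x0"] \<pi>_le[of "y - y0"] small
            unfolding \<pi>_def by linarith
          finally have n: "norm (\<pi> z) \<le> (d + 2 * \<eta>) / 2" unfolding z \<pi>_lin by simp
          have "\<bar>(x - y) \<bullet> e\<bar> \<le> \<bar>(x0 - y0) \<bullet> e\<bar> + (\<bar>(x - x0) \<bullet> e\<bar> + \<bar>(y - y0) \<bullet> e\<bar>)"
            by (simp add: inner_diff_left)
          also have "\<dots> \<le> h + (\<eta> + \<eta>)"
            using height[OF 0(1,3)] Basis_le_norm[OF e, of "x - x0"] Basis_le_norm[OF e, of "y - y0"] small by linarith
          finally have "\<bar>z \<bullet> e\<bar> \<le> (h + 2 * \<eta>) / 2" unfolding z by simp
          then show "z \<in> ?C" using n by (auto simp: \<pi>_def abs_le_iff field_simps)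
        qed
        show "midpoints (\<Union>D) (\<Union>?D') \<in> sets lborel"
          using compact_midpoints[OF compact_box_family[OF D(1)] compact_box_family[OF box_family_uminus[OF D(1)]]]
          by (simp add: compact_imp_closed)
        show "?C \<in> fmeasurable lborel"
        proof -
          have "?C \<in> sets lborel" by measurable
          moreover have "emeasure lborel ?C < \<infinity>" unfolding Cm by simp
          ultimately show ?thesis by (simp add: fmeasurable_def)
        qed
      qed
      also have "measure lborel ?C = (h + 2 * \<eta>) * (unit_ball_vol ?n * ((d + 2 * \<eta>) / 2) ^ ?n)"
      proof -
        have "0 \<le> (h + 2 * \<eta>) * (unit_ball_vol ?n * ((d + 2 * \<eta>) / 2) ^ ?n)"
          using h d \<eta> by (intro mult_nonneg_nonneg zero_le_power) auto
        then show ?thesis unfolding measure_def Cm by (rule enn2real_ennreal)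
      qed
      finally show ?thesis using D(2) by linarith
    qed
  qed
  have lim: "((\<lambda>\<eta>. (h + 2 * \<eta>) * (unit_ball_vol ?n * ((d + 2 * \<eta>) / 2) ^ ?n)) \<longlongrightarrow>
     (h + 2 * 0) * (unit_ball_vol ?n * ((d + 2 * 0) / 2) ^ ?n)) (at_right 0)"
    by (intro tendsto_intros) auto
  have "measure lborel W \<le> (h + 2 * 0) * (unit_ball_vol ?n * ((d + 2 * 0) / 2) ^ ?n)"
    by (rule tendsto_lowerbound[OF lim]) (use main in \<open>auto simp: eventually_at_filter\<close>)
  then show ?thesis by simp
qed

text \<open>The cylinder of height 1 over \<open>A\<close> measures \<open>A\<close> by its volume.
  Each covering set is replaced by the cylinder over the closure of its projection; projecting does
  not increase the diameter, and the isodiametric inequality bounds the volume by the gauge used in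
  \<open>hausdorff_pre\<close>.\<close>

lemma hausdorff_measure_ge:
  fixes A :: "'a::euclidean_space set"
  assumes e: "e \<in> Basis" and dim: "DIM('a) \<ge> 2" and A: "A \<subseteq> interface e"
    and Z: "{x. 0 \<le> x \<bullet> e \<and> x \<bullet> e \<le> 1 \<and> x - (x \<bullet> e) *\<^sub>R e \<in> A} \<in> sets lborel"
  shows "emeasure lborel {x. 0 \<le> x \<bullet> e \<and> x \<bullet> e \<le> 1 \<and> x - (x \<bullet> e) *\<^sub>R e \<in> A} \<le> hausdorff_measure (DIM('a) - 1) A"
proof -
  let ?Z = "{x. 0 \<le> x \<bullet> e \<and> x \<bullet> e \<le> 1 \<and> x - (x \<bullet> e) *\<^sub>R e \<in> A}"
  let ?n = "DIM('a) - 1"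
  define \<pi> where "\<pi> x = x - (x \<bullet> e) *\<^sub>R e" for x
  have \<pi>_lin: "\<pi> (x - y) = \<pi> x - \<pi> y" for x y
    by (auto simp: \<pi>_def inner_diff_left algebra_simps)
  have ee: "e \<bullet> e = 1" "norm e = 1" using e by auto
  have \<pi>_le: "norm (\<pi> x) \<le> norm x" for x
    unfolding \<pi>_def by (rule norm_orth_part_le[OF ee(2)])
  have \<pi>cont: "continuous_on S \<pi>" for S unfolding \<pi>_def by (intro continuous_intros)
  \<comment> \<open>The bound holds for covering sets of any size, so the single scale 1 already
    bounds the supremum from below.\<close>
  have "emeasure lborel ?Z \<le> hausdorff_pre ?n 1 A"
    unfolding hausdorff_pre_def
  proof (rule INF_greatest, clarify)
    fix U :: "nat \<Rightarrow> 'a set" assume cov: "A \<subseteq> (\<Union>i. U i)" and U: "\<forall>i. bounded (U i) \<and> diameter (U i) \<le> 1"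
    define W where "W i = {x. 0 \<le> x \<bullet> e \<and> x \<bullet> e \<le> 1 \<and> \<pi> x \<in> closure (\<pi> ` U i)}" for i
    have b\<pi>: "bounded (\<pi> ` U i)" for i
    proof -
      obtain B where B: "\<And>x. x \<in> U i \<Longrightarrow> norm x \<le> B" using U unfolding bounded_iff by blast
      have "norm (\<pi> x) \<le> B" if "x \<in> U i" for x using B[OF that] \<pi>_le[of x] by linarith
      then show ?thesis unfolding bounded_iff by blast
    qed
    have cW: "compact (W i)" for i
    proof -
      have "closed (W i)"
      proof -
        have "W i = {x. 0 \<le> x \<bullet> e} \<inter> {x. x \<bullet> e \<le> 1} \<inter> (\<pi> -` closure (\<pi> ` U i))" by (auto simp: W_def)
        moreover have "closed (\<pi> -` closure (\<pi> ` U i))"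
          by (rule continuous_closed_vimage) (use \<pi>cont[of UNIV] in \<open>auto simp: continuous_on_eq_continuous_at\<close>)
        ultimately show ?thesis by (auto intro!: closed_Int closed_Collect_le continuous_intros)
      qed
      moreover have "bounded (W i)"
      proof -
        obtain B where B: "\<And>x. x \<in> closure (\<pi> ` U i) \<Longrightarrow> norm x \<le> B"
          using bounded_closure[OF b\<pi>[of i]] unfolding bounded_iff by blast
        have "norm x \<le> B + 1" if x: "x \<in> W i" for x
        proof -
          have "x = \<pi> x + (x \<bullet> e) *\<^sub>R e" by (simp add: \<pi>_def)
          then have "norm x \<le> norm (\<pi> x) + \<bar>x \<bullet> e\<bar>"
            using norm_triangle_ineq[of "\<pi> x" "(x \<bullet> e) *\<^sub>R e"] ee by simp
          then show ?thesis using x B[of "\<pi> x"] by (auto simp: W_def)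
        qed
        then show ?thesis unfolding bounded_iff by blast
      qed
      ultimately show ?thesis by (simp add: compact_eq_bounded_closed)
    qed
    have mW: "emeasure lborel (W i) \<le> (if U i = {} then 0 else ennreal (unit_ball_vol ?n * (diameter (U i) / 2) ^ ?n))" for i
    proof (cases "U i = {}")
      case True
      then show ?thesis by (simp add: W_def)
    next
      case False
      have "measure lborel (W i) \<le> 1 * (unit_ball_vol ?n * (diameter (U i) / 2) ^ ?n)"
      proof (rule isodiametric_cylinder[OF e dim cW])
        show "0 \<le> diameter (U i)" using U by (simp add: diameter_ge_0)
        fix x y assume xy: "x \<in> W i" "y \<in> W i"
        show "\<bar>(x - y) \<bullet> e\<bar> \<le> 1" using xy by (auto simp: W_def inner_diff_left)
        have "dist (\<pi> x) (\<pi> y) \<le> diameter (closure (\<pi> ` U i))"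
          using xy bounded_closure[OF b\<pi>[of i]] by (intro diameter_bounded_bound) (auto simp: W_def)
        also have "\<dots> = diameter (\<pi> ` U i)" by (rule diameter_closure[OF b\<pi>])
        also have "\<dots> \<le> diameter (U i)"
        proof (rule diameter_le)
          fix u v assume "u \<in> \<pi> ` U i" "v \<in> \<pi> ` U i"
          then obtain u' v' where uv: "u' \<in> U i" "v' \<in> U i" "u = \<pi> u'" "v = \<pi> v'" by auto
          have "norm (u - v) \<le> dist u' v'" unfolding uv \<pi>_lin[symmetric] dist_norm by (rule \<pi>_le)
          also have "\<dots> \<le> diameter (U i)" using U uv by (intro diameter_bounded_bound) auto
          finally show "norm (u - v) \<le> diameter (U i)" .
        qed (use False in auto)
        finally show "norm ((x - y) - ((x - y) \<bullet> e) *\<^sub>R e) \<le> diameter (U i)"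
          unfolding \<pi>_def[symmetric] \<pi>_lin dist_norm .
      qed simp
      moreover have "emeasure lborel (W i) = ennreal (measure lborel (W i))"
        using emeasure_compact_finite[OF cW[of i]] by (simp add: emeasure_eq_ennreal_measure)
      ultimately show ?thesis using False by (simp add: ennreal_leI)
    qed
    have "?Z \<subseteq> (\<Union>i. W i)"
    proof
      fix x assume x: "x \<in> ?Z"
      then have "\<pi> x \<in> A" by (simp add: \<pi>_def)
      then obtain i where i: "\<pi> x \<in> U i" using cov by auto
      have "\<pi> (\<pi> x) = \<pi> x" by (simp add: \<pi>_def inner_diff_left ee)
      then have "\<pi> x \<in> \<pi> ` U i" using i by (metis imageI)
      then show "x \<in> (\<Union>i. W i)" using x closure_subset by (force simp: W_def)
    qed
    then have "emeasure lborel ?Z \<le> emeasure lborel (\<Union>i. W i)"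
      using cW by (intro emeasure_mono) (auto simp: compact_imp_closed)
    also have "\<dots> \<le> (\<Sum>i. emeasure lborel (W i))"
      using cW by (intro emeasure_subadditive_countably) (auto simp: compact_imp_closed)
    also have "\<dots> \<le> (\<Sum>i. if U i = {} then 0 else ennreal (unit_ball_vol ?n * (diameter (U i) / 2) ^ ?n))"
      using mW by (intro suminf_le) auto
    finally show "emeasure lborel ?Z \<le> (\<Sum>i. if U i = {} then 0 else ennreal (unit_ball_vol ?n * (diameter (U i) / 2) ^ ?n))" .
  qed
  also have "\<dots> \<le> hausdorff_measure ?n A"
    unfolding hausdorff_measure_def by (rule SUP_upper) simp
  finally show ?thesis .
qed

section \<open>Hausdorff measure of an annulus in the interface\<close>

text \<open>Coverings are indexed by all natural numbers, while \<open>C\<close> may be finite or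
  empty. Spare indices receive radius zero, whose balls have measure zero.\<close>

lemma countable_disjoint_balls_sequence:
  fixes a :: "'i \<Rightarrow> 'a::euclidean_space"
  assumes C: "countable C" and disj: "pairwise (\<lambda>i j. disjnt (cball (a i) (r i)) (cball (a j) (r j))) C"
    and sub: "\<And>i. i \<in> C \<Longrightarrow> cball (a i) (r i) \<subseteq> T" and r: "\<And>i. i \<in> C \<Longrightarrow> 0 < r i"
    and T: "T \<in> sets lborel"
  obtains a' r' where "\<And>k::nat. 0 \<le> r' k" "\<And>k. r' k = 0 \<or> (\<exists>i\<in>C. r' k = r i)"
    "\<And>i. i \<in> C \<Longrightarrow> \<exists>k. a' k = a i \<and> r' k = r i"
    "(\<Sum>k. emeasure lborel (cball (a' k) (r' k))) \<le> emeasure lborel T"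
proof -
  define used where "used k \<longleftrightarrow> k \<in> to_nat_on C ` C" for k
  define a' where "a' k = a (from_nat_into C k)" for k
  define r' where "r' k = (if used k then r (from_nat_into C k) else 0)" for k
  define A where "A k = (if used k then cball (a' k) (r' k) else {})" for k
  have used: "from_nat_into C k \<in> C" "to_nat_on C (from_nat_into C k) = k" if "used k" for k
    using that C by (auto simp: used_def)
  have dA: "disjoint_family A"
  proof (unfold disjoint_family_on_def, intro ballI impI)
    fix k l assume kl: "k \<noteq> (l::nat)"
    show "A k \<inter> A l = {}"
    proof (cases "used k \<and> used l")
      case True
      then have "from_nat_into C k \<noteq> from_nat_into C l" using used(2)[of k] used(2)[of l] kl by auto
      then show ?thesis
        using disj True used(1)[of k] used(1)[of l]
        by (auto simp: A_def a'_def r'_def pairwise_def disjnt_def)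
    qed (auto simp: A_def)
  qed
  have "(\<Sum>k. emeasure lborel (A k)) = emeasure lborel (\<Union>k. A k)"
    by (rule suminf_emeasure[OF _ dA]) (auto simp: A_def)
  also have "\<dots> \<le> emeasure lborel T"
    using sub used(1) by (intro emeasure_mono T) (force simp: A_def a'_def r'_def split: if_splits)
  also have "(\<Sum>k. emeasure lborel (A k)) = (\<Sum>k. emeasure lborel (cball (a' k) (r' k)))"
    by (intro suminf_cong) (auto simp: A_def r'_def)
  finally have sum: "(\<Sum>k. emeasure lborel (cball (a' k) (r' k))) \<le> emeasure lborel T" .
  show thesis
  proof (rule that[of r' a'])
    show "0 \<le> r' k" for k using r[OF used(1)[of k]] by (auto simp: r'_def)
    show "r' k = 0 \<or> (\<exists>i\<in>C. r' k = r i)" for k using used(1)[of k] by (auto simp: r'_def)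
    show "\<exists>k. a' k = a i \<and> r' k = r i" if "i \<in> C" for i
      using that C by (intro exI[of _ "to_nat_on C i"]) (auto simp: a'_def r'_def used_def)
  qed (rule sum)
qed

text \<open>Merges the main covering and the covering of the leftover null set into one
  sequence.\<close>

lemma suminf_interleave:
  fixes f g :: "nat \<Rightarrow> ennreal"
  shows "(\<Sum>k. if even k then f (k div 2) else g (k div 2)) = (\<Sum>k. f k) + (\<Sum>k. g k)"
proof -
  let ?f = "\<lambda>k. if even k then f (k div 2) else 0" and ?g = "\<lambda>k. if odd k then g (k div 2) else 0"
  have "(\<Sum>k. if even k then f (k div 2) else g (k div 2)) = (\<Sum>k. ?f k + ?g k)"
    by (intro suminf_cong) auto
  also have "\<dots> = (\<Sum>k. ?f k) + (\<Sum>k. ?g k)"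
    by (rule suminf_add[symmetric]) auto
  also have "(\<Sum>k. ?f k) = (\<Sum>k. ?f (2 * k))"
    by (rule suminf_mono_reindex[symmetric]) (auto simp: strict_mono_def elim: evenE)
  also have "(\<Sum>k. ?g k) = (\<Sum>k. ?g (2 * k + 1))"
    by (rule suminf_mono_reindex[symmetric]) (auto simp: strict_mono_def elim: oddE)
  finally show ?thesis by simp
qed

text \<open>Balls covering the cylinder over \<open>G\<close> are sliced at a height where the total slice volume is
  at most average.\<close>

lemma hausdorff_pre_le_of_ball_cover:
  fixes G :: "'a::euclidean_space set"
  assumes e: "e \<in> Basis" and dim: "DIM('a) \<ge> 2" and G: "G \<subseteq> interface e"
    and cov: "{x. 0 < x \<bullet> e \<and> x \<bullet> e < 1 \<and> x - (x \<bullet> e) *\<^sub>R e \<in> G} \<subseteq> (\<Union>k. cball (a k) (r k))"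
    and r: "\<And>k. 0 \<le> r k" "\<And>k. r k \<le> \<delta> / 2"
    and V: "(\<Sum>k. emeasure lborel (cball (a k) (r k))) \<le> ennreal V" "V \<ge> 0" and \<epsilon>: "\<epsilon> > 0"
  shows "hausdorff_pre (DIM('a) - 1) \<delta> G \<le> ennreal (V + \<epsilon>)"
proof -
  let ?n = "DIM('a) - 1"
  have n: "?n > 0" using dim by simp
  have ee: "e \<bullet> e = 1" "norm e = 1" using e by auto
  \<comment> \<open>The total \<open>n\<close>-dimensional volume of the slices of all balls at
    height \<open>s\<close>; its integral over all heights is the total volume of the balls.\<close>
  define cost where "cost s = (\<Sum>k. ennreal (slice_density ?n (r k) (s - a k \<bullet> e)))" for s
  have [measurable]: "cost \<in> borel_measurable borel" unfolding cost_def by measurable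
  have "(\<integral>\<^sup>+s. cost s \<partial>lborel) = (\<Sum>k. \<integral>\<^sup>+s. ennreal (slice_density ?n (r k) (s - a k \<bullet> e)) \<partial>lborel)"
    unfolding cost_def by (rule nn_integral_suminf) measurable
  also have "\<dots> = (\<Sum>k. emeasure lborel (cball (a k) (r k)))"
  proof (intro suminf_cong)
    fix k
    show "(\<integral>\<^sup>+s. ennreal (slice_density ?n (r k) (s - a k \<bullet> e)) \<partial>lborel) = emeasure lborel (cball (a k) (r k))"
      using nn_integral_ball_slices[of e "r k" "\<lambda>_. 1" "a k"] e dim r(1)[of k] by simp
  qed
  finally have int: "(\<integral>\<^sup>+s. cost s \<partial>lborel) \<le> ennreal V" using V by simp
  \<comment> \<open>The interval of heights has length 1, so a cost above
    \<open>V + \<epsilon>\<close> throughout would force an integral above \<open>V\<close>.\<close>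
  have "\<exists>s. 0 < s \<and> s < 1 \<and> cost s \<le> ennreal (V + \<epsilon>)"
  proof (rule ccontr)
    assume "\<not> ?thesis"
    then have "ennreal (V + \<epsilon>) * indicator {0<..<1} s \<le> cost s" for s
      by (cases "s \<in> {0<..<1}") (auto simp: not_le intro: less_imp_le)
    then have "(\<integral>\<^sup>+s. ennreal (V + \<epsilon>) * indicator {0<..<1::real} s \<partial>lborel) \<le> (\<integral>\<^sup>+s. cost s \<partial>lborel)"
      by (intro nn_integral_mono) auto
    also have "\<dots> \<le> ennreal V" by (rule int)
    finally have "ennreal (V + \<epsilon>) \<le> ennreal V" by (simp add: nn_integral_cmult_indicator)
    then show False using V(2) \<epsilon> by (simp add: ennreal_le_iff)
  qed
  then obtain s where s: "0 < s" "s < 1" "cost s \<le> ennreal (V + \<epsilon>)" by blast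
  \<comment> \<open>The slice of the k-th ball at height \<open>s\<close>, shifted down to the
    interface. Its diameter is at most \<open>2 * \<rho> k\<close>, so its gauge is at most the
    slice volume.\<close>
  define U where "U k = {x \<in> interface e. x + s *\<^sub>R e \<in> cball (a k) (r k)}" for k
  define \<rho> where "\<rho> k = sqrt (max 0 ((r k)\<^sup>2 - (s - a k \<bullet> e)\<^sup>2))" for k
  have U\<rho>: "norm (x - (a k - (a k \<bullet> e) *\<^sub>R e)) \<le> \<rho> k" if "x \<in> U k" for x k
  proof -
    have "x \<bullet> e = 0" using that by (simp add: U_def interface_def)
    then have 1: "(x + s *\<^sub>R e - a k) \<bullet> e = s - a k \<bullet> e" by (simp add: inner_add_left inner_diff_left ee)
    have 2: "x + s *\<^sub>R e - a k - (s - a k \<bullet> e) *\<^sub>R e = x - (a k - (a k \<bullet> e) *\<^sub>R e)"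
      by (simp add: algebra_simps)
    have "x + s *\<^sub>R e \<in> cball (a k) (r k)" using that by (simp add: U_def)
    then show ?thesis
      unfolding mem_cball_slice[OF ee(2) r(1)] 1 2 \<rho>_def by blast
  qed
  have \<rho>: "0 \<le> \<rho> k" "\<rho> k \<le> r k" for k
  proof -
    have "sqrt (max 0 ((r k)\<^sup>2 - (s - a k \<bullet> e)\<^sup>2)) \<le> sqrt ((r k)\<^sup>2)" by (intro real_sqrt_le_mono) auto
    then show "\<rho> k \<le> r k" using r(1)[of k] by (simp add: \<rho>_def)
  qed (simp add: \<rho>_def)
  have diam: "diameter (U k) \<le> 2 * \<rho> k" for k
  proof (cases "U k = {}")
    case True
    then show ?thesis using \<rho>(1)[of k] by simp
  next
    case False
    show ?thesis
    proof (rule diameter_le)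
      fix x y assume "x \<in> U k" "y \<in> U k"
      from U\<rho>[OF this(1)] U\<rho>[OF this(2)] dist_triangle2[of x y "a k - (a k \<bullet> e) *\<^sub>R e"]
      show "norm (x - y) \<le> 2 * \<rho> k" unfolding dist_norm by linarith
    qed (use False in auto)
  qed
  have bU: "bounded (U k)" for k
  proof -
    have "norm x \<le> r k + norm (a k) + 1" if "x \<in> U k" for x
    proof -
      have "norm (x + s *\<^sub>R e - a k) \<le> r k" using that by (simp add: U_def dist_norm norm_minus_commute)
      moreover have "norm x \<le> norm (x + s *\<^sub>R e - a k) + norm (a k - s *\<^sub>R e)"
        using norm_triangle_ineq[of "x + s *\<^sub>R e - a k" "a k - s *\<^sub>R e"] by simp
      moreover have "norm (a k - s *\<^sub>R e) \<le> norm (a k) + s"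
        using norm_triangle_ineq4[of "a k" "s *\<^sub>R e"] s ee by simp
      ultimately show ?thesis using s by linarith
    qed
    then show ?thesis unfolding bounded_iff by blast
  qed
  have "G \<subseteq> (\<Union>k. U k)"
  proof
    fix x assume x: "x \<in> G"
    then have xe: "x \<bullet> e = 0" using G by (auto simp: interface_def)
    then have "(x + s *\<^sub>R e) \<bullet> e = s" by (simp add: inner_add_left ee)
    then have "x + s *\<^sub>R e \<in> {x. 0 < x \<bullet> e \<and> x \<bullet> e < 1 \<and> x - (x \<bullet> e) *\<^sub>R e \<in> G}"
      using s x by simp
    then have "x + s *\<^sub>R e \<in> (\<Union>k. cball (a k) (r k))" using cov by blast
    then show "x \<in> (\<Union>k. U k)" using x G by (auto simp: U_def)
  qed
  then have "hausdorff_pre ?n \<delta> G \<le> (\<Sum>k. if U k = {} then 0 else ennreal (unit_ball_vol (real ?n) * (diameter (U k) / 2) ^ ?n))"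
    unfolding hausdorff_pre_def
  proof (intro INF_lower, safe)
    show "diameter (U k) \<le> \<delta>" for k using diam[of k] \<rho>(2)[of k] r(2)[of k] by linarith
  qed (use bU in auto)
  also have "\<dots> \<le> cost s"
    unfolding cost_def
  proof (intro suminf_le)
    fix k
    show "(if U k = {} then 0 else ennreal (unit_ball_vol (real ?n) * (diameter (U k) / 2) ^ ?n)) \<le> ennreal (slice_density ?n (r k) (s - a k \<bullet> e))"
    proof (cases "U k = {}")
      case False
      have "(diameter (U k) / 2) ^ ?n \<le> \<rho> k ^ ?n"
        using diam[of k] diameter_ge_0[OF bU[of k]] by (intro power_mono) auto
      then have "unit_ball_vol (real ?n) * (diameter (U k) / 2) ^ ?n \<le> slice_density ?n (r k) (s - a k \<bullet> e)"
        unfolding slice_density_def \<rho>_def by (intro mult_left_mono) auto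
      then show ?thesis using False by (simp add: ennreal_leI)
    qed simp
  qed auto
  finally show ?thesis using s(3) by (rule order_trans)
qed

text \<open>Vitali's theorem fills the open cylinder with small disjoint balls up to a null set.
  That null set must be covered too, since a single slice is used and a slice cannot ignore it; an
  open neighbourhood of small volume and the fivefold covering lemma do this cheaply.\<close>

lemma hausdorff_pre_le_cylinder:
  fixes G :: "'a::euclidean_space set"
  assumes e: "e \<in> Basis" and dim: "DIM('a) \<ge> 2" and G: "G \<subseteq> interface e"
    and op: "open {x. 0 < x \<bullet> e \<and> x \<bullet> e < 1 \<and> x - (x \<bullet> e) *\<^sub>R e \<in> G}"
    and V: "emeasure lborel {x. 0 < x \<bullet> e \<and> x \<bullet> e < 1 \<and> x - (x \<bullet> e) *\<^sub>R e \<in> G} \<le> ennreal V" "V \<ge> 0"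
    and \<delta>: "\<delta> > 0"
  shows "hausdorff_pre (DIM('a) - 1) \<delta> G \<le> ennreal V"
proof -
  let ?Z = "{x. 0 < x \<bullet> e \<and> x \<bullet> e < 1 \<and> x - (x \<bullet> e) *\<^sub>R e \<in> G}"
  let ?N = "DIM('a)"
  \<comment> \<open>One \<open>\<epsilon>\<close> pays for covering the null set, the other for
    choosing a height.\<close>
  have main: "hausdorff_pre (DIM('a) - 1) \<delta> G \<le> ennreal (V + \<epsilon> + \<epsilon>)" if \<epsilon>: "\<epsilon> > 0" for \<epsilon>
  proof -
    \<comment> \<open>Radius at most \<open>\<delta> / 2\<close> gives slices of diameter at most
      \<open>\<delta>\<close>.\<close>
    define K1 where "K1 = {p::'a \<times> real. 0 < snd p \<and> snd p \<le> \<delta> / 2 \<and> cball (fst p) (snd p) \<subseteq> ?Z}"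
    have "\<exists>p. p \<in> K1 \<and> x \<in> cball (fst p) (snd p) \<and> snd p < d" if x: "x \<in> ?Z" and d: "0 < d" for x d
    proof -
      obtain \<eta> where \<eta>: "\<eta> > 0" "cball x \<eta> \<subseteq> ?Z" 
        using open_contains_cball[THEN iffD1, OF op, THEN bspec, OF x] by blast
      define \<rho> where "\<rho> = min (d / 2) (min \<eta> (\<delta> / 2))"
      have "0 < \<rho>" "\<rho> < d" "\<rho> \<le> \<eta>" "\<rho> \<le> \<delta> / 2" using d \<eta>(1) \<delta> by (auto simp: \<rho>_def min_def)
      moreover have "cball x \<rho> \<subseteq> ?Z" using \<eta>(2) \<open>\<rho> \<le> \<eta>\<close> by (meson subset_cball order_trans)
      ultimately show ?thesis by (intro exI[of _ "(x, \<rho>)"]) (auto simp: K1_def)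
    qed
    then obtain C1 where C1: "countable C1" "C1 \<subseteq> K1"
      "pairwise (\<lambda>i j. disjnt (cball (fst i) (snd i)) (cball (fst j) (snd j))) C1"
      "negligible (?Z - (\<Union>i\<in>C1. cball (fst i) (snd i)))"
      by (rule Vitali_covering_theorem_cballs[of K1 snd ?Z fst, rotated]) (auto simp: K1_def)
    obtain a1 r1 where 1: "\<And>k::nat. 0 \<le> r1 k" "\<And>k. r1 k = 0 \<or> (\<exists>i\<in>C1. r1 k = snd i)"
      "\<And>i. i \<in> C1 \<Longrightarrow> \<exists>k. a1 k = fst i \<and> r1 k = snd i"
      "(\<Sum>k. emeasure lborel (cball (a1 k) (r1 k))) \<le> emeasure lborel ?Z"
    proof (rule countable_disjoint_balls_sequence[OF C1(1,3), of ?Z])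
      show "?Z \<in> sets lborel" using op by simp
    qed (use C1(2) in \<open>auto simp: K1_def\<close>)
    define S where "S = ?Z - (\<Union>i\<in>C1. cball (fst i) (snd i))"
    have S: "S \<in> null_sets lebesgue" using C1(4) by (simp add: S_def negligible_iff_null_sets)
    \<comment> \<open>Fivefold enlargement multiplies volumes by \<open>5 ^ ?N\<close>, hence the
      divisor.\<close>
    obtain T where T: "open T" "S \<subseteq> T" "emeasure lebesgue (T - S) < ennreal (\<epsilon> / 5 ^ ?N)"
    proof (rule sets_lebesgue_outer_open)
      show "S \<in> sets lebesgue" using S by auto
      show "0 < \<epsilon> / 5 ^ ?N" using \<epsilon> by simp
    qed blast
    have Te: "emeasure lborel T \<le> ennreal (\<epsilon> / 5 ^ ?N)"
    proof -
      have "emeasure lborel T = emeasure lebesgue T" using T(1) by simp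
      also have "\<dots> = emeasure lebesgue (T - S)"
        by (rule emeasure_Diff_null_set[symmetric, OF S]) (use T(1) in auto)
      finally show ?thesis using T(3) by simp
    qed
    \<comment> \<open>The bound \<open>\<delta> / 10\<close> leaves radius
      \<open>\<delta> / 2\<close> after enlargement by 5.\<close>
    define K2 where "K2 = {p::'a \<times> real. 0 < snd p \<and> snd p \<le> \<delta> / 10 \<and> cball (fst p) (snd p) \<subseteq> T}"
    have "S \<subseteq> (\<Union>i\<in>K2. cball (fst i) (snd i))"
    proof
      fix x assume "x \<in> S"
      then obtain \<eta> where \<eta>: "\<eta> > 0" "cball x \<eta> \<subseteq> T" using T unfolding open_contains_cball by blast
      have "cball x (min \<eta> (\<delta> / 10)) \<subseteq> T" using \<eta>(2) by (meson subset_cball order_trans min.cobounded1)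
      then show "x \<in> (\<Union>i\<in>K2. cball (fst i) (snd i))"
        using \<eta>(1) \<delta> by (intro UN_I[of "(x, min \<eta> (\<delta> / 10))"]) (auto simp: K2_def)
    qed
    then obtain C2 where C2: "countable C2" "C2 \<subseteq> K2"
      "pairwise (\<lambda>i j. disjnt (cball (fst i) (snd i)) (cball (fst j) (snd j))) C2"
      "S \<subseteq> (\<Union>i\<in>C2. cball (fst i) (5 * snd i))"
      by (rule Vitali_covering_lemma_cballs[of S fst snd K2 "\<delta> / 10"]) (auto simp: K2_def)
    obtain a2 r2 where 2: "\<And>k::nat. 0 \<le> r2 k" "\<And>k. r2 k = 0 \<or> (\<exists>i\<in>C2. r2 k = snd i)"
      "\<And>i. i \<in> C2 \<Longrightarrow> \<exists>k. a2 k = fst i \<and> r2 k = snd i"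
      "(\<Sum>k. emeasure lborel (cball (a2 k) (r2 k))) \<le> emeasure lborel T"
    proof (rule countable_disjoint_balls_sequence[OF C2(1,3), of T])
      show "T \<in> sets lborel" using T(1) by simp
    qed (use C2(2) in \<open>auto simp: K2_def\<close>)
    define a where "a k = (if even k then a1 (k div 2) else a2 (k div 2))" for k
    define r where "r k = (if even k then r1 (k div 2) else 5 * r2 (k div 2))" for k
    have five: "emeasure lborel (cball (a2 k) (5 * r2 k)) = ennreal (5 ^ ?N) * emeasure lborel (cball (a2 k) (r2 k))" for k
      using 2(1)[of k] emeasure_cball[of "r2 k" "a2 k"] emeasure_cball[of "5 * r2 k" "a2 k"]
      by (simp add: ennreal_mult'[symmetric] power_mult_distrib mult_ac)
    have "(\<Sum>k. emeasure lborel (cball (a k) (r k))) =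
        (\<Sum>k. if even k then emeasure lborel (cball (a1 (k div 2)) (r1 (k div 2)))
          else emeasure lborel (cball (a2 (k div 2)) (5 * r2 (k div 2))))"
      by (intro suminf_cong) (auto simp: a_def r_def)
    also have "\<dots> = (\<Sum>k. emeasure lborel (cball (a1 k) (r1 k))) + (\<Sum>k. emeasure lborel (cball (a2 k) (5 * r2 k)))"
      by (rule suminf_interleave)
    also have "(\<Sum>k. emeasure lborel (cball (a2 k) (5 * r2 k))) = ennreal (5 ^ ?N) * (\<Sum>k. emeasure lborel (cball (a2 k) (r2 k)))"
      unfolding five by (rule ennreal_suminf_cmult)
    also have "\<dots> \<le> ennreal (5 ^ ?N) * ennreal (\<epsilon> / 5 ^ ?N)"
      using 2(4) Te by (intro mult_left_mono) auto
    also have "\<dots> = ennreal \<epsilon>" using \<epsilon> by (simp add: ennreal_mult'[symmetric])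
    also have "(\<Sum>k. emeasure lborel (cball (a1 k) (r1 k))) + ennreal \<epsilon> \<le> ennreal V + ennreal \<epsilon>"
      using 1(4) V(1) by (intro add_right_mono) auto
    also have "\<dots> = ennreal (V + \<epsilon>)" using V(2) \<epsilon> by simp
    finally have sum: "(\<Sum>k. emeasure lborel (cball (a k) (r k))) \<le> ennreal (V + \<epsilon>)" by (simp add: add_left_mono)
    show ?thesis
    proof (rule hausdorff_pre_le_of_ball_cover[OF e dim G _ _ _ sum _ \<epsilon>])
      show "0 \<le> r k" for k using 1(1) 2(1) by (simp add: r_def)
      show "r k \<le> \<delta> / 2" for k
      proof -
        have "r1 j \<le> \<delta> / 2" for j using 1(2)[of j] C1(2) \<delta> by (auto simp: K1_def)
        moreover have "5 * r2 j \<le> \<delta> / 2" for j using 2(2)[of j] C2(2) \<delta> by (auto simp: K2_def)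
        ultimately show ?thesis by (simp add: r_def)
      qed
      show "?Z \<subseteq> (\<Union>k. cball (a k) (r k))"
      proof
        fix x assume x: "x \<in> ?Z"
        show "x \<in> (\<Union>k. cball (a k) (r k))"
        proof (cases "x \<in> S")
          case False
          then obtain i where i: "i \<in> C1" "x \<in> cball (fst i) (snd i)" using x unfolding S_def by blast
          obtain k where "a1 k = fst i" "r1 k = snd i" using 1(3)[OF i(1)] by blast
          then have "x \<in> cball (a (2 * k)) (r (2 * k))" using i(2) by (simp add: a_def r_def)
          then show ?thesis by blast
        next
          case True
          then obtain i where i: "i \<in> C2" "x \<in> cball (fst i) (5 * snd i)" using C2(4) by blast
          obtain k where "a2 k = fst i" "r2 k = snd i" using 2(3)[OF i(1)] by blast
          then have "x \<in> cball (a (2 * k + 1)) (r (2 * k + 1))" using i(2) by (simp add: a_def r_def)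
          then show ?thesis by blast
        qed
      qed
      show "0 \<le> V + \<epsilon>" using V(2) \<epsilon> by simp
    qed
  qed
  have lim: "((\<lambda>\<epsilon>. ennreal (V + \<epsilon> + \<epsilon>)) \<longlongrightarrow> ennreal (V + 0 + 0)) (at_right 0)"
    by (intro tendsto_intros)
  have "hausdorff_pre (DIM('a) - 1) \<delta> G \<le> ennreal (V + 0 + 0)"
    by (rule tendsto_lowerbound[OF lim]) (use main in \<open>auto simp: eventually_at_filter\<close>)
  then show ?thesis by simp
qed

lemma hausdorff_pre_mono: "A \<subseteq> B \<Longrightarrow> hausdorff_pre k \<delta> A \<le> hausdorff_pre k \<delta> B"
  unfolding hausdorff_pre_def by (intro INF_superset_mono) auto

lemma hausdorff_measure_mono: "A \<subseteq> B \<Longrightarrow> hausdorff_measure k A \<le> hausdorff_measure k B"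
  unfolding hausdorff_measure_def by (intro SUP_mono' hausdorff_pre_mono)

text \<open>Membership of the two rims in the contact set is left open, hence the sandwich. The
  upper bound widens the annulus slightly, which makes it relatively open as Vitali requires; the
  lower bound uses slightly narrower annuli inside \<open>A\<close>.\<close>

lemma hausdorff_measure_annulus:
  fixes A :: "'a::euclidean_space set"
  assumes e: "e \<in> Basis" and dim: "DIM('a) \<ge> 2" and r: "0 < r0" "r0 < r1"
    and sub: "{x \<in> interface e. r0 < norm x \<and> norm x < r1} \<subseteq> A"
    and sup: "A \<subseteq> {x \<in> interface e. r0 \<le> norm x \<and> norm x \<le> r1}"
  shows "hausdorff_measure (DIM('a) - 1) A = ennreal (unit_ball_vol (DIM('a) - 1) * (r1 ^ (DIM('a) - 1) - r0 ^ (DIM('a) - 1)))"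
proof -
  let ?n = "DIM('a) - 1"
  define \<omega> where "\<omega> = unit_ball_vol (real ?n)"
  have \<omega>: "\<omega> > 0" by (simp add: \<omega>_def)
  define C where "C r = {x. 0 \<le> x \<bullet> e \<and> x \<bullet> e \<le> 1 \<and> norm (x - (x \<bullet> e) *\<^sub>R e) \<le> r}" for r
  have ee: "e \<bullet> e = 1" "norm e = 1" using e by auto
  have \<pi>: "x - (x \<bullet> e) *\<^sub>R e \<in> interface e" for x by (simp add: interface_def inner_diff_left ee)
  have Cb [measurable]: "C r \<in> sets borel" for r unfolding C_def by measurable
  have Ce: "emeasure lborel (C r) = ennreal (\<omega> * r ^ ?n)" if "r \<ge> 0" for r
    using emeasure_cylinder[OF e dim, of 0 1 r] that by (simp add: C_def \<omega>_def)
  have diff: "emeasure lborel (C s - C r) = ennreal (\<omega> * (s ^ ?n - r ^ ?n))" if "0 \<le> r" "r \<le> s" for r s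
  proof -
    have "C r \<subseteq> C s" using that by (auto simp: C_def)
    then have "emeasure lborel (C s - C r) = emeasure lborel (C s) - emeasure lborel (C r)"
      using that by (intro emeasure_Diff) (auto simp: Ce)
    also have "\<dots> = ennreal (\<omega> * s ^ ?n - \<omega> * r ^ ?n)"
      using that \<omega> by (simp add: Ce ennreal_minus)
    finally show ?thesis by (simp add: right_diff_distrib)
  qed
  have "hausdorff_measure ?n A \<le> ennreal (\<omega> * (r1 ^ ?n - r0 ^ ?n))"
  proof -
    have le: "hausdorff_measure ?n A \<le> ennreal (\<omega> * ((r1 + \<eta>) ^ ?n - (r0 - \<eta>) ^ ?n))" if \<eta>: "0 < \<eta>" "\<eta> < r0" for \<eta>
      unfolding hausdorff_measure_def
    proof (rule SUP_least)
      fix \<delta> :: real assume "\<delta> \<in> {0<..}"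
      then have \<delta>: "\<delta> > 0" by simp
      let ?G = "{x \<in> interface e. r0 - \<eta> < norm x \<and> norm x < r1 + \<eta>}"
      let ?Z = "{x. 0 < x \<bullet> e \<and> x \<bullet> e < 1 \<and> x - (x \<bullet> e) *\<^sub>R e \<in> ?G}"
      have "hausdorff_pre ?n \<delta> A \<le> hausdorff_pre ?n \<delta> ?G"
        by (rule hausdorff_pre_mono) (use sup \<eta> in force)
      also have "\<dots> \<le> ennreal (\<omega> * ((r1 + \<eta>) ^ ?n - (r0 - \<eta>) ^ ?n))"
      proof (rule hausdorff_pre_le_cylinder[OF e dim _ _ _ _ \<delta>])
        have "?Z = {x. 0 < x \<bullet> e} \<inter> {x. x \<bullet> e < 1} \<inter> {x. r0 - \<eta> < norm (x - (x \<bullet> e) *\<^sub>R e)} \<inter> {x. norm (x - (x \<bullet> e) *\<^sub>R e) < r1 + \<eta>}"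
          using \<pi> by auto
        moreover have "open \<dots>" by (intro open_Int open_Collect_less continuous_intros)
        ultimately show "open ?Z" by simp
        have "emeasure lborel ?Z \<le> emeasure lborel (C (r1 + \<eta>) - C (r0 - \<eta>))"
          by (rule emeasure_mono) (auto simp: C_def)
        then show "emeasure lborel ?Z \<le> ennreal (\<omega> * ((r1 + \<eta>) ^ ?n - (r0 - \<eta>) ^ ?n))"
          using \<eta> r by (simp add: diff)
        show "0 \<le> \<omega> * ((r1 + \<eta>) ^ ?n - (r0 - \<eta>) ^ ?n)"
          using \<omega> power_mono[of "r0 - \<eta>" "r1 + \<eta>" ?n] \<eta> r by (intro mult_nonneg_nonneg) auto
      qed auto
      finally show "hausdorff_pre ?n \<delta> A \<le> ennreal (\<omega> * ((r1 + \<eta>) ^ ?n - (r0 - \<eta>) ^ ?n))" .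
    qed
    have lim: "((\<lambda>\<eta>. ennreal (\<omega> * ((r1 + \<eta>) ^ ?n - (r0 - \<eta>) ^ ?n))) \<longlongrightarrow> ennreal (\<omega> * ((r1 + 0) ^ ?n - (r0 - 0) ^ ?n))) (at_right 0)"
      by (intro tendsto_intros)
    have "hausdorff_measure ?n A \<le> ennreal (\<omega> * ((r1 + 0) ^ ?n - (r0 - 0) ^ ?n))"
    proof (rule tendsto_lowerbound[OF lim])
      show "\<forall>\<^sub>F \<eta> in at_right 0. hausdorff_measure ?n A \<le> ennreal (\<omega> * ((r1 + \<eta>) ^ ?n - (r0 - \<eta>) ^ ?n))"
        using le r(1) unfolding eventually_at_right_field by blast
    qed simp
    then show ?thesis by simp
  qed
  moreover have "ennreal (\<omega> * (r1 ^ ?n - r0 ^ ?n)) \<le> hausdorff_measure ?n A"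
  proof -
    have ge: "ennreal (\<omega> * (s ^ ?n - r0 ^ ?n)) \<le> hausdorff_measure ?n A" if s: "r0 < s" "s < r1" for s
    proof -
      let ?G = "{x \<in> interface e. r0 < norm x \<and> norm x \<le> s}"
      let ?Z = "{x. 0 \<le> x \<bullet> e \<and> x \<bullet> e \<le> 1 \<and> x - (x \<bullet> e) *\<^sub>R e \<in> ?G}"
      have Z: "?Z = C s - C r0" using \<pi> by (auto simp: C_def)
      have "ennreal (\<omega> * (s ^ ?n - r0 ^ ?n)) = emeasure lborel ?Z"
        unfolding Z using s r by (simp add: diff)
      also have "\<dots> \<le> hausdorff_measure ?n ?G"
      proof (rule hausdorff_measure_ge[OF e dim])
        show "?Z \<in> sets lborel" unfolding Z by measurable
      qed auto
      also have "\<dots> \<le> hausdorff_measure ?n A"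
        by (rule hausdorff_measure_mono) (use sub s in force)
      finally show ?thesis .
    qed
    have lim: "((\<lambda>s. ennreal (\<omega> * (s ^ ?n - r0 ^ ?n))) \<longlongrightarrow> ennreal (\<omega> * (r1 ^ ?n - r0 ^ ?n))) (at_left r1)"
      by (intro tendsto_intros)
    show ?thesis
    proof (rule tendsto_upperbound[OF lim])
      show "\<forall>\<^sub>F s in at_left r1. ennreal (\<omega> * (s ^ ?n - r0 ^ ?n)) \<le> hausdorff_measure ?n A"
        using ge r(2) unfolding eventually_at_left_field by blast
    qed simp
  qed
  ultimately show ?thesis unfolding \<omega>_def by (rule antisym)
qed

section \<open>Sets bounded by two caps\<close>

text \<open>The right cap is written as a left cap for \<open>- e\<close>, so that exchanging the
  sides is the identity \<open>two_caps_swap\<close> and every statement about the left side serves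
  the right one.\<close>

definition two_caps :: "'a::euclidean_space \<Rightarrow> real \<Rightarrow> real \<Rightarrow> real \<Rightarrow> real \<Rightarrow> 'a set" where
  "two_caps e \<tau> R \<sigma> S =
     (cball ((\<tau> * R) *\<^sub>R e) R \<inter> {x. x \<bullet> e \<le> 0}) \<union> (cball ((\<sigma> * S) *\<^sub>R (- e)) S \<inter> {x. x \<bullet> (- e) \<le> 0})"

lemma two_caps_swap: "two_caps (- e) \<sigma> S \<tau> R = two_caps e \<tau> R \<sigma> S"
  by (simp add: two_caps_def Un_commute)

lemma closed_two_caps: "closed (two_caps e \<tau> R \<sigma> S)"
  unfolding two_caps_def by (intro closed_Un closed_Int closed_cball closed_Collect_le continuous_intros)

lemma two_caps_half_neg: "two_caps e \<tau> R \<sigma> S \<inter> half_neg e = cball ((\<tau> * R) *\<^sub>R e) R \<inter> half_neg e"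
  by (auto simp: two_caps_def half_neg_def)

lemma null_sets_interface:
  fixes e :: "'a::euclidean_space"
  assumes "e \<in> Basis \<or> - e \<in> Basis"
  shows "interface e \<in> null_sets lborel"
  using assms null_sets_hyperplane[of e 0] null_sets_hyperplane[of "- e" 0] by (auto simp: interface_def)

lemma emeasure_two_caps_half_neg:
  fixes e :: "'a::euclidean_space"
  assumes e: "e \<in> Basis \<or> - e \<in> Basis" and dim: "DIM('a) \<ge> 2" and R: "R > 0" and \<tau>: "\<bar>\<tau>\<bar> \<le> 1"
  shows "emeasure lebesgue (two_caps e \<tau> R \<sigma> S \<inter> half_neg e) = ennreal (R ^ DIM('a) * cap_volume (DIM('a) - 1) \<tau>)"
proof -
  let ?B = "cball ((\<tau> * R) *\<^sub>R e) R"
  have m: "?B \<inter> half_neg e \<in> sets borel" "?B \<inter> {x. x \<bullet> e \<le> 0} \<in> sets borel"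
    unfolding half_neg_def by measurable
  have "emeasure lborel (?B \<inter> half_neg e) = emeasure lborel (?B \<inter> {x. x \<bullet> e \<le> 0})"
  proof (rule emeasure_eq_AE)
    show "AE x in lborel. x \<in> ?B \<inter> half_neg e \<longleftrightarrow> x \<in> ?B \<inter> {x. x \<bullet> e \<le> 0}"
      using AE_not_in[OF null_sets_interface[OF e]] by eventually_elim (auto simp: half_neg_def interface_def)
  qed (use m in auto)
  then show ?thesis
    unfolding two_caps_half_neg using m emeasure_cap[OF e dim R \<tau>] by simp
qed

lemma perimeter_two_caps_half_neg:
  fixes e :: "'a::euclidean_space"
  assumes "e \<in> Basis \<or> - e \<in> Basis" "DIM('a) \<ge> 2" "R > 0" "\<bar>\<tau>\<bar> < 1"
  shows "perimeter (two_caps e \<tau> R \<sigma> S) (half_neg e) =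
    ennreal (R ^ (DIM('a) - 1) * (DIM('a) * cap_volume (DIM('a) - 1) \<tau> + \<tau> * slice_density (DIM('a) - 1) 1 \<tau>))"
  using perimeter_cong[OF two_caps_half_neg] perimeter_cap_le[OF assms] perimeter_cap_ge[OF assms] by simp

section \<open>Finite perimeter of two-cap sets\<close>

lemma power_diff_le:
  fixes x y :: real
  assumes "0 \<le> y" "y \<le> x"
  shows "x ^ k - y ^ k \<le> k * x ^ (k - 1) * (x - y)"
proof (induction k)
  case (Suc k)
  have "x ^ Suc k - y ^ Suc k = x * (x ^ k - y ^ k) + y ^ k * (x - y)" by (simp add: algebra_simps)
  also have "\<dots> \<le> x * (k * x ^ (k - 1) * (x - y)) + x ^ k * (x - y)"
    using Suc assms by (intro add_mono mult_left_mono mult_right_mono power_mono) auto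
  also have "x * (k * x ^ (k - 1) * (x - y)) = k * x ^ k * (x - y)"
    by (cases k) auto
  finally show ?case by (simp add: algebra_simps)
qed simp

lemma emeasure_shell_le:
  fixes c :: "'a::euclidean_space" and R t :: real
  assumes "0 \<le> R" "0 < t" "t \<le> 1"
  shows "emeasure lborel {x. \<bar>norm (x - c) - R\<bar> \<le> t} \<le>
    ennreal (unit_ball_vol DIM('a) * (DIM('a) * (R + 1) ^ (DIM('a) - 1) * 2) * t)"
proof -
  let ?N = "DIM('a)"
  \<comment> \<open>The width \<open>t\<close> may exceed \<open>R\<close>; the inner ball is then
    empty.\<close>
  define y where "y = max 0 (R - t)"
  have y: "0 \<le> y" "y \<le> R + t" "R + t - y \<le> 2 * t" using assms by (auto simp: y_def)
  have "{x. \<bar>norm (x - c) - R\<bar> \<le> t} \<subseteq> cball c (R + t) - ball c y"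
    using y by (auto simp: y_def dist_norm norm_minus_commute abs_le_iff)
  then have "emeasure lborel {x. \<bar>norm (x - c) - R\<bar> \<le> t} \<le> emeasure lborel (cball c (R + t) - ball c y)"
    by (intro emeasure_mono) auto
  also have "\<dots> = emeasure lborel (cball c (R + t)) - emeasure lborel (ball c y)"
    using y emeasure_lborel_ball_finite[of c y] by (intro emeasure_Diff) auto
  also have "\<dots> = ennreal (unit_ball_vol ?N * (R + t) ^ ?N - unit_ball_vol ?N * y ^ ?N)"
    using assms y by (simp add: emeasure_cball emeasure_ball ennreal_minus)
  also have "\<dots> \<le> ennreal (unit_ball_vol ?N * (?N * (R + 1) ^ (?N - 1) * 2) * t)"
  proof (rule ennreal_leI)
    have "(R + t) ^ ?N - y ^ ?N \<le> ?N * (R + t) ^ (?N - 1) * (R + t - y)"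
      by (rule power_diff_le) (use y in auto)
    also have "\<dots> \<le> ?N * (R + 1) ^ (?N - 1) * (2 * t)"
      using assms y by (intro mult_mono power_mono) auto
    finally have "unit_ball_vol ?N * ((R + t) ^ ?N - y ^ ?N) \<le> unit_ball_vol ?N * (?N * (R + 1) ^ (?N - 1) * (2 * t))"
      by (intro mult_left_mono) auto
    then show "unit_ball_vol ?N * (R + t) ^ ?N - unit_ball_vol ?N * y ^ ?N \<le> unit_ball_vol ?N * (?N * (R + 1) ^ (?N - 1) * 2) * t"
      by (simp add: algebra_simps)
  qed
  finally show ?thesis .
qed

lemma emeasure_slab_le:
  fixes e c :: "'a::euclidean_space"
  assumes e: "e \<in> Basis \<or> - e \<in> Basis" and dim: "DIM('a) \<ge> 2" and "R \<ge> 0" "0 < t"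
  shows "emeasure lborel (cball c R \<inter> {x. \<bar>x \<bullet> e\<bar> \<le> t}) \<le> ennreal (unit_ball_vol (DIM('a) - 1) * R ^ (DIM('a) - 1) * 2 * t)"
proof -
  let ?n = "DIM('a) - 1"
  have "emeasure lborel (cball c R \<inter> {x. \<bar>x \<bullet> e\<bar> \<le> t}) = (\<integral>\<^sup>+x. indicator {-t..t} (x \<bullet> e) * indicator (cball c R) x \<partial>lborel)"
  proof (subst nn_integral_indicator[symmetric])
    show "cball c R \<inter> {x. \<bar>x \<bullet> e\<bar> \<le> t} \<in> sets lborel" by measurable
  qed (intro nn_integral_cong, auto simp: indicator_def abs_le_iff)
  also have "\<dots> = (\<integral>\<^sup>+s. indicator {-t..t} s * ennreal (slice_density ?n R (s - c \<bullet> e)) \<partial>lborel)"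
    using assms by (intro nn_integral_ball_slices) auto
  also have "\<dots> \<le> (\<integral>\<^sup>+s. ennreal (unit_ball_vol ?n * R ^ ?n) * indicator {-t..t} s \<partial>lborel)"
  proof (intro nn_integral_mono)
    fix s :: real
    have "slice_density ?n R (s - c \<bullet> e) \<le> unit_ball_vol ?n * R ^ ?n"
      using slice_density_le assms(3) by blast
    then show "indicator {-t..t} s * ennreal (slice_density ?n R (s - c \<bullet> e)) \<le> ennreal (unit_ball_vol ?n * R ^ ?n) * indicator {-t..t} s"
      by (auto simp: indicator_def intro: ennreal_leI)
  qed
  also have "\<dots> = ennreal (unit_ball_vol ?n * R ^ ?n) * ennreal (2 * t)"
    using assms by (subst nn_integral_cmult_indicator) auto
  also have "\<dots> = ennreal (unit_ball_vol ?n * R ^ ?n * 2 * t)"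
    using assms by (simp add: ennreal_mult'[symmetric] mult.assoc)
  finally show ?thesis .
qed

text \<open>A shift of length \<open>t\<close> changes the height and the distance to each centre by
  at most \<open>t\<close>. Membership therefore changes only within \<open>t\<close> of a sphere
  or, near the balls, within \<open>t\<close> of the interface, and these sets have volume of order
  \<open>t\<close>.\<close>

lemma finite_perimeter_two_caps:
  fixes e :: "'a::euclidean_space"
  assumes e: "e \<in> Basis \<or> - e \<in> Basis" and dim: "DIM('a) \<ge> 2" and R: "R > 0" "S > 0"
  shows "finite_perimeter (two_caps e \<tau> R \<sigma> S)"
proof -
  let ?n = "DIM('a) - 1" and ?N = "DIM('a)"
  let ?E = "two_caps e \<tau> R \<sigma> S"
  define c1 where "c1 = (\<tau> * R) *\<^sub>R e"
  define c2 where "c2 = (\<sigma> * S) *\<^sub>R (- e)"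
  have E: "x \<in> ?E \<longleftrightarrow> (norm (x - c1) \<le> R \<and> x \<bullet> e \<le> 0) \<or> (norm (x - c2) \<le> S \<and> x \<bullet> e \<ge> 0)" for x
    by (auto simp: two_caps_def c1_def c2_def dist_norm norm_minus_commute)
  have norme: "norm e = 1" using e by (metis norm_Basis norm_minus_cancel)
  define A1 where "A1 = unit_ball_vol ?N * (?N * (R + 1) ^ ?n * 2)"
  define A2 where "A2 = unit_ball_vol ?N * (?N * (S + 1) ^ ?n * 2)"
  define A3 where "A3 = unit_ball_vol ?n * (R + 1) ^ ?n * 2"
  define A4 where "A4 = unit_ball_vol ?n * (S + 1) ^ ?n * 2"
  have A: "A1 \<ge> 0" "A2 \<ge> 0" "A3 \<ge> 0" "A4 \<ge> 0" using R by (auto simp: A1_def A2_def A3_def A4_def)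
  show ?thesis
  proof (rule perimeter_finite_of_translations[where C = "A1 + A2 + A3 + A4"])
    show "?E \<in> sets borel" by (intro borel_closed closed_two_caps)
    have "?E \<subseteq> cball c1 R \<union> cball c2 S" by (auto simp: two_caps_def c1_def c2_def)
    then have "emeasure lborel ?E \<le> emeasure lborel (cball c1 R \<union> cball c2 S)" by (intro emeasure_mono) auto
    also have "\<dots> < \<infinity>" by (rule emeasure_compact_finite) (intro compact_Un compact_cball)
    finally show "emeasure lborel ?E < \<infinity>" .
    show "0 \<le> A1 + A2 + A3 + A4" using A by simp
    fix i :: 'a and t :: real assume i: "i \<in> Basis" and t: "0 < t" "t \<le> 1"
    \<comment> \<open>The slabs are cut off to have finite volume. Outside both enlarged balls and
      off the shells, neither a point nor its translate can belong to the set.\<close>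
    let ?S1 = "{x. \<bar>norm (x - c1) - R\<bar> \<le> t}" and ?S2 = "{x. \<bar>norm (x - c2) - S\<bar> \<le> t}"
      and ?L1 = "cball c1 (R + 1) \<inter> {x. \<bar>x \<bullet> e\<bar> \<le> t}" and ?L2 = "cball c2 (S + 1) \<inter> {x. \<bar>x \<bullet> e\<bar> \<le> t}"
    have "{x. (x - t *\<^sub>R i \<in> ?E) \<noteq> (x \<in> ?E)} \<subseteq> (?S1 \<union> ?S2) \<union> (?L1 \<union> ?L2)"
    proof
      fix x assume x: "x \<in> {x. (x - t *\<^sub>R i \<in> ?E) \<noteq> (x \<in> ?E)}"
      have d: "\<bar>norm (x - t *\<^sub>R i - c) - norm (x - c)\<bar> \<le> t" for c
        using norm_triangle_ineq3[of "x - t *\<^sub>R i - c" "x - c"] i t by simp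
      have "\<bar>i \<bullet> e\<bar> \<le> 1" using Cauchy_Schwarz_ineq2[of i e] i norme by simp
      then have "\<bar>t * (i \<bullet> e)\<bar> \<le> t" using t by (simp add: abs_mult mult_left_le)
      then have de: "\<bar>(x - t *\<^sub>R i) \<bullet> e - x \<bullet> e\<bar> \<le> t" by (simp add: inner_diff_left)
      show "x \<in> (?S1 \<union> ?S2) \<union> (?L1 \<union> ?L2)"
      proof (rule ccontr)
        assume neg: "x \<notin> (?S1 \<union> ?S2) \<union> (?L1 \<union> ?L2)"
        then have n1: "\<bar>norm (x - c1) - R\<bar> > t" and n2: "\<bar>norm (x - c2) - S\<bar> > t"
          and n3: "norm (x - c1) \<le> R + 1 \<or> norm (x - c2) \<le> S + 1 \<Longrightarrow> \<bar>x \<bullet> e\<bar> > t"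
          by (auto simp: dist_norm norm_minus_commute)
        have e1: "norm (x - t *\<^sub>R i - c1) \<le> R \<longleftrightarrow> norm (x - c1) \<le> R" using d[of c1] n1 by linarith
        have e2: "norm (x - t *\<^sub>R i - c2) \<le> S \<longleftrightarrow> norm (x - c2) \<le> S" using d[of c2] n2 by linarith
        show False
        proof (cases "norm (x - c1) \<le> R + 1 \<or> norm (x - c2) \<le> S + 1")
          case True
          then have "\<bar>x \<bullet> e\<bar> > t" by (rule n3)
          then have "(x - t *\<^sub>R i) \<bullet> e \<le> 0 \<longleftrightarrow> x \<bullet> e \<le> 0" "(x - t *\<^sub>R i) \<bullet> e \<ge> 0 \<longleftrightarrow> x \<bullet> e \<ge> 0"
            using de by linarith+
          then show False using x e1 e2 unfolding E by blast
        next
          case False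
          then have "\<not> norm (x - c1) \<le> R" "\<not> norm (x - c2) \<le> S" by linarith+
          then show False using x e1 e2 unfolding E by blast
        qed
      qed
    qed
    then have "emeasure lborel {x. (x - t *\<^sub>R i \<in> ?E) \<noteq> (x \<in> ?E)} \<le> emeasure lborel ((?S1 \<union> ?S2) \<union> (?L1 \<union> ?L2))"
      by (intro emeasure_mono) (auto, measurable)
    also have "\<dots> \<le> emeasure lborel (?S1 \<union> ?S2) + emeasure lborel (?L1 \<union> ?L2)"
      by (rule emeasure_subadditive) measurable
    also have "\<dots> \<le> (emeasure lborel ?S1 + emeasure lborel ?S2) + (emeasure lborel ?L1 + emeasure lborel ?L2)"
      by (intro add_mono; rule emeasure_subadditive; measurable)
    also have "\<dots> \<le> (ennreal (A1 * t) + ennreal (A2 * t)) + (ennreal (A3 * t) + ennreal (A4 * t))"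
      unfolding A1_def A2_def A3_def A4_def
      using emeasure_shell_le[of R t c1] emeasure_shell_le[of S t c2] emeasure_slab_le[OF e dim, of "R + 1" t c1]
        emeasure_slab_le[OF e dim, of "S + 1" t c2] R t by (intro add_mono) auto
    also have "\<dots> = ennreal ((A1 + A2 + A3 + A4) * t)"
      using A t by (simp add: distrib_right ennreal_plus[symmetric] del: ennreal_plus)
    finally show "emeasure lborel {x. (x - t *\<^sub>R i \<in> ?E) \<noteq> (x \<in> ?E)} \<le> ennreal ((A1 + A2 + A3 + A4) * t)" .
  qed
qed

section \<open>The contact set of two caps\<close>

lemma emeasure_open_pos:
  fixes U :: "'a::euclidean_space set"
  assumes "open U" "U \<noteq> {}"
  shows "emeasure lebesgue U > 0"
  using open_not_negligible[OF assms] assms(1)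
  by (auto simp: negligible_iff_null_sets null_sets_def zero_less_iff_neq_zero)

lemma bdry_subset_closed: "closed E \<Longrightarrow> bdry E \<subseteq> E"
proof
  fix x assume E: "closed E" and x: "x \<in> bdry E"
  show "x \<in> E"
  proof (rule ccontr)
    assume "x \<notin> E"
    then obtain r where "r > 0" "ball x r \<subseteq> - E"
      using E open_contains_ball[of "- E"] by (auto simp: open_Compl)
    then have "E \<inter> ball x r = {}" by auto
    then show False using x \<open>r > 0\<close> by (auto simp: bdry_def)
  qed
qed

lemma norm_center_interface:
  assumes "e \<bullet> e = 1" "x \<bullet> e = 0"
  shows "(norm (x - (\<tau> * R) *\<^sub>R e))\<^sup>2 = (norm x)\<^sup>2 + \<tau>\<^sup>2 * R\<^sup>2"
  unfolding power2_norm_eq_inner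
  using assms by (simp add: inner_diff_left inner_diff_right inner_commute[of e x] power2_eq_square)

lemma mem_ball_interface:
  assumes e: "e \<bullet> e = 1" "x \<bullet> e = 0" and R: "R > 0" and \<tau>: "\<bar>\<tau>\<bar> \<le> 1"
  shows "x \<in> cball ((\<tau> * R) *\<^sub>R e) R \<longleftrightarrow> norm x \<le> R * sqrt (1 - \<tau>\<^sup>2)"
    and "x \<in> ball ((\<tau> * R) *\<^sub>R e) R \<longleftrightarrow> norm x < R * sqrt (1 - \<tau>\<^sup>2)"
proof -
  have \<tau>2: "\<tau>\<^sup>2 \<le> 1" using \<tau> by (simp add: abs_square_le_1)
  define p where "p = R * sqrt (1 - \<tau>\<^sup>2)"
  have p: "p \<ge> 0" "p\<^sup>2 = R\<^sup>2 - \<tau>\<^sup>2 * R\<^sup>2" using R \<tau>2 by (auto simp: p_def power_mult_distrib algebra_simps)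
  have "norm (x - (\<tau> * R) *\<^sub>R e) \<le> R \<longleftrightarrow> (norm (x - (\<tau> * R) *\<^sub>R e))\<^sup>2 \<le> R\<^sup>2"
    using R by (simp add: abs_le_square_iff[symmetric])
  also have "\<dots> \<longleftrightarrow> (norm x)\<^sup>2 \<le> p\<^sup>2" unfolding norm_center_interface[OF e] p by linarith
  also have "\<dots> \<longleftrightarrow> norm x \<le> p" using p(1) by (simp add: abs_le_square_iff[symmetric])
  finally show "x \<in> cball ((\<tau> * R) *\<^sub>R e) R \<longleftrightarrow> norm x \<le> R * sqrt (1 - \<tau>\<^sup>2)"
    by (simp add: p_def dist_norm norm_minus_commute)
  have "norm (x - (\<tau> * R) *\<^sub>R e) \<ge> R \<longleftrightarrow> (norm (x - (\<tau> * R) *\<^sub>R e))\<^sup>2 \<ge> R\<^sup>2"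
    using R by (simp add: abs_le_square_iff[symmetric])
  also have "\<dots> \<longleftrightarrow> (norm x)\<^sup>2 \<ge> p\<^sup>2" unfolding norm_center_interface[OF e] p by linarith
  also have "\<dots> \<longleftrightarrow> norm x \<ge> p" using p(1) by (simp add: abs_le_square_iff[symmetric])
  finally show "x \<in> ball ((\<tau> * R) *\<^sub>R e) R \<longleftrightarrow> norm x < R * sqrt (1 - \<tau>\<^sup>2)"
    by (auto simp: p_def dist_norm norm_minus_commute)
qed

text \<open>A point of the interface strictly between the rims is interior to the left ball and off
  the right one, so the set is locally a half ball there. Inside the smaller disc both balls contain
  a neighbourhood, so the set has full measure nearby; outside the larger disc the closed set is
  absent.\<close>

lemma hausdorff_measure_Gamma_zero_less:
  fixes e :: "'a::euclidean_space"
  assumes e: "e \<in> Basis \<or> - e \<in> Basis" and dim: "DIM('a) \<ge> 2" and R: "R > 0" "S > 0"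
    and \<tau>: "\<bar>\<tau>\<bar> < 1" "\<bar>\<sigma>\<bar> < 1" and less: "S * sqrt (1 - \<sigma>\<^sup>2) < R * sqrt (1 - \<tau>\<^sup>2)"
  shows "hausdorff_measure (DIM('a) - 1) (Gamma_zero e (two_caps e \<tau> R \<sigma> S)) =
    ennreal (R ^ (DIM('a) - 1) * slice_density (DIM('a) - 1) 1 \<tau> - S ^ (DIM('a) - 1) * slice_density (DIM('a) - 1) 1 \<sigma>)"
proof -
  let ?n = "DIM('a) - 1"
  let ?E = "two_caps e \<tau> R \<sigma> S"
  define B1 where "B1 = cball ((\<tau> * R) *\<^sub>R e) R"
  define B2 where "B2 = cball ((\<sigma> * S) *\<^sub>R (- e)) S"
  define r1 where "r1 = R * sqrt (1 - \<tau>\<^sup>2)"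
  define r0 where "r0 = S * sqrt (1 - \<sigma>\<^sup>2)"
  have ee: "e \<bullet> e = 1" "(- e) \<bullet> (- e) = 1" using e inner_same_Basis[of "-e"] inner_same_Basis[of e] by auto
  have norme: "norm e = 1" using ee by (simp add: norm_eq_1)
  have E: "?E = (B1 \<inter> {x. x \<bullet> e \<le> 0}) \<union> (B2 \<inter> {x. x \<bullet> e \<ge> 0})" by (auto simp: two_caps_def B1_def B2_def)
  have r0: "0 < r0" using R \<tau> abs_square_less_1[of \<sigma>] by (simp add: r0_def)
  have r01: "r0 < r1" using less by (simp add: r0_def r1_def)
  have B1i: "x \<in> B1 \<longleftrightarrow> norm x \<le> r1" "x \<in> interior B1 \<longleftrightarrow> norm x < r1"
    and B2i: "x \<in> B2 \<longleftrightarrow> norm x \<le> r0" "x \<in> interior B2 \<longleftrightarrow> norm x < r0" if "x \<in> interface e" for x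
  proof -
    have x: "x \<bullet> e = 0" "x \<bullet> (- e) = 0" using that by (auto simp: interface_def)
    show "x \<in> B1 \<longleftrightarrow> norm x \<le> r1" "x \<in> interior B1 \<longleftrightarrow> norm x < r1"
      using mem_ball_interface[OF ee(1) x(1) R(1), of \<tau>] \<tau> by (auto simp: B1_def r1_def simp del: mem_cball mem_ball)
    show "x \<in> B2 \<longleftrightarrow> norm x \<le> r0" "x \<in> interior B2 \<longleftrightarrow> norm x < r0"
      using mem_ball_interface[OF ee(2) x(2) R(2), of \<sigma>] \<tau> by (auto simp: B2_def r0_def simp del: mem_cball mem_ball)
  qed
  have sub: "{x \<in> interface e. r0 < norm x \<and> norm x < r1} \<subseteq> Gamma_zero e ?E"
  proof
    fix x assume "x \<in> {x \<in> interface e. r0 < norm x \<and> norm x < r1}"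
    then have x: "x \<in> interface e" "r0 < norm x" "norm x < r1" by auto
    have "x \<in> interior B1 \<inter> - B2" using B1i(2)[OF x(1)] B2i(1)[OF x(1)] x by auto
    moreover have "open (interior B1 \<inter> - B2)" by (auto simp: B2_def)
    ultimately obtain d where d: "d > 0" "ball x d \<subseteq> interior B1 \<inter> - B2" unfolding open_contains_ball by blast
    have dB: "ball x d \<subseteq> B1" "ball x d \<inter> B2 = {}" using d(2) interior_subset by blast+
    have "x \<in> bdry ?E" unfolding bdry_def
    proof safe
      fix r :: real assume r: "r > 0"
      define q where "q = min d r"
      have q: "q > 0" "q \<le> d" "q \<le> r" using d r by (auto simp: q_def)
      have dist: "dist x (x + s *\<^sub>R e) = \<bar>s\<bar>" for s by (simp add: dist_norm norme)
      have xe: "(x + s *\<^sub>R e) \<bullet> e = s" for s using x(1) by (simp add: interface_def inner_add_left ee)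
      \<comment> \<open>The two halves of a small ball: the lower one lies in the set and the upper
        one outside it, which gives the two strict inequalities in \<open>bdry\<close>.\<close>
      let ?U = "ball x q \<inter> {x. x \<bullet> e < 0}" and ?W = "ball x q \<inter> {x. x \<bullet> e > 0}"
      have opU: "open ?U" "open ?W" by (auto intro!: open_Int open_Collect_less continuous_intros)
      have "x + (- q / 2) *\<^sub>R e \<in> ?U" using q unfolding Int_iff mem_ball dist mem_Collect_eq xe by simp
      then have "?U \<noteq> {}" by blast
      then have Upos: "emeasure lebesgue ?U > 0" using opU by (intro emeasure_open_pos)
      have "x + (q / 2) *\<^sub>R e \<in> ?W" using q unfolding Int_iff mem_ball dist mem_Collect_eq xe by simp
      then have "?W \<noteq> {}" by blast
      then have Wpos: "emeasure lebesgue ?W > 0" using opU by (intro emeasure_open_pos)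
      have qd: "ball x q \<subseteq> ball x d" "ball x q \<subseteq> ball x r" using q by auto
      have "?U \<subseteq> ?E \<inter> ball x r" using qd dB unfolding E by auto
      then have "emeasure lebesgue ?U \<le> emeasure lebesgue (?E \<inter> ball x r)"
        using closed_two_caps[of e \<tau> R \<sigma> S] by (intro emeasure_mono) auto
      then show "0 < emeasure lebesgue (?E \<inter> ball x r)" using Upos by simp
      have "?E \<inter> ball x r \<subseteq> ball x r - ?W" using qd dB unfolding E by auto
      then have "emeasure lebesgue (?E \<inter> ball x r) \<le> emeasure lebesgue (ball x r - ?W)"
        using opU by (intro emeasure_mono) auto
      also have "\<dots> = emeasure lebesgue (ball x r) - emeasure lebesgue ?W"
      proof (rule emeasure_Diff)
        have "emeasure lebesgue ?W \<le> emeasure lebesgue (ball x q)" by (intro emeasure_mono) auto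
        then show "emeasure lebesgue ?W \<noteq> \<infinity>" using emeasure_lborel_ball_finite[of x q] by auto
      qed (use opU qd in auto)
      also have "\<dots> < emeasure lebesgue (ball x r)"
      proof (rule ennreal_between)
        show "emeasure lebesgue (ball x r) < top" using emeasure_lborel_ball_finite[of x r] by simp
        show "0 < emeasure lebesgue ?W" by (rule Wpos)
        show "0 < emeasure lebesgue (ball x r)" using r by (intro emeasure_open_pos) auto
      qed
      finally show "emeasure lebesgue (?E \<inter> ball x r) < emeasure lebesgue (ball x r)" .
    qed
    then show "x \<in> Gamma_zero e ?E" using x by (simp add: Gamma_zero_def)
  qed
  have sup: "Gamma_zero e ?E \<subseteq> {x \<in> interface e. r0 \<le> norm x \<and> norm x \<le> r1}"
  proof
    fix x assume "x \<in> Gamma_zero e ?E"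
    then have x: "x \<in> interface e" "x \<in> bdry ?E" by (auto simp: Gamma_zero_def)
    have "x \<in> ?E" using bdry_subset_closed[OF closed_two_caps] x by blast
    then have "norm x \<le> r1" using B1i[OF x(1)] B2i[OF x(1)] r01 unfolding E by auto
    moreover have "r0 \<le> norm x"
    proof (rule ccontr)
      assume "\<not> r0 \<le> norm x"
      then have "x \<in> interior B1 \<inter> interior B2" using B1i[OF x(1)] B2i[OF x(1)] r01 by auto
      moreover have "open (interior B1 \<inter> interior B2)" by auto
      ultimately obtain d where d: "d > 0" "ball x d \<subseteq> interior B1 \<inter> interior B2"
        using open_contains_ball[of "interior B1 \<inter> interior B2"] by blast
      then have "ball x d \<subseteq> B1" "ball x d \<subseteq> B2" using interior_subset by blast+
      then have "?E \<inter> ball x d = ball x d" unfolding E by auto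
      then show False using x(2) d(1) unfolding bdry_def by force
    qed
    ultimately show "x \<in> {x \<in> interface e. r0 \<le> norm x \<and> norm x \<le> r1}" using x by simp
  qed
  have int: "interface (- e) = interface e" by (auto simp: interface_def)
  have "hausdorff_measure ?n (Gamma_zero e ?E) = ennreal (unit_ball_vol ?n * (r1 ^ ?n - r0 ^ ?n))"
  proof (cases "e \<in> Basis")
    case True
    then show ?thesis using hausdorff_measure_annulus[OF True dim r0 r01 sub sup] by simp
  next
    case False
    then have "- e \<in> Basis" using e by simp
    from hausdorff_measure_annulus[OF this dim r0 r01, unfolded int, OF sub sup] show ?thesis by simp
  qed
  also have "unit_ball_vol ?n * (r1 ^ ?n - r0 ^ ?n) = R ^ ?n * slice_density ?n 1 \<tau> - S ^ ?n * slice_density ?n 1 \<sigma>"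
    using \<tau> by (simp add: slice_density_eq r0_def r1_def power_mult_distrib algebra_simps)
  finally show ?thesis .
qed

lemma cap_area_eq:
  assumes "\<bar>\<tau>\<bar> < 1" "R > 0"
  shows "R ^ n * slice_density n 1 \<tau> = unit_ball_vol n * (R * sqrt (1 - \<tau>\<^sup>2)) ^ n"
  using assms by (simp add: slice_density_eq power_mult_distrib)

text \<open>If the right disc is the larger one, the previous lemma applies to \<open>- e\<close>
  with the caps exchanged, because the interface does not see the sign of \<open>e\<close>.\<close>

lemma hausdorff_measure_Gamma_zero:
  fixes e :: "'a::euclidean_space"
  assumes e: "e \<in> Basis \<or> - e \<in> Basis" and dim: "DIM('a) \<ge> 2" and R: "R > 0" "S > 0"
    and \<tau>: "\<bar>\<tau>\<bar> < 1" "\<bar>\<sigma>\<bar> < 1"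
    and ne: "R ^ (DIM('a) - 1) * slice_density (DIM('a) - 1) 1 \<tau> \<noteq> S ^ (DIM('a) - 1) * slice_density (DIM('a) - 1) 1 \<sigma>"
  shows "hausdorff_measure (DIM('a) - 1) (Gamma_zero e (two_caps e \<tau> R \<sigma> S)) =
    ennreal \<bar>R ^ (DIM('a) - 1) * slice_density (DIM('a) - 1) 1 \<tau> - S ^ (DIM('a) - 1) * slice_density (DIM('a) - 1) 1 \<sigma>\<bar>"
proof -
  let ?n = "DIM('a) - 1"
  let ?r = "R * sqrt (1 - \<tau>\<^sup>2)" and ?s = "S * sqrt (1 - \<sigma>\<^sup>2)"
  have pos: "0 \<le> ?r" "0 \<le> ?s" using R \<tau> abs_square_less_1[of \<tau>] abs_square_less_1[of \<sigma>] by auto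
  have ne': "?r \<noteq> ?s" using ne unfolding cap_area_eq[OF \<tau>(1) R(1)] cap_area_eq[OF \<tau>(2) R(2)] by auto
  show ?thesis
  proof (cases "?s < ?r")
    case True
    have "?s ^ ?n \<le> ?r ^ ?n" using True pos by (intro power_mono) auto
    then have "S ^ ?n * slice_density ?n 1 \<sigma> \<le> R ^ ?n * slice_density ?n 1 \<tau>"
      unfolding cap_area_eq[OF \<tau>(1) R(1)] cap_area_eq[OF \<tau>(2) R(2)] by (intro mult_left_mono) auto
    then show ?thesis using hausdorff_measure_Gamma_zero_less[OF e dim R \<tau> True] by simp
  next
    case False
    then have less: "?r < ?s" using ne' by simp
    have e': "- e \<in> Basis \<or> - (- e) \<in> Basis" using e by auto
    have "?r ^ ?n \<le> ?s ^ ?n" using less pos by (intro power_mono) auto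
    then have "R ^ ?n * slice_density ?n 1 \<tau> \<le> S ^ ?n * slice_density ?n 1 \<sigma>"
      unfolding cap_area_eq[OF \<tau>(1) R(1)] cap_area_eq[OF \<tau>(2) R(2)] by (intro mult_left_mono) auto
    moreover have "Gamma_zero (- e) X = Gamma_zero e X" for X by (auto simp: Gamma_zero_def interface_def)
    ultimately show ?thesis
      using hausdorff_measure_Gamma_zero_less[OF e' dim R(2,1) \<tau>(2,1) less] by (simp add: two_caps_swap)
  qed
qed

section \<open>The first variation\<close>

text \<open>The divergence theorem for (x - c) / R on the cap: its flux through the curved part is
  the volume integral of the divergence minus the flux through the base disc, where its normal
  component is - \<tau>.\<close>

definition cap_perimeter :: "nat \<Rightarrow> real \<Rightarrow> real \<Rightarrow> real" where
  "cap_perimeter n \<tau> R = R ^ n * (real (Suc n) * cap_volume n \<tau> + \<tau> * slice_density n 1 \<tau>)"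

definition cap_area :: "nat \<Rightarrow> real \<Rightarrow> real \<Rightarrow> real" where
  "cap_area n \<tau> R = R ^ n * slice_density n 1 \<tau>"

text \<open>For \<open>\<tau> < 0\<close> this says that the cap contains the cone over its base disc with apex at the centre.\<close>

lemma cap_perimeter_pos:
  assumes "\<bar>\<tau>\<bar> < 1" "R > 0" "n > 0"
  shows "cap_perimeter n \<tau> R > 0"
proof -
  let ?h = "\<lambda>\<tau>. real (Suc n) * cap_volume n \<tau> + \<tau> * slice_density n 1 \<tau>"
  have "?h 1 < ?h \<tau>"
  proof (rule DERIV_neg_imp_decreasing_open[of \<tau> 1 ?h])
    fix x assume x: "\<tau> < x" "x < 1"
    then have x1: "\<bar>x\<bar> < 1" using assms by auto
    have lt: "1 - x\<^sup>2 > 0" using x1 abs_square_less_1[of x] by simp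
    have "(?h has_real_derivative real (Suc n) * (- slice_density n 1 x)
       + (1 * slice_density n 1 x + (- (n * x * slice_density n 1 x / (1 - x\<^sup>2))) * x)) (at x)"
      using x1 assms
      by (intro DERIV_add DERIV_cmult DERIV_mult DERIV_ident has_real_derivative_slice_density has_real_derivative_cap_volume)
    \<comment> \<open>The terms combine to a negative quantity whatever the sign of
      \<open>x\<close>, so here no distinction by the sign of \<tau> arises.\<close>
    also have "real (Suc n) * (- slice_density n 1 x) + (1 * slice_density n 1 x + (- (n * x * slice_density n 1 x / (1 - x\<^sup>2))) * x)
       = - (n * slice_density n 1 x / (1 - x\<^sup>2))"
      using lt by (simp add: field_simps power2_eq_square)
    finally show "\<exists>y. (?h has_real_derivative y) (at x) \<and> y < 0"
    proof (intro exI conjI)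
      have "n * slice_density n 1 x / (1 - x\<^sup>2) > 0"
        using slice_density_pos[of x 1 n] x1 lt assms by simp
      then show "- (n * slice_density n 1 x / (1 - x\<^sup>2)) < 0" by simp
    qed
  next
    show "continuous_on {\<tau>..1} ?h"
      by (intro continuous_intros continuous_on_subset[OF continuous_on_cap_volume]) (use assms in auto)
  qed (use assms in auto)
  moreover have "?h 1 = 0" using assms slice_density_zero[of n 1 1] by simp
  ultimately show ?thesis using assms by (simp add: cap_perimeter_def)
qed

text \<open>Positivity of the two perimeters allows the sum in \<open>ennreal\<close> to be
  collapsed to one real number, ready for differentiation.\<close>

lemma energy_two_caps:
  fixes e :: "'a::euclidean_space"
  assumes e: "e \<in> Basis \<or> - e \<in> Basis" and dim: "DIM('a) = Suc n" "n > 0" and R: "R > 0" "S > 0"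
    and \<tau>: "\<bar>\<tau>\<bar> < 1" "\<bar>\<sigma>\<bar> < 1" and coeff: "\<rho>m > 0" "\<rho>p > 0" "\<gamma> \<ge> 0"
    and ne: "cap_area n \<tau> R \<noteq> cap_area n \<sigma> S"
  shows "energy e \<rho>m \<rho>p \<gamma> (two_caps e \<tau> R \<sigma> S) =
    ennreal (\<rho>m * cap_perimeter n \<tau> R + \<rho>p * cap_perimeter n \<sigma> S + \<gamma> * \<bar>cap_area n \<tau> R - cap_area n \<sigma> S\<bar>)"
proof -
  have dim2: "DIM('a) \<ge> 2" using dim by simp
  have e': "- e \<in> Basis \<or> - (- e) \<in> Basis" using e by auto
  have hp: "half_pos e = half_neg (- e)" by (auto simp: half_pos_def half_neg_def)
  have 1: "perimeter (two_caps e \<tau> R \<sigma> S) (half_neg e) = ennreal (cap_perimeter n \<tau> R)"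
    using perimeter_two_caps_half_neg[OF e dim2 R(1) \<tau>(1)] dim by (simp add: cap_perimeter_def)
  have 2: "perimeter (two_caps e \<tau> R \<sigma> S) (half_pos e) = ennreal (cap_perimeter n \<sigma> S)"
    unfolding hp two_caps_swap[of e, symmetric]
    using perimeter_two_caps_half_neg[OF e' dim2 R(2) \<tau>(2)] dim by (simp add: cap_perimeter_def)
  have 3: "hausdorff_measure (DIM('a) - 1) (Gamma_zero e (two_caps e \<tau> R \<sigma> S)) = ennreal \<bar>cap_area n \<tau> R - cap_area n \<sigma> S\<bar>"
    using hausdorff_measure_Gamma_zero[OF e dim2 R \<tau>] ne dim by (simp add: cap_area_def)
  have "cap_perimeter n \<tau> R > 0" "cap_perimeter n \<sigma> S > 0"
    using cap_perimeter_pos \<tau> R dim by auto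
  then show ?thesis
    unfolding energy_def 1 2 3 using coeff by (simp add: ennreal_mult'[symmetric] ennreal_plus[symmetric] del: ennreal_plus)
qed

text \<open>Stationarity in the cap parameter yields the claimed expression times \<open>D'\<close>,
  the derivative of the base area, and \<open>D' > 0\<close> cancels. Only the left cap moves;
  applied to \<open>- e\<close> with the caps exchanged, the lemma gives the balance on the
  right.\<close>

lemma minimizer_two_caps_balance:
  fixes e :: "'a::euclidean_space"
  assumes e: "e \<in> Basis \<or> - e \<in> Basis" and dim: "DIM('a) = Suc n" "n > 0" and R: "R > 0" "S > 0"
    and \<tau>: "\<bar>\<tau>\<bar> < 1" "\<bar>\<sigma>\<bar> < 1" and coeff: "\<rho>m > 0" "\<rho>p > 0" "\<gamma> \<ge> 0"
    and min: "minimizer e \<rho>m \<rho>p \<gamma> Vm Vp (two_caps e \<tau> R \<sigma> S)"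
    and ne: "cap_area n \<tau> R \<noteq> cap_area n \<sigma> S"
  shows "\<rho>m * \<tau> + \<gamma> * sgn (cap_area n \<tau> R - cap_area n \<sigma> S) = 0"
proof -
  let ?\<kappa> = "slice_density n 1" and ?V = "cap_volume n"
  have dim2: "DIM('a) \<ge> 2" using dim by simp
  define sg where "sg = sgn (cap_area n \<tau> R - cap_area n \<sigma> S)"
  define v where "v = R ^ Suc n * ?V \<tau>"
  \<comment> \<open>The radius forced by volume \<open>v\<close> once the cap parameter is
    \<open>t\<close>.\<close>
  define r where "r t = (v / ?V t) powr (1 / real (Suc n))" for t
  define D where "D t = r t ^ n * ?\<kappa> t" for t
  \<comment> \<open>The perimeter rewritten through the constant \<open>v\<close>, so that
    \<open>cap_volume\<close> drops out and only \<open>r\<close> and \<open>D\<close> need to be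
    differentiated.\<close>
  define P where "P t = real (Suc n) * v / r t + t * D t" for t
  have v: "v > 0" using R cap_volume_pos[OF \<tau>(1), of n] by (simp add: v_def)
  have r: "r t > 0" "r t ^ Suc n * ?V t = v" if "\<bar>t\<bar> < 1" for t
  proof -
    have V: "?V t > 0" by (rule cap_volume_pos[OF that])
    show "r t > 0" using v V by (simp add: r_def)
    have "r t ^ Suc n = v / ?V t"
      unfolding r_def using v V by (subst powr_realpow[symmetric]) (auto simp: powr_powr)
    then show "r t ^ Suc n * ?V t = v" using V by simp
  qed
  have r\<tau>: "r \<tau> = R"
  proof -
    have "r \<tau> ^ Suc n = R ^ Suc n" using r(2)[OF \<tau>(1)] cap_volume_pos[OF \<tau>(1), of n] by (simp add: v_def)
    then show ?thesis using r(1)[OF \<tau>(1)] R by (metis power_inject_base less_imp_le)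
  qed
  have area: "cap_area n t (r t) = D t" for t by (simp add: cap_area_def D_def)
  have perim: "cap_perimeter n t (r t) = P t" if "\<bar>t\<bar> < 1" for t
  proof -
    have "real (Suc n) * v / r t = r t ^ n * (real (Suc n) * ?V t)"
      unfolding r(2)[OF that, symmetric] using r(1)[OF that] by simp
    then show ?thesis by (simp add: cap_perimeter_def P_def D_def algebra_simps)
  qed
  \<comment> \<open>The sign is frozen at its value for \<tau>, making \<open>f\<close>
    differentiable. It is the energy up to the constant contribution of the right cap as long as the
    sign persists.\<close>
  define f where "f t = \<rho>m * P t + \<gamma> * (sg * (D t - cap_area n \<sigma> S))" for t
  have dr: "(r has_real_derivative r \<tau> * (?\<kappa> \<tau> / (real (Suc n) * ?V \<tau>))) (at \<tau>)"
  proof -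
    have V: "?V \<tau> > 0" by (rule cap_volume_pos[OF \<tau>(1)])
    have "((\<lambda>t. v / ?V t) has_real_derivative (0 * ?V \<tau> - v * (- ?\<kappa> \<tau>)) / (?V \<tau> * ?V \<tau>)) (at \<tau>)"
      by (rule DERIV_divide[OF DERIV_const has_real_derivative_cap_volume[OF \<tau>(1)]]) (use V in simp)
    moreover have "((\<lambda>z. z powr (1 / real (Suc n))) has_real_derivative (1 / real (Suc n)) * (v / ?V \<tau>) powr (1 / real (Suc n) - 1)) (at (v / ?V \<tau>))"
      by (rule has_real_derivative_powr) (use v V in simp)
    ultimately have "(r has_real_derivative ((1 / real (Suc n)) * (v / ?V \<tau>) powr (1 / real (Suc n) - 1)) * ((0 * ?V \<tau> - v * (- ?\<kappa> \<tau>)) / (?V \<tau> * ?V \<tau>))) (at \<tau>)"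
      unfolding r_def by (rule DERIV_chain2[rotated])
    also have "(v / ?V \<tau>) powr (1 / real (Suc n) - 1) = r \<tau> / (v / ?V \<tau>)"
      using v V by (simp add: powr_diff r_def)
    also have "((1 / real (Suc n)) * (r \<tau> / (v / ?V \<tau>))) * ((0 * ?V \<tau> - v * (- ?\<kappa> \<tau>)) / (?V \<tau> * ?V \<tau>)) = r \<tau> * (?\<kappa> \<tau> / (real (Suc n) * ?V \<tau>))"
      using v V by (simp add: field_simps del: of_nat_Suc)
    finally show ?thesis .
  qed
  define r' where "r' = R * (?\<kappa> \<tau> / (real (Suc n) * ?V \<tau>))"
  define \<kappa>' where "\<kappa>' = - (n * \<tau> * ?\<kappa> \<tau> / (1 - \<tau>\<^sup>2))"
  define D' where "D' = real n * (r' * R ^ (n - 1)) * ?\<kappa> \<tau> + \<kappa>' * R ^ n"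
  have dr': "(r has_real_derivative r') (at \<tau>)" using dr by (simp add: r'_def r\<tau>)
  have dD: "(D has_real_derivative D') (at \<tau>)"
  proof -
    have "((\<lambda>t. r t ^ n) has_real_derivative real n * (r' * r \<tau> ^ (n - Suc 0))) (at \<tau>)"
      using DERIV_power[OF dr', of n] by simp
    then have "(D has_real_derivative (real n * (r' * r \<tau> ^ (n - Suc 0))) * ?\<kappa> \<tau> + \<kappa>' * r \<tau> ^ n) (at \<tau>)"
      unfolding D_def \<kappa>'_def by (intro DERIV_mult has_real_derivative_slice_density \<tau> dim)
    then show ?thesis by (simp add: D'_def r\<tau>)
  qed
  have dP: "(P has_real_derivative \<tau> * D') (at \<tau>)"
  proof -
    have V: "?V \<tau> > 0" by (rule cap_volume_pos[OF \<tau>(1)])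
    have "((\<lambda>t. real (Suc n) * v / r t) has_real_derivative (0 * r \<tau> - real (Suc n) * v * r') / (r \<tau> * r \<tau>)) (at \<tau>)"
      by (rule DERIV_divide[OF DERIV_const dr']) (use R r\<tau> in simp)
    moreover have "((\<lambda>t. t * D t) has_real_derivative 1 * D \<tau> + D' * \<tau>) (at \<tau>)"
      by (rule DERIV_mult[OF DERIV_ident dD])
    ultimately have "(P has_real_derivative (0 * r \<tau> - real (Suc n) * v * r') / (r \<tau> * r \<tau>) + (1 * D \<tau> + D' * \<tau>)) (at \<tau>)"
      unfolding P_def by (rule DERIV_add)
    \<comment> \<open>Where the volume constraint enters: the variation of the radius cancels the
      term \<open>D \<tau>\<close> of the product rule, and only \<open>\<tau> * D'\<close> is
      left.\<close>
    moreover have "(0 * r \<tau> - real (Suc n) * v * r') / (r \<tau> * r \<tau>) = - D \<tau>"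
    proof -
      have "real (Suc n) * v * r' = R ^ n * ?\<kappa> \<tau> * (R * R)"
        unfolding r'_def v_def using V by (simp add: field_simps del: of_nat_Suc)
      then show ?thesis using R by (simp add: r\<tau> D_def)
    qed
    ultimately show ?thesis by (simp add: mult.commute)
  qed
  have D'pos: "D' > 0"
  proof -
    have V: "?V \<tau> > 0" by (rule cap_volume_pos[OF \<tau>(1)])
    have \<kappa>: "?\<kappa> \<tau> > 0" by (rule slice_density_pos[OF \<tau>(1)])
    have lt: "1 - \<tau>\<^sup>2 > 0" using \<tau> abs_square_less_1[of \<tau>] by simp
    have Rn: "R ^ n = R ^ (n - 1) * R" using power_minus_mult[OF dim(2), of R] by simp
    \<comment> \<open>Factoring exhibits the comparison of the cap with its tangent cone,
      \<open>cap_volume_less\<close>, as the sign of \<open>D'\<close>: raising \<tau> at fixed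
      volume widens the base disc.\<close>
    have "D' = real n * R ^ n * ?\<kappa> \<tau> * (?\<kappa> \<tau> / (real (Suc n) * ?V \<tau>) - \<tau> / (1 - \<tau>\<^sup>2))"
      unfolding D'_def r'_def \<kappa>'_def Rn by (simp add: algebra_simps)
    moreover have "\<tau> / (1 - \<tau>\<^sup>2) < ?\<kappa> \<tau> / (real (Suc n) * ?V \<tau>)"
    proof -
      have "\<tau> * (real (Suc n) * ?V \<tau>) < ?\<kappa> \<tau> * (1 - \<tau>\<^sup>2)"
        using cap_volume_less[OF \<tau>(1) dim(2)] by (simp add: algebra_simps)
      moreover have "real (Suc n) * ?V \<tau> > 0" using V by simp
      ultimately show ?thesis using lt by (simp add: divide_less_eq less_divide_eq mult.commute mult.left_commute mult.assoc del: of_nat_Suc)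
    qed
    ultimately show ?thesis using \<kappa> R dim by simp
  qed
  have df: "(f has_real_derivative \<rho>m * (\<tau> * D') + \<gamma> * (sg * (D' - 0))) (at \<tau>)"
    unfolding f_def by (intro DERIV_add DERIV_cmult DERIV_diff DERIV_const dP dD)
  have sg: "sg * (cap_area n \<tau> R - cap_area n \<sigma> S) > 0"
    using ne by (auto simp: sg_def sgn_if)
  have "isCont D \<tau>" using dD by (rule DERIV_isCont)
  then have "((\<lambda>t. sg * (D t - cap_area n \<sigma> S)) \<longlongrightarrow> sg * (D \<tau> - cap_area n \<sigma> S)) (at \<tau>)"
    unfolding isCont_def by (intro tendsto_intros)
  moreover have "sg * (D \<tau> - cap_area n \<sigma> S) > 0" using sg area[of \<tau>] by (simp add: r\<tau>)
  ultimately have ev: "\<forall>\<^sub>F t in at \<tau>. sg * (D t - cap_area n \<sigma> S) > 0" by (rule order_tendstoD(1))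
  then obtain d0 where d0: "d0 > 0" "\<And>t. t \<noteq> \<tau> \<Longrightarrow> dist t \<tau> < d0 \<Longrightarrow> sg * (D t - cap_area n \<sigma> S) > 0"
    unfolding eventually_at by auto
  \<comment> \<open>Within distance \<open>d\<close> of \<tau> the parameter stays in (-1, 1) and
    the sign of the difference of the areas does not change.\<close>
  define d where "d = min d0 (1 - \<bar>\<tau>\<bar>)"
  have d: "d > 0" using d0 \<tau> by (simp add: d_def)
  have "f \<tau> \<le> f t" if t: "\<bar>\<tau> - t\<bar> < d" for t
  proof (cases "t = \<tau>")
    case False
    have "\<bar>\<tau> - t\<bar> < 1 - \<bar>\<tau>\<bar>" using t by (simp add: d_def)
    then have t1: "\<bar>t\<bar> < 1" by linarith
    have pos: "sg * (D t - cap_area n \<sigma> S) > 0"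
      using d0(2)[OF False] t by (simp add: d_def dist_real_def abs_minus_commute)
    have sgabs: "sg * x = \<bar>x\<bar>" if "sg * x > 0" for x
      using that by (auto simp: sg_def sgn_if split: if_splits)
    let ?E = "two_caps e t (r t) \<sigma> S"
    have e': "- e \<in> Basis \<or> - (- e) \<in> Basis" using e by auto
    have hp: "half_pos e = half_neg (- e)" by (auto simp: half_pos_def half_neg_def)
    have right: "two_caps e t (r t) \<sigma> S \<inter> half_pos e = two_caps e \<tau> R \<sigma> S \<inter> half_pos e"
      unfolding hp two_caps_swap[of e, symmetric] two_caps_half_neg by simp
    have "emeasure lebesgue (?E \<inter> half_neg e) = ennreal v"
      using emeasure_two_caps_half_neg[OF e dim2 r(1)[OF t1], of t] t1 r(2)[OF t1] dim by simp
    moreover have "emeasure lebesgue (two_caps e \<tau> R \<sigma> S \<inter> half_neg e) = ennreal v"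
      using emeasure_two_caps_half_neg[OF e dim2 R(1), of \<tau>] \<tau> dim by (simp add: v_def)
    ultimately have "admissible e \<rho>m \<rho>p Vm Vp ?E"
      using min finite_perimeter_two_caps[OF e dim2 r(1)[OF t1] R(2)] right
      unfolding minimizer_def admissible_def by simp
    then have "energy e \<rho>m \<rho>p \<gamma> (two_caps e \<tau> R \<sigma> S) \<le> energy e \<rho>m \<rho>p \<gamma> ?E"
      using min unfolding minimizer_def by blast
    moreover have "energy e \<rho>m \<rho>p \<gamma> (two_caps e \<tau> R \<sigma> S) = ennreal (f \<tau> + \<rho>p * cap_perimeter n \<sigma> S)"
      unfolding energy_two_caps[OF e dim R \<tau> coeff ne] f_def
      using perim[OF \<tau>(1)] area[of \<tau>] sgabs[OF sg] by (simp add: r\<tau> add_ac)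
    moreover have "energy e \<rho>m \<rho>p \<gamma> ?E = ennreal (f t + \<rho>p * cap_perimeter n \<sigma> S)"
    proof -
      have "cap_area n t (r t) \<noteq> cap_area n \<sigma> S" using pos area[of t] by auto
      from energy_two_caps[OF e dim r(1)[OF t1] R(2) t1 \<tau>(2) coeff this]
      show ?thesis unfolding f_def using perim[OF t1] area[of t] sgabs[OF pos] by (simp add: add_ac)
    qed
    ultimately have le: "ennreal (f \<tau> + \<rho>p * cap_perimeter n \<sigma> S) \<le> ennreal (f t + \<rho>p * cap_perimeter n \<sigma> S)" by simp
    \<comment> \<open>\<open>ennreal\<close> truncates negative reals to 0, so the inequality
      descends to the reals only once its right-hand side is known to be nonnegative.\<close>
    have "P t > 0" using perim[OF t1] cap_perimeter_pos[OF t1 r(1)[OF t1] dim(2)] by simp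
    then have "0 \<le> \<rho>m * P t" "0 \<le> \<gamma> * (sg * (D t - cap_area n \<sigma> S))" "0 \<le> \<rho>p * cap_perimeter n \<sigma> S"
      using mult_nonneg_nonneg[OF coeff(3) less_imp_le[OF pos]] coeff cap_perimeter_pos[OF \<tau>(2) R(2) dim(2)] by simp_all
    then have "0 \<le> f t + \<rho>p * cap_perimeter n \<sigma> S" unfolding f_def by linarith
    then show ?thesis using le by (simp add: ennreal_le_iff)
  qed simp
  then have "\<rho>m * (\<tau> * D') + \<gamma> * (sg * (D' - 0)) = 0"
    by (intro DERIV_local_min[OF df d]) auto
  then have "D' * (\<rho>m * \<tau> + \<gamma> * sg) = 0" by (simp add: algebra_simps)
  then show ?thesis using D'pos by (simp add: sg_def)
qed

section \<open>Excluding tangency, and the conclusion\<close>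

text \<open>For \<tau> = -1 the ball touches the interface at the origin only, whereas a sphere of
  positive radius in the interface has two opposite points. With \<tau> = - cos \<alpha> on the left
  and cos \<beta> on the right this rules out \<alpha> = 0 and \<beta> = \<pi>.\<close>

lemma interface_sphere_two_caps:
  fixes e :: "'a::euclidean_space"
  assumes e: "e \<in> Basis \<or> - e \<in> Basis" and dim: "DIM('a) \<ge> 2" and R: "R > 0"
    and sph: "interface_sphere e (closure (Gamma_neg e (two_caps e \<tau> R \<sigma> S)) - Gamma_neg e (two_caps e \<tau> R \<sigma> S)) s"
  shows "\<tau> \<noteq> - 1"
proof
  assume \<tau>: "\<tau> = - 1"
  let ?E = "two_caps e \<tau> R \<sigma> S" and ?B = "cball ((\<tau> * R) *\<^sub>R e) R"
  have ee: "e \<bullet> e = 1" using e inner_same_Basis[of "-e"] inner_same_Basis[of e] by auto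
  have "Gamma_neg e ?E \<subseteq> ?E \<inter> half_neg e"
    using bdry_subset_closed[OF closed_two_caps] unfolding Gamma_neg_def by blast
  also have "\<dots> \<subseteq> ?B" unfolding two_caps_half_neg by simp
  finally have cl: "closure (Gamma_neg e ?E) \<subseteq> ?B" by (intro closure_minimal) auto
  obtain z where z: "z \<in> interface e" "s > 0"
    "closure (Gamma_neg e ?E) - Gamma_neg e ?E = sphere z s \<inter> interface e"
    using sph by (auto simp: interface_sphere_def)
  have zero: "x = 0" if "x \<in> sphere z s \<inter> interface e" for x
  proof -
    have "x \<in> ?B" using that z(3) cl by blast
    moreover have "x \<bullet> e = 0" using that by (simp add: interface_def)
    ultimately have "norm x \<le> R * sqrt (1 - \<tau>\<^sup>2)"
      using mem_ball_interface(1)[OF ee _ R, of x \<tau>] \<tau> by (simp del: mem_cball)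
    then show ?thesis using \<tau> by simp
  qed
  \<comment> \<open>A direction within the interface, available because the dimension is at least
    2.\<close>
  have "\<exists>u\<in>Basis. u \<noteq> e \<and> u \<noteq> - e"
  proof (rule ccontr)
    assume "\<not> ?thesis"
    then have "Basis \<subseteq> {e} \<or> Basis \<subseteq> {- e}"
      using e by (metis insertCI insert_absorb nonzero_Basis inner_not_same_Basis subsetI inner_minus_right ee
          neg_equal_0_iff_equal singletonD one_neq_zero minus_minus singletonI)
    then have "card (Basis :: 'a set) \<le> 1" by (metis card.empty card_insert_disjoint card_mono empty_iff finite.emptyI finite_insert One_nat_def)
    then show False using dim by simp
  qed
  then obtain u where u: "u \<in> Basis" "u \<noteq> e" "u \<noteq> - e" by blast
  have ue: "u \<bullet> e = 0"
    using e u inner_not_same_Basis[of u e] inner_not_same_Basis[of u "- e"] by auto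
  have "z + s *\<^sub>R u \<in> sphere z s \<inter> interface e" "z - s *\<^sub>R u \<in> sphere z s \<inter> interface e"
    using z(1,2) u(1) ue by (auto simp: interface_def inner_add_left inner_diff_left dist_norm)
  then have "z + s *\<^sub>R u = 0" "z - s *\<^sub>R u = 0" using zero by blast+
  then have "(2 * s) *\<^sub>R u = 0" by (metis diff_add_cancel add_diff_cancel_left' mult_2 scaleR_add_left add_0 diff_0 minus_unique eq_iff_diff_eq_0)
  then show False using z(2) u(1) nonzero_Basis by auto
qed

lemma candidate_eq_two_caps: "candidate e \<alpha> \<beta> Rm Rp = two_caps e (- cos \<alpha>) Rm (cos \<beta>) Rp"
proof -
  have centers: "(- Rm * cos \<alpha>) *\<^sub>R e = (- cos \<alpha> * Rm) *\<^sub>R e" "(- Rp * cos \<beta>) *\<^sub>R e = (cos \<beta> * Rp) *\<^sub>R (- e)"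
    by (simp_all add: mult.commute)
  have "{x. x \<bullet> e \<ge> 0} = {x. x \<bullet> (- e) \<le> 0}" by auto
  then show ?thesis unfolding candidate_def two_caps_def centers by simp
qed

lemma abs_cos_less_1: "0 < x \<Longrightarrow> x < pi \<Longrightarrow> \<bar>cos x\<bar> < 1"
  using cos_monotone_0_pi[of 0 x] cos_monotone_0_pi[of x pi] by (simp add: abs_less_iff)

lemma cap_area_sin:
  assumes "0 < x" "x < pi" "R > 0" "\<tau>\<^sup>2 = (cos x)\<^sup>2"
  shows "cap_area n \<tau> R = unit_ball_vol n * (R * sin x) ^ n"
proof -
  have "\<bar>\<tau>\<bar> < 1" using abs_cos_less_1[OF assms(1,2)] assms(4) by (metis power2_abs power2_eq_iff abs_abs abs_minus_cancel)
  moreover have "sqrt (1 - \<tau>\<^sup>2) = sin x"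
    using assms sin_gt_zero[OF assms(1,2)] by (simp add: assms(4) sin_squared_eq[symmetric])
  ultimately show ?thesis using cap_area_eq[of \<tau> R n] assms by (simp add: cap_area_def)
qed

theorem theorem4p5:
  fixes e1 :: "'a::euclidean_space"
    and \<rho>m \<rho>p \<gamma> Vm Vp \<alpha> \<beta> Rm Rp :: real
  assumes "DIM('a) \<ge> 2" and "e1 \<in> Basis"
    and "Vm > 0" and "Vp > 0" and "\<rho>m > 0" and "\<rho>p > 0" and "\<gamma> \<ge> 0"
    and "0 \<le> \<alpha>" and "\<alpha> < pi" and "0 < \<beta>" and "\<beta> \<le> pi" and "Rm > 0" and "Rp > 0"
    and "minimizer e1 \<rho>m \<rho>p \<gamma> Vm Vp (candidate e1 \<alpha> \<beta> Rm Rp)"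
    and "type_II e1 (candidate e1 \<alpha> \<beta> Rm Rp)"
  shows "(Rm * sin \<alpha> > Rp * sin \<beta> \<longrightarrow> \<rho>m * cos \<alpha> = \<gamma> \<and> \<gamma> = \<rho>p * cos \<beta>) \<and>
         (Rm * sin \<alpha> < Rp * sin \<beta> \<longrightarrow> \<rho>m * cos \<alpha> = - \<gamma> \<and> - \<gamma> = \<rho>p * cos \<beta>)"
proof -
  define n where "n = DIM('a) - 1"
  have n: "DIM('a) = Suc n" "n > 0" using assms(1) by (auto simp: n_def)
  let ?\<tau> = "- cos \<alpha>" and ?\<sigma> = "cos \<beta>"
  let ?E = "two_caps e1 ?\<tau> Rm ?\<sigma> Rp"
  have e: "e1 \<in> Basis \<or> - e1 \<in> Basis" and e': "- e1 \<in> Basis \<or> - (- e1) \<in> Basis" using assms(2) by auto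
  have hn: "half_neg (- e1) = half_pos e1" "half_pos (- e1) = half_neg e1" "interface (- e1) = interface e1"
    by (auto simp: half_neg_def half_pos_def interface_def)
  have min: "minimizer e1 \<rho>m \<rho>p \<gamma> Vm Vp ?E" using assms(14) by (simp add: candidate_eq_two_caps)
  \<comment> \<open>Reflection exchanges the half spaces together with their densities and volumes,
    while the contact term is unchanged.\<close>
  then have min': "minimizer (- e1) \<rho>p \<rho>m \<gamma> Vp Vm (two_caps (- e1) ?\<sigma> Rp ?\<tau> Rm)"
    unfolding two_caps_swap minimizer_def admissible_def energy_def Gamma_zero_def hn
    by (auto simp: add_ac)
  obtain sm sp where "interface_sphere e1 (closure (Gamma_neg e1 ?E) - Gamma_neg e1 ?E) sm"
    and "interface_sphere e1 (closure (Gamma_pos e1 ?E) - Gamma_pos e1 ?E) sp"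
    using assms(15) unfolding type_II_def candidate_eq_two_caps by blast
  moreover have "Gamma_pos e1 ?E = Gamma_neg (- e1) (two_caps (- e1) ?\<sigma> Rp ?\<tau> Rm)"
    by (simp add: two_caps_swap Gamma_pos_def Gamma_neg_def hn)
  moreover have "interface_sphere e1 = interface_sphere (- e1)"
    by (intro ext) (simp add: interface_sphere_def hn)
  ultimately have "?\<tau> \<noteq> - 1" "?\<sigma> \<noteq> - 1"
    using interface_sphere_two_caps[OF e assms(1,12)] interface_sphere_two_caps[OF e' assms(1,13)] by metis+
  then have "\<alpha> \<noteq> 0" "\<beta> \<noteq> pi" by auto
  then have \<alpha>: "0 < \<alpha>" "\<alpha> < pi" and \<beta>: "0 < \<beta>" "\<beta> < pi" using assms by auto
  have \<tau>: "\<bar>?\<tau>\<bar> < 1" "\<bar>?\<sigma>\<bar> < 1" using abs_cos_less_1[OF \<alpha>] abs_cos_less_1[OF \<beta>] by auto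
  define r1 where "r1 = Rm * sin \<alpha>"
  define r0 where "r0 = Rp * sin \<beta>"
  define \<omega> where "\<omega> = unit_ball_vol (real n)"
  have r: "r1 > 0" "r0 > 0" using sin_gt_zero[OF \<alpha>] sin_gt_zero[OF \<beta>] assms by (auto simp: r0_def r1_def)
  have \<omega>: "\<omega> > 0" by (simp add: \<omega>_def)
  have area: "cap_area n ?\<tau> Rm = \<omega> * r1 ^ n" "cap_area n ?\<sigma> Rp = \<omega> * r0 ^ n"
    using cap_area_sin[OF \<alpha> assms(12), of ?\<tau> n] cap_area_sin[OF \<beta> assms(13), of ?\<sigma> n]
    by (auto simp: r0_def r1_def \<omega>_def)
  \<comment> \<open>The two balances carry opposite signs of the difference of the areas, and the
    parameters - cos \<alpha> and cos \<beta> have opposite signs in front of the cosines; hence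
    both cosines come out with the same sign.\<close>
  note balance = minimizer_two_caps_balance[OF e n assms(12,13) \<tau> assms(5-7) min]
  note balance' = minimizer_two_caps_balance[OF e' n assms(13,12) \<tau>(2,1) assms(6,5,7) min']
  have "\<rho>m * cos \<alpha> = \<gamma> \<and> \<gamma> = \<rho>p * cos \<beta>" if "r1 > r0"
  proof -
    \<comment> \<open>The hypothesis compares rim radii, the balances compare disc areas; strict
      monotonicity of powers connects them because \<open>n > 0\<close>.\<close>
    have less: "\<omega> * r0 ^ n < \<omega> * r1 ^ n" using that r \<omega> n by (simp add: power_strict_mono)
    then have "sgn (\<omega> * r1 ^ n - \<omega> * r0 ^ n) = 1" "sgn (\<omega> * r0 ^ n - \<omega> * r1 ^ n) = - 1" by simp_all
    moreover have "\<omega> * r1 ^ n \<noteq> \<omega> * r0 ^ n" using less by (metis less_irrefl)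
    ultimately have "\<rho>m * ?\<tau> + \<gamma> * (1) = 0" "\<rho>p * ?\<sigma> + \<gamma> * (- 1) = 0"
      using balance balance' unfolding area by metis+
    then show ?thesis by auto
  qed
  moreover have "\<rho>m * cos \<alpha> = - \<gamma> \<and> - \<gamma> = \<rho>p * cos \<beta>" if "r1 < r0"
  proof -
    have less: "\<omega> * r1 ^ n < \<omega> * r0 ^ n" using that r \<omega> n by (simp add: power_strict_mono)
    then have "sgn (\<omega> * r1 ^ n - \<omega> * r0 ^ n) = - 1" "sgn (\<omega> * r0 ^ n - \<omega> * r1 ^ n) = 1" by simp_all
    moreover have "\<omega> * r1 ^ n \<noteq> \<omega> * r0 ^ n" using less by (metis less_irrefl)
    ultimately have "\<rho>m * ?\<tau> + \<gamma> * (- 1) = 0" "\<rho>p * ?\<sigma> + \<gamma> * (1) = 0"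
      using balance balance' unfolding area by metis+
    then show ?thesis by auto
  qed
  ultimately show ?thesis by (simp add: r0_def r1_def)
qed

end
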